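(* Let $c>0$ and $\delta>0$. Then $$\psi_{\delta,\infty}(u)\sim \mathcal{H}_{2c^2\delta}\,\psi_\infty(u),\qquad u\to\infty,$$ and further, for any $s\in\mathbb{R}$, $$\lim_{u\to\infty}\mathbb{P}\left\{ \frac{c^{3/2}\,(\tau_\delta(u)-u/c)}{\sqrt{u}}\le s \;\Big|\; \tau_\delta(u)<\infty\right\}=\Phi(s),$$ where $\Phi$ is the distribution function of a standard Gaussian random variable.
   Context: $B$ is a standard Brownian motion, $c>0$ is a fixed constant (premium rate), and $u>0$ is the initial capital. The risk process is $R_u(t)=u+ct-B(t)$, $t\ge 0$. For $\delta>0$ the uniform grid is $G(\delta)=\{0,\delta,2\delta,\ldots\}$. Continuous-time ruin probability: $\psi_\infty(u)=\mathbb{P}\{\inf_{t\ge 0}R_u(t)<0\}=e^{-2cu}$. Discrete-time ruin probability: $\psi_{\delta,\infty}(u)=\mathbb{P}\{\inf_{t\in G(\delta)}R_u(t)<0\}=\mathbb{P}\{\sup_{t\in G(\delta)}(B(t)-ct)>u\}$. Discrete ruin time: $\tau_\delta(u)=\inf\{t\in G(\delta): B(t)-ct>u\}$ (with $\inf\emptyset=\infty$). Pickands constant: for $\eta>0$, $$\mathcal{H}_\eta=\frac1\eta\,\mathbb{E}\left\{\frac{\sup_{t\in\eta\mathbb{Z}}e^{W(t)}}{\sum_{t\in\eta\mathbb{Z}}e^{W(t)}}\right\}=\frac1\eta\,\mathbb{E}\left\{\max_{t\ge0,\,t\in\eta\mathbb{Z}}e^{W(t)}-\max_{t\ge\eta,\,t\in\eta\mathbb{Z}}e^{W(t)}\right\}\in(0,\infty),$$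 where $W(t)=\sqrt2\,B(t)-|t|$, $t\in\mathbb{R}$, with $B$ here a two-sided standard Brownian motion, and $\eta\mathbb{Z}=\{\eta k:k\in\mathbb{Z}\}$. $f(u)\sim g(u)$ as $u\to\infty$ means $f(u)/g(u)\to1$. *)

theory Defs
  imports "HOL-Probability.Probability" "HOL-Library.Landau_Symbols"
begin

text \<open>
  Standard Brownian motion with time set \<open>T\<close>: \<open>T = {0..}\<close> gives the usual one-sided process and
  \<open>T = UNIV\<close> the two-sided one, whose increments over \<open>(-\<infinity>, \<infinity>)\<close> are independent, so that
  \<open>t \<mapsto> B t\<close> and \<open>t \<mapsto> B (-t)\<close> on \<open>{0..}\<close> are independent one-sided Brownian motions.
  Continuity is required of every path, which makes infima over the uncountable time set \<open>{0..}\<close>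
  measurable without completing \<open>M\<close>.
\<close>

locale brownian_motion = prob_space M for M :: "'a measure" +
  fixes T :: "real set" and B :: "real \<Rightarrow> 'a \<Rightarrow> real"
  assumes measurable_B: "\<And>t. t \<in> T \<Longrightarrow> B t \<in> borel_measurable M"
    and B_zero: "AE \<omega> in M. B 0 \<omega> = 0"
    and indep_increments:
      "\<And>(t :: nat \<Rightarrow> real) n. incseq t \<Longrightarrow> range t \<subseteq> T \<Longrightarrow>
         indep_vars (\<lambda>_. borel) (\<lambda>i \<omega>. B (t (Suc i)) \<omega> - B (t i) \<omega>) {..<n}"
    and gaussian_increments:
      "\<And>s t. s \<in> T \<Longrightarrow> t \<in> T \<Longrightarrow> s < t \<Longrightarrow>
         distributed M lborel (\<lambda>\<omega>. B t \<omega> - B s \<omega>) (normal_density 0 (sqrt (t - s)))"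
    and continuous_paths: "\<And>\<omega>. \<omega> \<in> space M \<Longrightarrow> continuous_on T (\<lambda>t. B t \<omega>)"

abbreviation standard_brownian_motion :: "'a measure \<Rightarrow> (real \<Rightarrow> 'a \<Rightarrow> real) \<Rightarrow> bool" where
  "standard_brownian_motion M B \<equiv> brownian_motion M {0..} B"

abbreviation two_sided_brownian_motion :: "'a measure \<Rightarrow> (real \<Rightarrow> 'a \<Rightarrow> real) \<Rightarrow> bool" where
  "two_sided_brownian_motion M B \<equiv> brownian_motion M UNIV B"

definition grid :: "real \<Rightarrow> real set" where
  "grid \<delta> = range (\<lambda>k::nat. \<delta> * of_nat k)"

definition int_grid :: "real \<Rightarrow> real set" where
  "int_grid \<eta> = range (\<lambda>k::int. \<eta> * of_int k)"

definition risk_process :: "(real \<Rightarrow> 'a \<Rightarrow> real) \<Rightarrow> real \<Rightarrow> real \<Rightarrow> real \<Rightarrow> 'a \<Rightarrow> real" where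
  "risk_process B c u t \<omega> = u + c * t - B t \<omega>"

text \<open>Infima are taken in \<^typ>\<open>ereal\<close>, so that paths unbounded below and the empty set
  (\<open>Inf {} = \<infinity>\<close>) receive their usual values.\<close>

definition ruin_prob :: "'a measure \<Rightarrow> (real \<Rightarrow> 'a \<Rightarrow> real) \<Rightarrow> real \<Rightarrow> real \<Rightarrow> real" where
  "ruin_prob M B c u = \<P>(\<omega> in M. (INF t\<in>{0..}. ereal (risk_process B c u t \<omega>)) < 0)"

definition discrete_ruin_prob ::
    "'a measure \<Rightarrow> (real \<Rightarrow> 'a \<Rightarrow> real) \<Rightarrow> real \<Rightarrow> real \<Rightarrow> real \<Rightarrow> real" where
  "discrete_ruin_prob M B c \<delta> u =
     \<P>(\<omega> in M. (INF t\<in>grid \<delta>. ereal (risk_process B c u t \<omega>)) < 0)"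

definition discrete_ruin_time ::
    "(real \<Rightarrow> 'a \<Rightarrow> real) \<Rightarrow> real \<Rightarrow> real \<Rightarrow> real \<Rightarrow> 'a \<Rightarrow> ereal" where
  "discrete_ruin_time B c \<delta> u \<omega> = Inf (ereal ` {t \<in> grid \<delta>. B t \<omega> - c * t > u})"

text \<open>
  The Pickands constant \<open>H\<^sub>\<eta>\<close>, computed from a two-sided Brownian motion \<open>B\<close> on \<open>N\<close>.
  Almost surely the series converges and hence the supremum is finite; on the remaining null set
  the series evaluates to \<open>0\<close>, and so does the quotient.
\<close>

definition pickands_process :: "(real \<Rightarrow> 'a \<Rightarrow> real) \<Rightarrow> real \<Rightarrow> 'a \<Rightarrow> real" where
  "pickands_process B t \<omega> = sqrt 2 * B t \<omega> - \<bar>t\<bar>"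

definition pickands_constant :: "'a measure \<Rightarrow> (real \<Rightarrow> 'a \<Rightarrow> real) \<Rightarrow> real \<Rightarrow> real" where
  "pickands_constant N B \<eta> =
     1 / \<eta> * (\<integral>\<omega>. (SUP t\<in>int_grid \<eta>. exp (pickands_process B t \<omega>)) /
                  (\<Sum>\<^sub>\<infinity>t\<in>int_grid \<eta>. exp (pickands_process B t \<omega>)) \<partial>N)"

end

theory Submission
  imports Defs "HOL-Real_Asymp.Real_Asymp"
begin

text \<open>
  With \<open>\<eta> = 2c\<^sup>2\<delta>\<close> and \<open>x = 2cu\<close>, the process \<open>2c(B(t) - ct)\<close> on the grid is a random walk \<open>V\<close> with
  \<open>N(-\<eta>, 2\<eta>)\<close> steps, to be compared with the level \<open>x\<close>. Splitting according to the last visit above \<open>x\<close>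
  gives, with \<open>g\<^sub>i(y) = P(V\<^sub>1, \<dots>, V\<^sub>i \<le> -y)\<close> and \<open>h\<^sub>z(t)\<close> the density of \<open>N(t, 2t)\<close> at \<open>z\<close>,
  \<open>e\<^sup>x P(max\<^sub>k\<^sub>\<le>\<^sub>n V\<^sub>k > x) = \<integral>\<^sub>0\<^sup>\<infinity> e\<^sup>-\<^sup>y \<Sum>\<^sub>k\<^sub>\<le>\<^sub>n h\<^sub>x\<^sub>+\<^sub>y(\<eta>k) g\<^sub>n\<^sub>-\<^sub>k(y) dy\<close>.
  The function \<open>h\<^sub>z\<close> has an explicit antiderivative in \<open>t\<close> in terms of the normal distribution
  function and is unimodal with small maximum, so the sum over \<open>k\<close> is, uniformly in \<open>n\<close>, close to
  \<open>1/\<eta>\<close> times a distribution function. This yields \<open>e\<^sup>x P(max V > x) \<rightarrow> G/\<eta>\<close> with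
  \<open>G = \<integral>\<^sub>0\<^sup>\<infinity> e\<^sup>-\<^sup>y P(max\<^sub>k\<^sub>\<ge>\<^sub>1 V\<^sub>k \<le> -y) dy\<close>, and the central limit theorem for the ruin time.

  Let \<open>r\<close> be the ratio of maximum and sum of \<open>exp W\<close> over a window. Both \<open>G\<close> and the mean of \<open>r\<close> over
  \<open>\<int>\<close> are Cesaro limits of \<open>E max\<^sub>0\<^sub>\<le>\<^sub>k\<^sub>\<le>\<^sub>n exp(V\<^sub>k)\<close>: peel off the first point, or expand the maximum as
  \<open>\<Sum>\<^sub>k exp(V\<^sub>k) r\<close> and absorb \<open>exp(V\<^sub>k)\<close> by a change of measure. Hence \<open>G/\<eta>\<close> is the Pickands constant.

  The error bounds are also uniform as the mesh tends to \<open>0\<close>, which shows that \<open>e\<^sup>x P(sup 2c(B(t) - ct) > x)\<close>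
  does not depend on \<open>x > 0\<close>; the Markov property at a small time identifies this constant as \<open>1\<close>.
\<close>

subsection \<open>The Gaussian renewal density\<close>

abbreviation Phi :: "real \<Rightarrow> real" where
  "Phi \<equiv> cdf std_normal_distribution"

interpretation std_normal: real_distribution std_normal_distribution
  by (rule real_dist_normal_dist)

lemma continuous_on_normal_density: "\<sigma> \<noteq> 0 \<Longrightarrow> continuous_on A (normal_density \<mu> \<sigma>)"
  unfolding normal_density_def by (intro continuous_intros) auto

text \<open>Near \<open>x\<close> the distribution function is its value at a base point left of
  \<open>x\<close> plus the integral of the continuous density, so the fundamental theorem of
  calculus applies.\<close>

lemma Phi_has_real_derivative:
  "(Phi has_real_derivative std_normal_density x) (at x)"
proof -
  define a where "a = x - 1"
  have fint: "std_normal_density absolutely_integrable_on {a..x+1}"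
    by (intro absolutely_integrable_continuous_real continuous_on_normal_density) simp
  have cdf_eq: "Phi y = Phi a + integral {a..y} std_normal_density" if "y \<in> {a..x+1}" for y
  proof (cases "a = y")
    case False
    then have ay: "a < y" using that by auto
    have "Phi y - Phi a = measure std_normal_distribution {a<..y}"
      by (rule std_normal.cdf_diff_eq[OF ay])
    also have "\<dots> = (\<integral>t. indicator {a<..y} t \<partial>std_normal_distribution)"
      by simp
    also have "\<dots> = (\<integral>t\<in>{a<..y}. std_normal_density t \<partial>lborel)"
      by (subst integral_density) (auto simp: set_lebesgue_integral_def mult.commute)
    also have "\<dots> = (\<integral>t\<in>{a..y}. std_normal_density t \<partial>lborel)"
    proof (rule set_integral_null_delta)
      have "sym_diff {a<..y} {a..y} = {a}" using ay by auto
      then show "sym_diff {a<..y} {a..y} \<in> null_sets lborel"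
        by (simp add: countable_imp_null_set_lborel)
    qed simp_all
    also have "\<dots> = integral {a..y} std_normal_density"
      by (rule set_borel_integral_eq_integral)
         (auto intro!: borel_integrable_atLeastAtMost' continuous_on_normal_density)
    finally show ?thesis by simp
  qed simp
  have "((\<lambda>y. Phi a + integral {a..y} std_normal_density) has_real_derivative std_normal_density x)
      (at x within {a..x+1})"
    by (rule derivative_eq_intros integral_has_real_derivative | 
        auto simp: a_def intro!: continuous_on_normal_density)+
  moreover have "at x within {a..x+1} = at x"
    by (rule at_within_interior) (simp add: a_def)
  ultimately have "((\<lambda>y. Phi a + integral {a..y} std_normal_density) has_real_derivative std_normal_density x) (at x)"
    by simp
  then show ?thesis
    by (rule has_field_derivative_transform_within_open[where S="{a<..<x+1}"])
       (auto simp: a_def intro!: cdf_eq[symmetric, unfolded a_def])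
qed

lemma std_normal_density_has_real_derivative:
  "(std_normal_density has_real_derivative - x * std_normal_density x) (at x)"
  unfolding normal_density_def
  by (auto intro!: derivative_eq_intros simp: field_simps)

text \<open>Mills ratio bound. The function \<open>K\<close> has derivative
  \<open>- std_normal_density x / x\<^sup>2\<close> and limit 1 at infinity, so on the positive axis
  it decreases to 1 and stays at least 1.\<close>

lemma one_minus_Phi_le:
  assumes "b > 0" shows "1 - Phi b \<le> std_normal_density b / b"
proof -
  define K where "K b = std_normal_density b / b + Phi b" for b
  have K_lim: "(K \<longlongrightarrow> 0 + 1) at_top"
    unfolding K_def
  proof (intro tendsto_add std_normal.cdf_lim_at_top_prob)
    show "((\<lambda>b. std_normal_density b / b) \<longlongrightarrow> 0) at_top"
      unfolding normal_density_def by real_asymp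
  qed
  have "K c \<le> K b" if "b \<le> c" for c
  proof (rule DERIV_nonpos_imp_nonincreasing[OF that])
    fix x assume "b \<le> x"
    with assms have "x > 0" by simp
    then have "(K has_real_derivative - std_normal_density x / x\<^sup>2) (at x)"
      unfolding K_def
      by (auto intro!: derivative_eq_intros std_normal_density_has_real_derivative
          Phi_has_real_derivative simp: field_simps power2_eq_square)
    moreover have "- std_normal_density x / x\<^sup>2 \<le> 0" by simp
    ultimately show "\<exists>y. (K has_real_derivative y) (at x) \<and> y \<le> 0" by blast
  qed
  then have "0 + 1 \<le> K b"
    by (intro tendsto_upperbound[OF K_lim]) (auto simp: eventually_at_top_linorder)
  then show ?thesis by (simp add: K_def)
qed

section \<open>The renewal density and its antiderivative in time\<close>

definition hit_kernel :: "real \<Rightarrow> real \<Rightarrow> real" where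
  "hit_kernel z t = exp (- (z - t)\<^sup>2 / (4 * t)) / sqrt (4 * pi * t)"

text \<open>For \<open>z > 0\<close> this is the distribution function of the last passage time at
  level \<open>z\<close> for Brownian motion with drift 1 and variance 2 per unit time. A plus sign
  in front of the exponential would give the inverse Gaussian law of the first passage.\<close>

definition hit_cdf :: "real \<Rightarrow> real \<Rightarrow> real" where
  "hit_cdf z t = (if t \<le> 0 then 0
     else Phi ((t - z) / sqrt (2 * t)) - exp z * (1 - Phi ((t + z) / sqrt (2 * t))))"

lemma hit_kernel_nonneg: "t \<ge> 0 \<Longrightarrow> hit_kernel z t \<ge> 0"
  by (simp add: hit_kernel_def)

lemma hit_kernel_le: "t > 0 \<Longrightarrow> hit_kernel z t \<le> 1 / sqrt (4 * pi * t)"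
  unfolding hit_kernel_def by (intro divide_right_mono) auto

text \<open>Completing the square. This tilt from drift \<open>- t\<close> to drift \<open>t\<close>
  produces the factor \<open>exp (- v)\<close> that governs the decay of the ruin
  probability.\<close>

lemma normal_density_eq_hit_kernel:
  assumes "t > 0"
  shows "normal_density (- t) (sqrt (2 * t)) v = exp (- v) * hit_kernel v t"
proof -
  have "- (v + t)\<^sup>2 / (4 * t) = - v + - (v - t)\<^sup>2 / (4 * t)"
    using assms by (simp add: field_simps power2_eq_square)
  then have "exp (- (v + t)\<^sup>2 / (4 * t)) = exp (- v) * exp (- (v - t)\<^sup>2 / (4 * t))"
    by (simp only: exp_add)
  then show ?thesis
    using assms by (simp add: normal_density_def hit_kernel_def mult_ac)
qed

text \<open>It gives both terms in the derivative of \<open>hit_cdf\<close> the same Gaussian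
  factor, and it also controls the product of \<open>exp z\<close> with a normal tail.\<close>

lemma exp_times_std_normal_density:
  assumes "t > 0"
  shows "exp z * std_normal_density ((t + z) / sqrt (2 * t)) = std_normal_density ((t - z) / sqrt (2 * t))"
proof -
  have "z - (t + z)\<^sup>2 / (4 * t) = - (t - z)\<^sup>2 / (4 * t)"
    using assms by (simp add: field_simps power2_eq_square)
  then have "exp z * exp (- (t + z)\<^sup>2 / (4 * t)) = exp (- (t - z)\<^sup>2 / (4 * t))"
    by (simp flip: exp_add)
  then show ?thesis
    using assms by (simp add: std_normal_density_def power_divide)
qed

text \<open>With the common Gaussian factor \<open>p\<close>, the inner derivatives
  \<open>(t + z) / (2 * t * r)\<close> and \<open>(t - z) / (2 * t * r)\<close> add up to
  \<open>1 / r\<close>.\<close>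

lemma hit_cdf_has_real_derivative:
  assumes "t > 0"
  shows "(hit_cdf z has_real_derivative hit_kernel z t) (at t)"
proof -
  define r where "r = sqrt (2 * t)"
  have r: "r > 0" "r * r = 2 * t" using assms by (auto simp: r_def)
  have r': "sqrt (2 * t) = r" "sqrt (t * 2) = r" by (simp_all add: r_def mult.commute)
  define p where "p = std_normal_density ((t - z) / r)"
  have d: "((\<lambda>t. (t + w) / sqrt (2 * t)) has_real_derivative (t - w) / (2 * t * r)) (at t)" for w
    using assms r by (auto intro!: derivative_eq_intros simp: r' field_simps)
  have ab: "((\<lambda>t. Phi ((t + - z) / sqrt (2 * t)) - exp z * (1 - Phi ((t + z) / sqrt (2 * t))))
      has_real_derivative (std_normal_density ((t + - z) / sqrt (2 * t)) * ((t - - z) / (2 * t * r))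
        - exp z * (0 - std_normal_density ((t + z) / sqrt (2 * t)) * ((t - z) / (2 * t * r))))) (at t)"
    by (intro DERIV_diff DERIV_cmult DERIV_const DERIV_chain2[OF Phi_has_real_derivative d])
  have "std_normal_density ((t + - z) / sqrt (2 * t)) * ((t - - z) / (2 * t * r))
        - exp z * (0 - std_normal_density ((t + z) / sqrt (2 * t)) * ((t - z) / (2 * t * r)))
      = p * ((t + z) / (2 * t * r)) + (exp z * std_normal_density ((t + z) / sqrt (2 * t))) * ((t - z) / (2 * t * r))"
    by (simp add: p_def r_def)
  also have "\<dots> = p / r"
    unfolding exp_times_std_normal_density[OF assms] unfolding r_def[symmetric] p_def[symmetric]
    using assms r by (simp add: field_simps)
  also have "\<dots> = hit_kernel z t"
  proof -
    have "sqrt (2 * pi) * r = sqrt (4 * pi * t)"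
      by (simp add: r_def flip: real_sqrt_mult)
    moreover have "r\<^sup>2 = 2 * t" using r by (simp add: power2_eq_square)
    ultimately show ?thesis
      by (simp add: p_def hit_kernel_def std_normal_density_def power_divide power2_commute[of z])
  qed
  finally have "((\<lambda>t. Phi ((t + - z) / sqrt (2 * t)) - exp z * (1 - Phi ((t + z) / sqrt (2 * t))))
      has_real_derivative hit_kernel z t) (at t)"
    using ab by simp
  then show ?thesis
    by (rule has_field_derivative_transform_within_open[where S="{0<..}"])
       (use assms in \<open>auto simp: hit_cdf_def\<close>)
qed

lemma hit_cdf_le_1: "hit_cdf z t \<le> 1"
proof -
  have "0 \<le> exp z * (1 - Phi b)" for b
    using std_normal.cdf_bounded_prob[of b] by simp
  then show ?thesis
    unfolding hit_cdf_def using std_normal.cdf_bounded_prob[of "(t - z) / sqrt (2 * t)"]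
    by (smt (verit, best))
qed

lemma isCont_Phi: "isCont Phi x"
  using DERIV_isCont Phi_has_real_derivative by blast

text \<open>Only \<open>t = 0\<close> is delicate: there \<open>z > 0\<close> forces the two
  arguments of \<open>Phi\<close> to minus and plus infinity, so both terms vanish.\<close>

lemma continuous_on_hit_cdf:
  assumes "z > 0" shows "continuous_on {0..} (hit_cdf z)"
  unfolding continuous_on_eq_continuous_within
proof (intro ballI)
  fix t :: real assume "t \<in> {0..}"
  then consider "t = 0" | "t > 0" by fastforce
  then show "continuous (at t within {0..}) (hit_cdf z)"
  proof cases
    case 1
    have "((\<lambda>t. Phi ((t - z) / sqrt (2 * t)) - exp z * (1 - Phi ((t + z) / sqrt (2 * t))))
        \<longlongrightarrow> 0 - exp z * (1 - 1)) (at_right 0)"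
    proof (intro tendsto_intros filterlim_compose[OF std_normal.cdf_lim_at_bot]
        filterlim_compose[OF std_normal.cdf_lim_at_top_prob])
      show "filterlim (\<lambda>t. (t - z) / sqrt (2 * t)) at_bot (at_right 0)"
        using assms by real_asymp
      show "filterlim (\<lambda>t. (t + z) / sqrt (2 * t)) at_top (at_right 0)"
        using assms by real_asymp
    qed
    then have "((\<lambda>t. Phi ((t - z) / sqrt (2 * t)) - exp z * (1 - Phi ((t + z) / sqrt (2 * t))))
        \<longlongrightarrow> 0) (at_right 0)" by simp
    then have "(hit_cdf z \<longlongrightarrow> 0) (at_right 0)"
      by (rule Lim_transform_eventually)
         (use eventually_at_right_less[of 0] in eventually_elim, auto simp: hit_cdf_def)
    then show ?thesis
      using 1 by (simp add: continuous_within at_within_Ici_at_right hit_cdf_def)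
  next
    case 2
    then show ?thesis
      using DERIV_isCont[OF hit_cdf_has_real_derivative] continuous_at_imp_continuous_at_within by blast
  qed
qed

lemma hit_cdf_tendsto_1: "(hit_cdf z \<longlongrightarrow> 1) at_top"
proof -
  have "((\<lambda>t. Phi ((t - z) / sqrt (2 * t)) - exp z * (1 - Phi ((t + z) / sqrt (2 * t))))
        \<longlongrightarrow> 1 - exp z * (1 - 1)) at_top"
    by (intro tendsto_intros filterlim_compose[OF std_normal.cdf_lim_at_top_prob]; real_asymp)
  then have "((\<lambda>t. Phi ((t - z) / sqrt (2 * t)) - exp z * (1 - Phi ((t + z) / sqrt (2 * t)))) \<longlongrightarrow> 1) at_top"
    by simp
  then show ?thesis
    by (rule Lim_transform_eventually)
       (use eventually_gt_at_top[of 0] in eventually_elim, auto simp: hit_cdf_def)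
qed

text \<open>The hypothesis implies that \<open>T x / x\<close> tends to 1, so \<open>T x\<close> may
  replace \<open>x\<close> in the normalisation, and the fixed shift \<open>y\<close> is negligible
  against \<open>sqrt x\<close>. This treats the first term of \<open>hit_cdf\<close>; the second is
  removed by the Mills bound.\<close>

lemma hit_cdf_tendsto_Phi:
  assumes T: "((\<lambda>x. (T x - x) / sqrt (2 * x)) \<longlongrightarrow> s) at_top"
  shows "((\<lambda>x. hit_cdf (x + y) (T x)) \<longlongrightarrow> Phi s) at_top"
proof -
  have "((\<lambda>x. 1 + (T x - x) / sqrt (2 * x) * (sqrt 2 / sqrt x)) \<longlongrightarrow> 1 + s * 0) at_top"
    by (intro tendsto_intros T) real_asymp
  then have "((\<lambda>x. 1 + (T x - x) / sqrt (2 * x) * (sqrt 2 / sqrt x)) \<longlongrightarrow> 1) at_top" by simp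
  then have ratio: "((\<lambda>x. T x / x) \<longlongrightarrow> 1) at_top"
  proof (rule Lim_transform_eventually)
    show "eventually (\<lambda>x. 1 + (T x - x) / sqrt (2 * x) * (sqrt 2 / sqrt x) = T x / x) at_top"
      using eventually_gt_at_top[of 0]
    proof eventually_elim
      case (elim x)
      then have "(T x - x) / sqrt (2 * x) * (sqrt 2 / sqrt x) = (T x - x) / (sqrt x * sqrt x)"
        by (simp add: real_sqrt_mult)
      then show ?case using elim by (simp add: field_simps)
    qed
  qed
  have "filterlim (\<lambda>x. T x / x * x) at_top at_top"
    by (rule filterlim_tendsto_pos_mult_at_top[OF ratio]) (auto simp: filterlim_ident)
  then have Tinf: "filterlim T at_top at_top"
  proof (rule filterlim_mono_eventually)
    show "eventually (\<lambda>x. T x / x * x = T x) at_top"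
      using eventually_gt_at_top[of 0] by eventually_elim simp
  qed auto
  have ev: "eventually (\<lambda>x. x > 0 \<and> x + y > 0 \<and> T x > 0) at_top"
    using eventually_gt_at_top[of 0] eventually_gt_at_top[of "-y"]
      Tinf[THEN filterlim_at_top_dense[THEN iffD1], rule_format, of 0]
    by eventually_elim auto
  have "((\<lambda>x. ((T x - x) / sqrt (2 * x) - y / sqrt (2 * x)) / sqrt (T x / x)) \<longlongrightarrow> (s - 0) / sqrt 1) at_top"
    by (intro tendsto_intros T ratio) (auto, real_asymp)
  then have "((\<lambda>x. ((T x - x) / sqrt (2 * x) - y / sqrt (2 * x)) / sqrt (T x / x)) \<longlongrightarrow> s) at_top" by simp
  then have "((\<lambda>x. (T x - (x + y)) / sqrt (2 * T x)) \<longlongrightarrow> s) at_top"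
    by (rule Lim_transform_eventually)
       (use ev in eventually_elim, auto simp: field_simps real_sqrt_mult real_sqrt_divide)
  then have lim1: "((\<lambda>x. Phi ((T x - (x + y)) / sqrt (2 * T x))) \<longlongrightarrow> Phi s) at_top"
    by (intro isCont_tendsto_compose[OF isCont_Phi])
  have sq: "filterlim (\<lambda>x. sqrt (T x)) at_top at_top"
    by (intro filterlim_compose[OF sqrt_at_top] Tinf)
  have "((\<lambda>x. exp (x + y) * (1 - Phi ((T x + (x + y)) / sqrt (2 * T x)))) \<longlongrightarrow> 0) at_top"
  proof (rule tendsto_sandwich[OF _ _ tendsto_const])
    show "eventually (\<lambda>x. 0 \<le> exp (x + y) * (1 - Phi ((T x + (x + y)) / sqrt (2 * T x)))) at_top"
      using std_normal.cdf_bounded_prob by (intro always_eventually) auto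
    show "((\<lambda>x. sqrt 2 * inverse (sqrt (T x))) \<longlongrightarrow> 0) at_top"
      by (intro tendsto_mult_right_zero tendsto_inverse_0_at_top sq)
    show "eventually (\<lambda>x. exp (x + y) * (1 - Phi ((T x + (x + y)) / sqrt (2 * T x))) \<le> sqrt 2 * inverse (sqrt (T x))) at_top"
      using ev
    proof eventually_elim
      case (elim x)
      define t z where "t = T x" and "z = x + y"
      have tz: "t > 0" "z > 0" using elim by (auto simp: t_def z_def)
      define b where "b = (t + z) / sqrt (2 * t)"
      have b: "b > 0" using tz by (simp add: b_def)
      have "std_normal_density w \<le> 1" for w
      proof -
        have "1 / sqrt (2 * pi) \<le> 1" using pi_gt3 by simp
        moreover have "exp (- w\<^sup>2 / 2) \<le> 1" by simp
        ultimately show ?thesis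
          unfolding std_normal_density_def by (intro mult_le_one) auto
      qed
      then have "exp z * std_normal_density b \<le> 1"
        unfolding b_def exp_times_std_normal_density[OF tz(1)] .
      moreover have "exp z * (1 - Phi b) \<le> exp z * (std_normal_density b / b)"
        using one_minus_Phi_le[OF b] by (intro mult_left_mono) auto
      \<comment> \<open>The factor \<open>exp z\<close> is absorbed by the density at
        \<open>b\<close>, so only the \<open>1 / b\<close> of the Mills bound is left, which is of
        order \<open>1 / sqrt t\<close>.\<close>
      ultimately have "exp z * (1 - Phi b) \<le> 1 / b"
        using b by (smt (verit, best) divide_right_mono times_divide_eq_right)
      also have "\<dots> \<le> 1 / (t / sqrt (2 * t))"
        using tz b by (intro divide_left_mono) (auto simp: b_def divide_right_mono)
      also have "\<dots> = sqrt 2 * inverse (sqrt t)"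
        using tz by (simp add: real_sqrt_mult field_simps)
      finally show ?case by (simp add: t_def z_def b_def)
    qed
  qed
  from tendsto_diff[OF lim1 this]
  have "((\<lambda>x. Phi ((T x - (x + y)) / sqrt (2 * T x)) - exp (x + y) * (1 - Phi ((T x + (x + y)) / sqrt (2 * T x))))
      \<longlongrightarrow> Phi s) at_top" by simp
  then show ?thesis
    by (rule Lim_transform_eventually) (use ev in eventually_elim, auto simp: hit_cdf_def)
qed

section \<open>Unimodality of the renewal density in time\<close>

definition hit_mode :: "real \<Rightarrow> real" where
  "hit_mode z = sqrt (1 + z\<^sup>2) - 1"

lemma hit_mode_pos: "z > 0 \<Longrightarrow> hit_mode z > 0"
  by (simp add: hit_mode_def)

lemma hit_kernel_eq_exp:
  "t > 0 \<Longrightarrow> hit_kernel z t = exp (- (z - t)\<^sup>2 / (4 * t) - ln (4 * pi * t) / 2)"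
  by (simp add: hit_kernel_def exp_diff flip: ln_sqrt)

text \<open>The sign of this derivative is that of \<open>z\<^sup>2 + 1 - (t + 1)\<^sup>2\<close>,
  whose zero on the nonnegative axis is \<open>hit_mode z\<close>. The kernel therefore rises up to
  that time and falls afterwards.\<close>

lemma hit_exponent_has_real_derivative:
  assumes "t > 0"
  shows "((\<lambda>t. - (z - t)\<^sup>2 / (4 * t) - ln (4 * pi * t) / 2)
    has_real_derivative (z\<^sup>2 + 1 - (t + 1)\<^sup>2) / (4 * t\<^sup>2)) (at t)"
  using assms
  by (auto intro!: derivative_eq_intros simp: field_simps power2_eq_square)

lemma hit_kernel_increasing:
  assumes st: "0 \<le> s" "s \<le> t" "t \<le> hit_mode z"
  shows "hit_kernel z s \<le> hit_kernel z t"
proof (cases "s = 0")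
  case True
  \<comment> \<open>Division by \<open>sqrt 0\<close> gives \<open>hit_kernel z 0 = 0\<close>, so
    the kernel is increasing from the origin on.\<close>
  then show ?thesis using st hit_kernel_nonneg[of t z] by (simp add: hit_kernel_def)
next
  case False
  then have s: "s > 0" using st by simp
  have "- (z - s)\<^sup>2 / (4 * s) - ln (4 * pi * s) / 2 \<le> - (z - t)\<^sup>2 / (4 * t) - ln (4 * pi * t) / 2"
  proof (rule DERIV_nonneg_imp_nondecreasing[OF st(2)])
    fix x assume x: "s \<le> x" "x \<le> t"
    have "(x + 1)\<^sup>2 \<le> (sqrt (1 + z\<^sup>2))\<^sup>2"
      using x s st by (intro power_mono) (auto simp: hit_mode_def)
    then have "(z\<^sup>2 + 1 - (x + 1)\<^sup>2) / (4 * x\<^sup>2) \<ge> 0" by simp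
    then show "\<exists>y. ((\<lambda>t. - (z - t)\<^sup>2 / (4 * t) - ln (4 * pi * t) / 2) has_real_derivative y) (at x) \<and> 0 \<le> y"
      using hit_exponent_has_real_derivative[of x z] x s by (meson less_le_trans)
  qed
  then show ?thesis using s st by (simp add: hit_kernel_eq_exp)
qed

lemma hit_kernel_decreasing:
  assumes z: "z > 0" and st: "hit_mode z \<le> s" "s \<le> t"
  shows "hit_kernel z t \<le> hit_kernel z s"
proof -
  have s: "s > 0" using hit_mode_pos[OF z] st by simp
  have "- (z - t)\<^sup>2 / (4 * t) - ln (4 * pi * t) / 2 \<le> - (z - s)\<^sup>2 / (4 * s) - ln (4 * pi * s) / 2"
  proof (rule DERIV_nonpos_imp_nonincreasing[OF st(2)])
    fix x assume x: "s \<le> x" "x \<le> t"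
    have "(sqrt (1 + z\<^sup>2))\<^sup>2 \<le> (x + 1)\<^sup>2"
      using x s st by (intro power_mono) (auto simp: hit_mode_def)
    then have "(z\<^sup>2 + 1 - (x + 1)\<^sup>2) / (4 * x\<^sup>2) \<le> 0" by (simp add: divide_le_0_iff)
    then show "\<exists>y. ((\<lambda>t. - (z - t)\<^sup>2 / (4 * t) - ln (4 * pi * t) / 2) has_real_derivative y) (at x) \<and> y \<le> 0"
      using hit_exponent_has_real_derivative[of x z] x s by (meson less_le_trans)
  qed
  then show ?thesis using s st by (simp add: hit_kernel_eq_exp)
qed

text \<open>On each cell the mean value theorem writes the increment of \<open>F\<close> as
  \<open>\<eta> * f \<xi>\<close>, and \<open>V\<close> bounds the change of \<open>f\<close> from
  \<open>\<xi>\<close> to the right end point. These bounds telescope, so the error depends on the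
  mesh and on the total growth of \<open>V\<close>, not on the number of cells.\<close>

lemma riemann_sum_error:
  fixes f F V :: "real \<Rightarrow> real"
  assumes \<eta>: "\<eta> > 0" and cont: "continuous_on {0..} F"
    and deriv: "\<And>t. t > 0 \<Longrightarrow> (F has_real_derivative f t) (at t)"
    and var: "\<And>s t. 0 \<le> s \<Longrightarrow> s \<le> t \<Longrightarrow> \<bar>f t - f s\<bar> \<le> V t - V s"
  shows "\<bar>(\<Sum>k=1..n. \<eta> * f (\<eta> * real k)) - (F (\<eta> * real n) - F 0)\<bar> \<le> \<eta> * (V (\<eta> * real n) - V 0)"
proof (induction n)
  case (Suc n)
  let ?s = "\<eta> * real n" and ?t = "\<eta> * real (Suc n)"
  have st: "0 \<le> ?s" "?s < ?t" using \<eta> by auto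
  have "\<exists>l \<xi>. ?s < \<xi> \<and> \<xi> < ?t \<and> (F has_real_derivative l) (at \<xi>) \<and> F ?t - F ?s = (?t - ?s) * l"
  proof (intro MVT continuous_on_subset[OF cont])
    fix x assume "?s < x"
    then show "F differentiable (at x)"
      using deriv[of x] st by (auto simp: real_differentiable_def)
  qed (use st in auto)
  then obtain \<xi> l where \<xi>: "?s < \<xi>" "\<xi> < ?t" "(F has_real_derivative l) (at \<xi>)" "F ?t - F ?s = (?t - ?s) * l"
    by blast
  have "l = f \<xi>" using \<xi> st by (intro DERIV_unique[OF _ deriv]) auto
  with \<xi> have eq: "F ?t - F ?s = \<eta> * f \<xi>" by (simp add: algebra_simps)
  have "\<bar>f ?t - f \<xi>\<bar> \<le> V ?t - V \<xi>" "\<bar>f \<xi> - f ?s\<bar> \<le> V \<xi> - V ?s"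
    using \<xi> st by (intro var; simp)+
  then have "\<bar>f ?t - f \<xi>\<bar> \<le> V ?t - V ?s" by linarith
  then have "\<eta> * \<bar>f ?t - f \<xi>\<bar> \<le> \<eta> * (V ?t - V ?s)"
    using \<eta> by (intro mult_left_mono) auto
  moreover have "\<eta> * \<bar>f ?t - f \<xi>\<bar> = \<bar>\<eta> * f ?t - (F ?t - F ?s)\<bar>"
  proof -
    have "\<eta> * \<bar>f ?t - f \<xi>\<bar> = \<bar>\<eta> * (f ?t - f \<xi>)\<bar>"
      using \<eta> by (simp add: abs_mult)
    then show ?thesis unfolding eq by (simp only: right_diff_distrib)
  qed
  ultimately have "\<bar>\<eta> * f ?t - (F ?t - F ?s)\<bar> \<le> \<eta> * (V ?t - V ?s)" by simp
  then show ?case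
    using Suc.IH by (simp add: right_diff_distrib)
qed simp

text \<open>The bound of \<open>hit_kernel_le\<close> taken at the mode, hence a bound for the
  maximum of the kernel over time.\<close>

definition mesh_error :: "real \<Rightarrow> real" where
  "mesh_error z = 1 / sqrt (4 * pi * hit_mode z)"

lemma mesh_error_pos: "z > 0 \<Longrightarrow> mesh_error z > 0"
  by (simp add: mesh_error_def hit_mode_pos)

lemma mesh_error_antimono:
  assumes "0 < z" "z \<le> w" shows "mesh_error w \<le> mesh_error z"
proof -
  have "z\<^sup>2 \<le> w\<^sup>2" using assms by (intro power_mono) auto
  then have "hit_mode z \<le> hit_mode w" by (simp add: hit_mode_def)
  then show ?thesis
    unfolding mesh_error_def using hit_mode_pos[of z] assms
    by (intro divide_left_mono mult_pos_pos) auto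
qed

lemma mesh_error_tendsto_0: "(mesh_error \<longlongrightarrow> 0) at_top"
  unfolding mesh_error_def hit_mode_def by real_asymp

lemma hit_kernel_le_mesh_error:
  assumes "z > 0" "t \<ge> 0" shows "hit_kernel z t \<le> mesh_error z"
proof -
  have "hit_kernel z t \<le> hit_kernel z (hit_mode z)"
    using hit_kernel_increasing[of t "hit_mode z" z] hit_kernel_decreasing[of z "hit_mode z" t] assms
    by (cases "t \<le> hit_mode z") auto
  also have "\<dots> \<le> mesh_error z"
    unfolding mesh_error_def using hit_mode_pos[of z] assms by (intro hit_kernel_le) auto
  finally show ?thesis .
qed

text \<open>A unimodal nonnegative function varies by at most twice its maximum, which makes the
  error uniform in \<open>n\<close>.\<close>

lemma hit_kernel_sum_error:
  assumes \<eta>: "\<eta> > 0" and z: "z > 0"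
  shows "\<bar>(\<Sum>k=1..n. \<eta> * hit_kernel z (\<eta> * real k)) - hit_cdf z (\<eta> * real n)\<bar> \<le> 2 * \<eta> * mesh_error z"
proof -
  define p h where "p = hit_mode z" and "h = hit_kernel z"
  \<comment> \<open>The variation of \<open>h\<close>: it follows \<open>h\<close> up to the peak
    \<open>p\<close> and the reflection of \<open>h\<close> at height \<open>h p\<close>
    afterwards.\<close>
  define V where "V t = (if t \<le> p then h t else 2 * h p - h t)" for t
  have p: "p > 0" using hit_mode_pos[OF z] by (simp add: p_def)
  have inc: "h s \<le> h t" if "0 \<le> s" "s \<le> t" "t \<le> p" for s t
    using hit_kernel_increasing that by (simp add: p_def h_def)
  have dec: "h t \<le> h s" if "p \<le> s" "s \<le> t" for s t
    using hit_kernel_decreasing[OF z] that by (simp add: p_def h_def)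
  have var: "\<bar>h t - h s\<bar> \<le> V t - V s" if "0 \<le> s" "s \<le> t" for s t
    using inc[of s t] dec[of s t] inc[of s p] dec[of p t] that by (auto simp: V_def)
  have hp: "h p \<le> mesh_error z"
    using hit_kernel_le_mesh_error[OF z, of p] p by (simp add: h_def)
  have "V t - V 0 \<le> 2 * mesh_error z" if "t \<ge> 0" for t
    using hp inc[of t p] that p hit_kernel_nonneg[of t z] hit_kernel_nonneg[of 0 z]
      hit_kernel_nonneg[of p z] by (auto simp: V_def h_def)
  from this[of "\<eta> * real n"] have "\<eta> * (V (\<eta> * real n) - V 0) \<le> \<eta> * (2 * mesh_error z)"
    using \<eta> by (intro mult_left_mono) auto
  moreover have "\<bar>(\<Sum>k=1..n. \<eta> * h (\<eta> * real k)) - (hit_cdf z (\<eta> * real n) - hit_cdf z 0)\<bar>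
      \<le> \<eta> * (V (\<eta> * real n) - V 0)"
    using var hit_cdf_has_real_derivative continuous_on_hit_cdf[OF z]
    by (intro riemann_sum_error \<eta>) (auto simp: h_def)
  ultimately show ?thesis by (simp add: h_def hit_cdf_def)
qed

subsection \<open>Gaussian random walks\<close>

text \<open>For the upper bound, \<open>k \<le> n - L\<close> gives
  \<open>g (n - k) \<le> g L\<close> by monotonicity, and the at most \<open>L\<close> indices
  closest to \<open>n\<close> are estimated with \<open>g \<le> 1\<close>. The split
  \<open>L\<close> is free: it stays fixed for the central limit theorem and grows with
  \<open>n\<close> for the limit over all steps.\<close>

lemma convolution_bounds:
  fixes a g :: "nat \<Rightarrow> real"
  assumes a: "\<And>k. a k \<ge> 0" and g: "decseq g" and g1: "\<And>i. g i \<le> 1" and l: "\<And>i. l \<le> g i"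
    and g0: "\<And>i. 0 \<le> g i"
  shows "l * (\<Sum>k=1..n. a k) \<le> (\<Sum>k=1..n. a k * g (n - k))"
    and "(\<Sum>k=1..n. a k * g (n - k)) \<le> g L * (\<Sum>k=1..n. a k) + (\<Sum>k\<in>{n-L<..n}. a k)"
proof -
  show "l * (\<Sum>k=1..n. a k) \<le> (\<Sum>k=1..n. a k * g (n - k))"
    unfolding sum_distrib_left using a l by (intro sum_mono) (simp add: mult.commute[of l] mult_left_mono)
  have split: "{1..n} = {1..n-L} \<union> {n-L<..n} \<inter> {1..n}" "{1..n-L} \<inter> ({n-L<..n} \<inter> {1..n}) = {}"
    by auto
  have "(\<Sum>k=1..n. a k * g (n - k))
      = (\<Sum>k=1..n-L. a k * g (n - k)) + (\<Sum>k\<in>{n-L<..n} \<inter> {1..n}. a k * g (n - k))"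
    by (subst split(1), rule sum.union_disjoint) (use split(2) in auto)
  also have "(\<Sum>k=1..n-L. a k * g (n - k)) \<le> (\<Sum>k=1..n-L. a k * g L)"
    using a g by (intro sum_mono mult_left_mono) (auto simp: decseq_def)
  also have "(\<Sum>k=1..n-L. a k * g L) \<le> (\<Sum>k=1..n. a k * g L)"
    using a g0 by (intro sum_mono2) auto
  also have "(\<Sum>k\<in>{n-L<..n} \<inter> {1..n}. a k * g (n - k)) \<le> (\<Sum>k\<in>{n-L<..n} \<inter> {1..n}. a k)"
    using a g1 by (intro sum_mono mult_left_le) auto
  also have "(\<Sum>k\<in>{n-L<..n} \<inter> {1..n}. a k) \<le> (\<Sum>k\<in>{n-L<..n}. a k)"
    using a by (intro sum_mono2) auto
  finally show "(\<Sum>k=1..n. a k * g (n - k)) \<le> g L * (\<Sum>k=1..n. a k) + (\<Sum>k\<in>{n-L<..n}. a k)"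
    by (simp add: sum_distrib_left mult.commute)
qed

lemma convolution_tendsto:
  fixes a g :: "nat \<Rightarrow> real"
  assumes a: "\<And>k. a k \<ge> 0" and g: "decseq g" and g1: "\<And>i. g i \<le> 1" and l: "\<And>i. l \<le> g i"
    and g0: "\<And>i. 0 \<le> g i" and glim: "g \<longlonglongrightarrow> l" and S: "(\<lambda>n. \<Sum>k=1..n. a k) \<longlonglongrightarrow> S"
  shows "(\<lambda>n. \<Sum>k=1..n. a k * g (n - k)) \<longlonglongrightarrow> l * S"
proof (rule tendsto_sandwich)
  \<comment> \<open>With \<open>L = n div 2\<close> the value \<open>g L\<close> tends to
    \<open>l\<close>, while the last block of the convergent series tends to 0.\<close>
  have half: "filterlim (\<lambda>n::nat. n div 2) sequentially sequentially"
    unfolding filterlim_at_top eventually_sequentially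
  proof
    fix Z :: nat
    show "\<exists>N. \<forall>n\<ge>N. Z \<le> n div 2" by (rule exI[of _ "2 * Z"]) auto
  qed
  have half': "filterlim (\<lambda>n::nat. n - n div 2) sequentially sequentially"
    by (rule filterlim_at_top_mono[OF half]) (auto intro!: always_eventually)
  show "(\<lambda>n. l * (\<Sum>k=1..n. a k)) \<longlonglongrightarrow> l * S" by (intro tendsto_intros S)
  have tail: "(\<Sum>k\<in>{n - n div 2<..n}. a k) = (\<Sum>k=1..n. a k) - (\<Sum>k=1..n - n div 2. a k)" for n
  proof -
    have "{1..n} = {1..n - n div 2} \<union> {n - n div 2<..n}" by auto
    then have "(\<Sum>k=1..n. a k) = (\<Sum>k\<in>{1..n - n div 2} \<union> {n - n div 2<..n}. a k)" by (rule arg_cong)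
    also have "\<dots> = (\<Sum>k=1..n - n div 2. a k) + (\<Sum>k\<in>{n - n div 2<..n}. a k)"
      by (rule sum.union_disjoint) auto
    finally show ?thesis by simp
  qed
  have "(\<lambda>n. g (n div 2) * (\<Sum>k=1..n. a k) + ((\<Sum>k=1..n. a k) - (\<Sum>k=1..n - n div 2. a k))) \<longlonglongrightarrow> l * S + (S - S)"
    by (intro tendsto_intros S filterlim_compose[OF glim half] filterlim_compose[OF S half'])
  then show "(\<lambda>n. g (n div 2) * (\<Sum>k=1..n. a k) + (\<Sum>k\<in>{n - n div 2<..n}. a k)) \<longlonglongrightarrow> l * S"
    unfolding tail by simp
qed (use convolution_bounds[of a g l, OF a g g1 l g0] in auto)

section \<open>Joint laws of independent steps\<close>

lemma (in prob_space) distr_indep_vars_density: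
  fixes X :: "nat \<Rightarrow> 'a \<Rightarrow> real"
  assumes "indep_vars (\<lambda>_. borel) X {..<n}"
    and "\<And>i. i < n \<Longrightarrow> distributed M lborel (X i) (D i)"
  shows "distr M (PiM {..<n} (\<lambda>_. borel)) (\<lambda>\<omega>. \<lambda>i\<in>{..<n}. X i \<omega>)
    = PiM {..<n} (\<lambda>i. density lborel (D i))"
\<comment> \<open>For \<open>n = 0\<close> both sides are the point mass on the one-point product;
  the product characterisation of independence is applied to nonempty index sets only.\<close>
proof (cases "n = 0")
  case True
  have "(\<lambda>\<omega>. \<lambda>i\<in>{}. X i \<omega>) \<in> measurable M (PiM {} (\<lambda>_. borel))"
    by (rule measurable_restrict) simp
  then have em: "emeasure (distr M (PiM {} (\<lambda>_. borel)) (\<lambda>\<omega>. \<lambda>i\<in>{}. X i \<omega>)) {\<lambda>_. undefined} = 1"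
    by (subst emeasure_distr) (auto simp: PiM_empty emeasure_space_1 restrict_def)
  have "distr M (PiM {} (\<lambda>_. borel)) (\<lambda>\<omega>. \<lambda>i\<in>{}. X i \<omega>) = PiM {} (\<lambda>i. density lborel (D i))"
    by (rule measure_eqI_finite[of _ "{\<lambda>_. undefined}"]) (use em in \<open>auto simp: PiM_empty\<close>)
  then show ?thesis using True by simp
next
  case False
  have X: "i \<in> {..<n} \<Longrightarrow> random_variable borel (X i)" for i
    using distributed_measurable[OF assms(2)] by simp
  have "distr M (PiM {..<n} (\<lambda>_. borel)) (\<lambda>\<omega>. \<lambda>i\<in>{..<n}. X i \<omega>)
      = PiM {..<n} (\<lambda>i. distr M borel (X i))"
    using assms(1) False X by (subst (asm) indep_vars_iff_distr_eq_PiM') auto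
  also have "\<dots> = PiM {..<n} (\<lambda>i. density lborel (D i))"
  proof (rule PiM_cong[OF refl])
    fix i assume "i \<in> {..<n}"
    then have "distr M lborel (X i) = density lborel (D i)"
      using assms(2) by (intro distributed_distr_eq_density) auto
    then show "distr M borel (X i) = density lborel (D i)"
      by (metis distr_cong sets_lborel)
  qed
  finally show ?thesis .
qed

definition step_law :: "real \<Rightarrow> real measure" where
  "step_law \<eta> = density lborel (normal_density (- \<eta>) (sqrt (2 * \<eta>)))"

definition walk_law :: "real \<Rightarrow> nat \<Rightarrow> (nat \<Rightarrow> real) measure" where
  "walk_law \<eta> n = PiM {..<n} (\<lambda>_. step_law \<eta>)"

lemma sets_step_law [simp, measurable_cong]: "sets (step_law \<eta>) = sets borel"
  by (simp add: step_law_def)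

lemma space_step_law [simp]: "space (step_law \<eta>) = UNIV"
  by (simp add: step_law_def)

lemma sets_walk_law [measurable_cong]: "sets (walk_law \<eta> n) = sets (PiM {..<n} (\<lambda>_. borel))"
  unfolding walk_law_def by (intro sets_PiM_cong) auto

lemma space_walk_law [simp]: "space (walk_law \<eta> n) = PiE {..<n} (\<lambda>_. UNIV)"
  by (simp add: walk_law_def space_PiM)

lemma measurable_partial_sum:
  fixes j n :: nat
  assumes "j \<le> n"
  shows "(\<lambda>z. \<Sum>l<j. z l) \<in> borel_measurable (PiM {..<n} (\<lambda>_. borel :: real measure))"
  using assms by (intro borel_measurable_sum measurable_component_singleton) simp

text \<open>Stated with the canonical law of the steps instead of a walk on a given space, so that
  it depends on \<open>\<eta>\<close>, \<open>i\<close> and \<open>y\<close> alone. This lets walks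
  built from two unrelated Brownian motions share the constant
  \<open>escape_const \<eta>\<close>.\<close>

definition stay_prob :: "real \<Rightarrow> nat \<Rightarrow> real \<Rightarrow> real" where
  "stay_prob \<eta> i y = \<P>(z in walk_law \<eta> i. \<forall>j\<in>{1..i}. (\<Sum>l<j. z l) \<le> - y)"

definition escape_prob :: "real \<Rightarrow> real \<Rightarrow> real" where
  "escape_prob \<eta> y = lim (\<lambda>i. stay_prob \<eta> i y)"

abbreviation exp_law :: "real measure" where
  "exp_law \<equiv> density lborel (exponential_density 1)"

definition escape_const :: "real \<Rightarrow> real" where
  "escape_const \<eta> = (\<integral>y. escape_prob \<eta> y \<partial>exp_law)"

interpretation exp_law: prob_space exp_law
  by (rule prob_space_exponential_density) simp

lemma AE_exp_law_pos: "AE y in exp_law. y > 0"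
proof -
  have "AE y in lborel. (y::real) \<noteq> 0" by (rule AE_lborel_singleton)
  then show ?thesis
    by (subst AE_density) (auto simp: exponential_density_def)
qed

lemma integral_exp_law:
  "f \<in> borel_measurable borel \<Longrightarrow> (\<integral>y. f y \<partial>exp_law) = (\<integral>y. indicator {0<..} y * exp (- y) * (f y :: real) \<partial>lborel)"
proof -
  assume [measurable]: "f \<in> borel_measurable borel"
  have "(\<integral>y. f y \<partial>exp_law) = (\<integral>y. exponential_density 1 y * f y \<partial>lborel)"
    by (subst integral_density) (auto simp: exponential_density_def)
  also have "\<dots> = (\<integral>y. indicator {0<..} y * exp (- y) * f y \<partial>lborel)"
    by (rule integral_cong_AE, measurable, use AE_lborel_singleton[of "0::real"] in eventually_elim)
       (auto simp: exponential_density_def indicator_def)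
  finally show ?thesis .
qed

section \<open>Random walks with normal steps of mean \<open>- \<eta>\<close> and variance
  \<open>2 * \<eta>\<close>\<close>

locale gaussian_walk = prob_space M for M :: "'a measure" +
  fixes \<xi> :: "nat \<Rightarrow> 'a \<Rightarrow> real" and \<eta> :: real
  assumes \<eta>_pos: "\<eta> > 0"
    and indep_steps: "indep_vars (\<lambda>_. borel) \<xi> UNIV"
    and distributed_step: "distributed M lborel (\<xi> i) (normal_density (- \<eta>) (sqrt (2 * \<eta>)))"
begin

definition V :: "nat \<Rightarrow> 'a \<Rightarrow> real" where
  "V n \<omega> = (\<Sum>i<n. \<xi> i \<omega>)"

lemma measurable_step [measurable]: "\<xi> i \<in> borel_measurable M"
  using distributed_measurable[OF distributed_step[of i]] by simp

lemma measurable_V [measurable]: "V n \<in> borel_measurable M"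
  unfolding V_def by measurable

lemma distributed_V:
  assumes "n > 0"
  shows "distributed M lborel (V n) (normal_density (- (\<eta> * real n)) (sqrt (2 * (\<eta> * real n))))"
proof -
  have "distributed M lborel (\<lambda>\<omega>. \<Sum>i<n. \<xi> i \<omega>)
      (normal_density (\<Sum>i<n. - \<eta>) (sqrt (\<Sum>i<n. (sqrt (2 * \<eta>))\<^sup>2)))"
    using assms \<eta>_pos distributed_step
    by (intro sum_indep_normal indep_vars_subset[OF indep_steps]) (auto simp: lessThan_empty_iff)
  then show ?thesis
    using \<eta>_pos by (simp add: V_def[abs_def] mult_ac)
qed

lemma distr_steps:
  "distr M (PiM {..<n} (\<lambda>_. borel)) (\<lambda>\<omega>. \<lambda>i\<in>{..<n}. \<xi> (k + i) \<omega>) = walk_law \<eta> n"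
proof -
  have "indep_vars (\<lambda>_. borel) (\<xi> \<circ> (+) k) {..<n}"
  proof -
    have "indep_vars (\<lambda>j. PiM {k + j} (\<lambda>_. borel)) (\<lambda>j \<omega>. restrict (\<lambda>i. \<xi> i \<omega>) {k + j}) {..<n}"
      by (rule indep_vars_restrict[OF indep_steps]) (auto simp: disjoint_family_on_def)
    then have "indep_vars (\<lambda>_. borel) (\<lambda>j. (\<lambda>z. z (k + j)) \<circ> (\<lambda>\<omega>. restrict (\<lambda>i. \<xi> i \<omega>) {k + j})) {..<n}"
      by (rule indep_vars_compose) simp
    moreover have "(\<lambda>j. (\<lambda>z. z (k + j)) \<circ> (\<lambda>\<omega>. restrict (\<lambda>i. \<xi> i \<omega>) {k + j})) = \<xi> \<circ> (+) k"
      by (auto simp: fun_eq_iff)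
    ultimately show ?thesis by simp
  qed
  then have "distr M (PiM {..<n} (\<lambda>_. borel)) (\<lambda>\<omega>. \<lambda>i\<in>{..<n}. (\<xi> \<circ> (+) k) i \<omega>)
    = PiM {..<n} (\<lambda>i. density lborel (normal_density (- \<eta>) (sqrt (2 * \<eta>))))"
    by (rule distr_indep_vars_density) (simp add: distributed_step)
  then show ?thesis
    by (simp add: walk_law_def step_law_def)
qed

lemma prob_walk_law:
  assumes "{z \<in> space (PiM {..<n} (\<lambda>_. borel :: real measure)). P z} \<in> sets (PiM {..<n} (\<lambda>_. borel))"
  shows "\<P>(z in walk_law \<eta> n. P z) = \<P>(\<omega> in M. P (\<lambda>i\<in>{..<n}. \<xi> (k + i) \<omega>))"
  unfolding distr_steps[of n k, symmetric]
  by (subst measure_distr) (use assms in \<open>auto simp: space_PiM intro!: arg_cong[where f=prob]\<close>)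

lemma stay_prob_eq_shift:
  "stay_prob \<eta> i y = \<P>(\<omega> in M. \<forall>j\<in>{1..i}. V (k + j) \<omega> - V k \<omega> \<le> - y)"
proof -
  have V: "V (k + j) \<omega> - V k \<omega> = (\<Sum>l<j. \<xi> (k + l) \<omega>)" for j \<omega>
    unfolding V_def by (induction j) auto
  have "{z \<in> space (PiM {..<i} (\<lambda>_. borel)). \<forall>j\<in>{1..i}. (\<Sum>l<j. z l) \<le> - y} \<in> sets (PiM {..<i} (\<lambda>_. borel))"
    by (intro sets.sets_Collect_finite_All borel_measurable_le measurable_partial_sum) auto
  from prob_walk_law[OF this, of k] show ?thesis
    unfolding stay_prob_def V by (auto intro!: arg_cong[where f=prob])
qed

lemma stay_prob_eq: "stay_prob \<eta> i y = \<P>(\<omega> in M. \<forall>j\<in>{1..i}. V j \<omega> \<le> - y)"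
  using stay_prob_eq_shift[of i y 0] by (simp add: V_def)

lemma stay_prob_nonneg: "0 \<le> stay_prob \<eta> i y"
  and stay_prob_le_1: "stay_prob \<eta> i y \<le> 1"
  unfolding stay_prob_eq by auto

lemma decseq_stay_prob: "decseq (\<lambda>i. stay_prob \<eta> i y)"
  unfolding stay_prob_eq decseq_def by (auto intro!: finite_measure_mono)

lemma stay_prob_antimono: "y \<le> y' \<Longrightarrow> stay_prob \<eta> i y' \<le> stay_prob \<eta> i y"
  unfolding stay_prob_eq by (intro finite_measure_mono) force+

lemma measurable_stay_prob [measurable]: "stay_prob \<eta> i \<in> borel_measurable borel"
proof -
  have "mono (\<lambda>y. - stay_prob \<eta> i y)" using stay_prob_antimono by (intro monoI) simp
  then have "(\<lambda>y. - (- stay_prob \<eta> i y)) \<in> borel_measurable borel"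
    by (intro borel_measurable_uminus borel_measurable_mono)
  then show ?thesis by simp
qed

lemma stay_prob_tendsto: "(\<lambda>i. stay_prob \<eta> i y) \<longlonglongrightarrow> escape_prob \<eta> y"
  unfolding escape_prob_def
  using decseq_convergent[OF decseq_stay_prob, of 0 y] stay_prob_nonneg
  by (metis limI)

lemma escape_prob_le_stay_prob: "escape_prob \<eta> y \<le> stay_prob \<eta> i y"
  using decseq_ge[OF decseq_stay_prob stay_prob_tendsto] .

lemma escape_prob_nonneg: "0 \<le> escape_prob \<eta> y"
  by (rule LIMSEQ_le_const[OF stay_prob_tendsto]) (use stay_prob_nonneg in auto)

lemma escape_prob_le_1: "escape_prob \<eta> y \<le> 1"
  using escape_prob_le_stay_prob[of y 0] stay_prob_le_1[of 0 y] by simp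

lemma measurable_escape_prob [measurable]: "escape_prob \<eta> \<in> borel_measurable borel"
  by (rule borel_measurable_LIMSEQ_real[OF stay_prob_tendsto]) measurable

lemma stay_prob_integral_tendsto: "(\<lambda>i. \<integral>y. stay_prob \<eta> i y \<partial>exp_law) \<longlonglongrightarrow> escape_const \<eta>"
  unfolding escape_const_def
proof (rule integral_dominated_convergence[where w="\<lambda>_. 1"])
  show "AE y in exp_law. (\<lambda>i. stay_prob \<eta> i y) \<longlonglongrightarrow> escape_prob \<eta> y"
    using stay_prob_tendsto by simp
  show "AE y in exp_law. norm (stay_prob \<eta> i y) \<le> 1" for i
    using stay_prob_nonneg[of i] stay_prob_le_1[of i] by simp
qed auto

text \<open>The steps before and after time \<open>k\<close> form independent blocks. Given
  \<open>V k = v\<close>, the later block has law \<open>walk_law \<eta> i\<close>, and staying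
  below \<open>x\<close> means that its partial sums stay below \<open>- (v - x)\<close>; Fubini
  integrates this over \<open>v\<close>.\<close>

lemma markov_property:
  assumes k: "k > 0" and A[measurable]: "A \<in> sets borel"
  shows "\<P>(\<omega> in M. V k \<omega> \<in> A \<and> (\<forall>j\<in>{1..i}. V (k + j) \<omega> \<le> x)) =
    (\<integral>v. indicator A v * normal_density (- (\<eta> * real k)) (sqrt (2 * (\<eta> * real k))) v
        * stay_prob \<eta> i (v - x) \<partial>lborel)"
proof -
  define p where "p = normal_density (- (\<eta> * real k)) (sqrt (2 * (\<eta> * real k)))"
  have p_pos: "p v \<ge> 0" for v by (simp add: p_def)
  have [measurable]: "p \<in> borel_measurable borel" by (simp add: p_def)
  define R :: "(nat \<Rightarrow> real) measure" where "R = PiM {..<i} (\<lambda>_. borel)"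
  define Z where "Z \<omega> = (\<lambda>j\<in>{..<i}. \<xi> (k + j) \<omega>)" for \<omega>
  define Q :: "(nat \<Rightarrow> real) measure" where "Q = PiM {..<k} (\<lambda>_. borel)"
  define U where "U \<omega> = (\<lambda>j\<in>{..<k}. \<xi> j \<omega>)" for \<omega>
  have "indep_var Q U (PiM {k..<k+i} (\<lambda>_. borel)) (\<lambda>\<omega>. restrict (\<lambda>i. \<xi> i \<omega>) {k..<k+i})"
    unfolding Q_def U_def by (rule indep_var_restrict[OF indep_steps]) auto
  then have "indep_var Q ((\<lambda>z. z) \<circ> U)
      R ((\<lambda>z. \<lambda>j\<in>{..<i}. z (k + j)) \<circ> (\<lambda>\<omega>. restrict (\<lambda>i. \<xi> i \<omega>) {k..<k+i}))"
    unfolding R_def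
    by (rule indep_var_compose) (auto intro!: measurable_restrict measurable_component_singleton)
  also have "(\<lambda>z. \<lambda>j\<in>{..<i}. z (k + j)) \<circ> (\<lambda>\<omega>. restrict (\<lambda>i. \<xi> i \<omega>) {k..<k+i}) = Z"
    by (auto simp: Z_def fun_eq_iff restrict_def)
  finally have "indep_var Q U R Z" by (simp add: comp_def)
  then have Z[measurable]: "Z \<in> measurable M R" and U[measurable]: "U \<in> measurable M Q"
    and joint: "distr M Q U \<Otimes>\<^sub>M distr M R Z = distr M (Q \<Otimes>\<^sub>M R) (\<lambda>\<omega>. (U \<omega>, Z \<omega>))"
    by (auto simp: indep_var_distribution_eq)
  have sumU: "(\<Sum>l<k. U \<omega> l) = V k \<omega>" for \<omega> by (simp add: V_def U_def)
  have [measurable]: "(\<lambda>u. \<Sum>l<k. u l) \<in> borel_measurable Q"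
    unfolding Q_def by (rule measurable_partial_sum) simp
  have distrZ: "distr M R Z = walk_law \<eta> i"
    unfolding R_def Z_def by (rule distr_steps)
  interpret Z: prob_space "distr M R Z" by (rule prob_space_distr) measurable
  \<comment> \<open>The event as a set of pairs of blocks: its section at a first block is empty or
    an event measured by \<open>stay_prob\<close>.\<close>
  define S where "S = {w \<in> space (Q \<Otimes>\<^sub>M R). (\<Sum>l<k. fst w l) \<in> A \<and>
    (\<forall>j\<in>{1..i}. (\<Sum>l<k. fst w l) + (\<Sum>l<j. snd w l) \<le> x)}"
  have [measurable]: "(\<lambda>w. \<Sum>l<k. fst w l) \<in> borel_measurable (Q \<Otimes>\<^sub>M R)"
    by (rule measurable_compose[OF measurable_fst]) measurable
  have "(\<lambda>w. \<Sum>l<j. snd w l) \<in> borel_measurable (Q \<Otimes>\<^sub>M R)" if "j \<in> {1..i}" for j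
    unfolding R_def by (rule measurable_compose[OF measurable_snd measurable_partial_sum]) (use that in auto)
  then have S: "S \<in> sets (Q \<Otimes>\<^sub>M R)"
    unfolding S_def
    by (intro sets.sets_Collect_conj sets.sets_Collect_finite_All borel_measurable_le borel_measurable_add)
       (auto intro: measurable_sets_Collect)
  have VkZ: "V (k + j) \<omega> = V k \<omega> + (\<Sum>l<j. Z \<omega> l)" if "j \<le> i" for j \<omega>
    using that by (induction j) (auto simp: V_def Z_def)
  have "emeasure M {\<omega> \<in> space M. V k \<omega> \<in> A \<and> (\<forall>j\<in>{1..i}. V (k + j) \<omega> \<le> x)}
      = emeasure M ((\<lambda>\<omega>. (U \<omega>, Z \<omega>)) -` S \<inter> space M)"
    using measurable_space[OF Z] measurable_space[OF U]
    by (intro arg_cong[where f="emeasure M"]) (auto simp: S_def VkZ sumU space_pair_measure)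
  also have "\<dots> = emeasure (distr M Q U \<Otimes>\<^sub>M distr M R Z) S"
    unfolding joint using S by (subst emeasure_distr) auto
  also have "\<dots> = (\<integral>\<^sup>+u. emeasure (distr M R Z) (Pair u -` S) \<partial>distr M Q U)"
    using S by (intro Z.emeasure_pair_measure_alt) (simp cong: sets_pair_measure_cong)
  also have "\<dots> = (\<integral>\<^sup>+u. ennreal (indicator A (\<Sum>l<k. u l) * stay_prob \<eta> i ((\<Sum>l<k. u l) - x)) \<partial>distr M Q U)"
  proof (intro nn_integral_cong)
    fix u assume "u \<in> space (distr M Q U)"
    then have "Pair u -` S = (if (\<Sum>l<k. u l) \<in> A
        then {z \<in> space R. \<forall>j\<in>{1..i}. (\<Sum>l<j. z l) \<le> - ((\<Sum>l<k. u l) - x)} else {})"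
      by (auto simp: S_def space_pair_measure algebra_simps)
    then show "emeasure (distr M R Z) (Pair u -` S)
        = ennreal (indicator A (\<Sum>l<k. u l) * stay_prob \<eta> i ((\<Sum>l<k. u l) - x))"
      unfolding Z.emeasure_eq_measure stay_prob_def unfolding distrZ
      by (simp add: R_def space_PiM)
  qed
  also have "\<dots> = (\<integral>\<^sup>+\<omega>. ennreal (indicator A (V k \<omega>) * stay_prob \<eta> i (V k \<omega> - x)) \<partial>M)"
    by (subst nn_integral_distr) (simp_all add: sumU)
  also have "\<dots> = (\<integral>\<^sup>+v. ennreal (p v) * ennreal (indicator A v * stay_prob \<eta> i (v - x)) \<partial>lborel)"
    unfolding p_def by (rule distributed_nn_integral[OF distributed_V[OF k], symmetric]) measurable
  also have "\<dots> = (\<integral>\<^sup>+v. ennreal (indicator A v * p v * stay_prob \<eta> i (v - x)) \<partial>lborel)"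
    by (intro nn_integral_cong) (auto simp: p_pos stay_prob_nonneg mult_ac simp flip: ennreal_mult'')
  also have "\<dots> = ennreal (\<integral>v. indicator A v * p v * stay_prob \<eta> i (v - x) \<partial>lborel)"
  proof (rule nn_integral_eq_integral)
    show "integrable lborel (\<lambda>v. indicator A v * p v * stay_prob \<eta> i (v - x))"
    proof (rule Bochner_Integration.integrable_bound)
      show "integrable lborel p" using k \<eta>_pos by (simp add: p_def)
      show "AE v in lborel. norm (indicator A v * p v * stay_prob \<eta> i (v - x)) \<le> norm (p v)"
        using p_pos stay_prob_nonneg stay_prob_le_1
        by (intro AE_I2) (auto simp: indicator_def abs_mult mult_left_le)
    qed measurable
  qed (auto simp: p_pos stay_prob_nonneg)
  finally show ?thesis
    unfolding emeasure_eq_measure p_def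
    by (subst (asm) ennreal_inj) (auto intro!: integral_nonneg_AE simp: stay_prob_nonneg)
qed

end

subsection \<open>Last exit decomposition\<close>

lemma measurable_hit_kernel [measurable]:
  assumes [measurable]: "f \<in> borel_measurable M"
  shows "(\<lambda>x. hit_kernel (f x) t) \<in> borel_measurable M"
  unfolding hit_kernel_def by measurable

section \<open>Riemann sums of the renewal density\<close>

definition mesh_sum :: "real \<Rightarrow> real \<Rightarrow> nat \<Rightarrow> real" where
  "mesh_sum \<eta> z n = (\<Sum>k=1..n. \<eta> * hit_kernel z (\<eta> * real k))"

definition mesh_limit :: "real \<Rightarrow> real \<Rightarrow> real" where
  "mesh_limit \<eta> z = lim (mesh_sum \<eta> z)"

text \<open>As \<open>mesh_error\<close> is decreasing, one bound at \<open>x\<close> serves every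
  level \<open>z = x + y\<close> with \<open>y > 0\<close>, which is the uniformity needed for
  integrating over \<open>exp_law\<close>.\<close>

lemma mesh_sum_bound:
  assumes "\<eta> > 0" "0 < x" "x \<le> z"
  shows "\<bar>mesh_sum \<eta> z n - hit_cdf z (\<eta> * real n)\<bar> \<le> 2 * \<eta> * mesh_error x"
proof -
  have "2 * \<eta> * mesh_error z \<le> 2 * \<eta> * mesh_error x"
    using assms mesh_error_antimono by (intro mult_left_mono) auto
  moreover have "\<bar>mesh_sum \<eta> z n - hit_cdf z (\<eta> * real n)\<bar> \<le> 2 * \<eta> * mesh_error z"
    unfolding mesh_sum_def using assms by (intro hit_kernel_sum_error) auto
  ultimately show ?thesis by linarith
qed

lemma mesh_sum_le:
  assumes "\<eta> > 0" "0 < x" "x \<le> z"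
  shows "mesh_sum \<eta> z n \<le> 1 + 2 * \<eta> * mesh_error x"
  using mesh_sum_bound[OF assms, of n] hit_cdf_le_1[of z "\<eta> * real n"] by linarith

lemma mesh_sum_tendsto:
  assumes \<eta>: "\<eta> > 0" and z: "z > 0"
  shows "mesh_sum \<eta> z \<longlonglongrightarrow> mesh_limit \<eta> z"
proof -
  have "incseq (mesh_sum \<eta> z)"
    unfolding mesh_sum_def using \<eta> by (intro incseq_SucI) (auto simp: hit_kernel_nonneg)
  then obtain l where "mesh_sum \<eta> z \<longlonglongrightarrow> l"
    using incseq_convergent[of "mesh_sum \<eta> z" "1 + 2 * \<eta> * mesh_error z"] mesh_sum_le[OF \<eta> z order.refl]
    by blast
  then show ?thesis by (simp add: mesh_limit_def limI)
qed

lemma mesh_limit_bound: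
  assumes \<eta>: "\<eta> > 0" and x: "0 < x" "x \<le> z"
  shows "\<bar>mesh_limit \<eta> z - 1\<bar> \<le> 2 * \<eta> * mesh_error x"
proof (rule tendsto_upperbound)
  have "filterlim (\<lambda>n. \<eta> * real n) at_top sequentially"
    using \<eta> by real_asymp
  then have "(\<lambda>n. hit_cdf z (\<eta> * real n)) \<longlonglongrightarrow> 1"
    by (rule filterlim_compose[OF hit_cdf_tendsto_1])
  then show "(\<lambda>n. \<bar>mesh_sum \<eta> z n - hit_cdf z (\<eta> * real n)\<bar>) \<longlonglongrightarrow> \<bar>mesh_limit \<eta> z - 1\<bar>"
    using x by (intro tendsto_intros mesh_sum_tendsto \<eta>) auto
qed (use mesh_sum_bound[OF assms] in auto)

section \<open>Asymptotics of the hitting probabilities\<close>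

context gaussian_walk
begin

definition hit_prob :: "nat \<Rightarrow> real \<Rightarrow> real" where
  "hit_prob n x = \<P>(\<omega> in M. \<exists>j\<in>{1..n}. V j \<omega> > x)"

definition ever_hit_prob :: "real \<Rightarrow> real" where
  "ever_hit_prob x = \<P>(\<omega> in M. \<exists>j\<ge>1. V j \<omega> > x)"

lemma hit_prob_tendsto: "(\<lambda>n. hit_prob n x) \<longlonglongrightarrow> ever_hit_prob x"
proof -
  have "(\<lambda>n. prob {\<omega> \<in> space M. \<exists>j\<in>{1..n}. V j \<omega> > x}) \<longlonglongrightarrow> prob (\<Union>n. {\<omega> \<in> space M. \<exists>j\<in>{1..n}. V j \<omega> > x})"
    by (rule finite_Lim_measure_incseq) (auto simp: incseq_def)
  also have "(\<Union>n. {\<omega> \<in> space M. \<exists>j\<in>{1..n}. V j \<omega> > x}) = {\<omega> \<in> space M. \<exists>j\<ge>1. V j \<omega> > x}"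
    by fastforce
  finally show ?thesis by (simp add: hit_prob_def ever_hit_prob_def)
qed

text \<open>Decomposition according to the last visit to \<open>{x<..}\<close>, before which the path is unconstrained.\<close>

lemma hit_prob_last_exit:
  "hit_prob n x = (\<Sum>k=1..n. \<P>(\<omega> in M. V k \<omega> \<in> {x<..} \<and> (\<forall>j\<in>{1..n-k}. V (k + j) \<omega> \<le> x)))"
  unfolding hit_prob_def
proof (rule prob_sum)
  show "AE \<omega> in M. (\<forall>k\<in>{1..n}. (V k \<omega> \<in> {x<..} \<and> (\<forall>j\<in>{1..n-k}. V (k + j) \<omega> \<le> x)) \<longrightarrow> (\<exists>j\<in>{1..n}. V j \<omega> > x)) \<and>
    ((\<exists>j\<in>{1..n}. V j \<omega> > x) \<longrightarrow> (\<exists>!k\<in>{1..n}. V k \<omega> \<in> {x<..} \<and> (\<forall>j\<in>{1..n-k}. V (k + j) \<omega> \<le> x)))"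
  proof (intro AE_I2 conjI impI ballI)
    fix \<omega> assume ex: "\<exists>j\<in>{1..n}. V j \<omega> > x"
    define k where "k = Max {j\<in>{1..n}. V j \<omega> > x}"
    have "k \<in> {j\<in>{1..n}. V j \<omega> > x}"
      unfolding k_def using ex by (intro Max_in) auto
    then have k: "k \<in> {1..n}" "V k \<omega> > x" by auto
    have le: "V j \<omega> \<le> x" if "j \<in> {k<..n}" for j
    proof (rule ccontr)
      assume "\<not> V j \<omega> \<le> x"
      then have "j \<le> k" unfolding k_def using that k by (intro Max_ge) auto
      then show False using that by simp
    qed
    show "\<exists>!k\<in>{1..n}. V k \<omega> \<in> {x<..} \<and> (\<forall>j\<in>{1..n-k}. V (k + j) \<omega> \<le> x)"
    proof (rule ex1I)
      show "k \<in> {1..n} \<and> V k \<omega> \<in> {x<..} \<and> (\<forall>j\<in>{1..n-k}. V (k + j) \<omega> \<le> x)"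
        using k le by auto
      fix i assume i: "i \<in> {1..n} \<and> V i \<omega> \<in> {x<..} \<and> (\<forall>j\<in>{1..n-i}. V (i + j) \<omega> \<le> x)"
      have "\<not> i < k" using i[THEN conjunct2, THEN conjunct2, rule_format, of "k - i"] k by force
      moreover have "\<not> k < i" using i le[of i] by auto
      ultimately show "i = k" by simp
    qed
  qed auto
qed auto

lemma integrable_hit_term:
  assumes "t > 0"
  shows "integrable exp_law (\<lambda>y. hit_kernel (x + y) t * stay_prob \<eta> i y)"
proof (rule exp_law.integrable_const_bound[where B="1 / sqrt (4 * pi * t)"])
  show "AE y in exp_law. norm (hit_kernel (x + y) t * stay_prob \<eta> i y) \<le> 1 / sqrt (4 * pi * t)"
  proof (rule AE_I2)
    fix y
    have "hit_kernel (x + y) t * stay_prob \<eta> i y \<le> 1 / sqrt (4 * pi * t) * 1"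
      using assms by (intro mult_mono hit_kernel_le stay_prob_le_1 hit_kernel_nonneg stay_prob_nonneg) auto
    then show "norm (hit_kernel (x + y) t * stay_prob \<eta> i y) \<le> 1 / sqrt (4 * pi * t)"
      using assms hit_kernel_nonneg[of t "x + y"] stay_prob_nonneg[of i y] by (simp add: abs_mult)
  qed
qed simp

text \<open>Each term of the last exit decomposition is evaluated by \<open>markov_property\<close>.
  Writing the last point above \<open>x\<close> as \<open>x + y\<close> and tilting the normal
  density yields \<open>exp (- x)\<close>, which cancels, and \<open>exp (- y)\<close>, which
  becomes the weight of \<open>exp_law\<close>.\<close>

lemma exp_hit_prob:
  "exp x * hit_prob n x = (\<integral>y. (\<Sum>k=1..n. hit_kernel (x + y) (\<eta> * real k) * stay_prob \<eta> (n - k) y) \<partial>exp_law)"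
proof -
  have term_eq: "exp x * \<P>(\<omega> in M. V k \<omega> \<in> {x<..} \<and> (\<forall>j\<in>{1..i}. V (k + j) \<omega> \<le> x))
      = (\<integral>y. hit_kernel (x + y) (\<eta> * real k) * stay_prob \<eta> i y \<partial>exp_law)" if k: "k > 0" for k i
  proof -
    define t where "t = \<eta> * real k"
    have t: "t > 0" using k \<eta>_pos by (simp add: t_def)
    have "\<P>(\<omega> in M. V k \<omega> \<in> {x<..} \<and> (\<forall>j\<in>{1..i}. V (k + j) \<omega> \<le> x))
        = (\<integral>v. indicator {x<..} v * normal_density (- t) (sqrt (2 * t)) v * stay_prob \<eta> i (v - x) \<partial>lborel)"
      unfolding t_def by (rule markov_property[OF k]) simp
    also have "\<dots> = (\<integral>y. indicator {x<..} (x + y) * normal_density (- t) (sqrt (2 * t)) (x + y) * stay_prob \<eta> i (x + y - x) \<partial>lborel)"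
      by (subst lborel_integral_real_affine[of 1 _ x]) auto
    also have "\<dots> = (\<integral>y. exp (- x) * (indicator {0<..} y * exp (- y) * (hit_kernel (x + y) t * stay_prob \<eta> i y)) \<partial>lborel)"
    proof (intro Bochner_Integration.integral_cong refl)
      fix y
      have "exp (- (x + y)) = exp (- x) * exp (- y)"
        by (simp flip: exp_add)
      then show "indicator {x<..} (x + y) * normal_density (- t) (sqrt (2 * t)) (x + y) * stay_prob \<eta> i (x + y - x)
          = exp (- x) * (indicator {0<..} y * exp (- y) * (hit_kernel (x + y) t * stay_prob \<eta> i y))"
        unfolding normal_density_eq_hit_kernel[OF t] by (simp add: indicator_def)
    qed
    also have "\<dots> = exp (- x) * (\<integral>y. hit_kernel (x + y) t * stay_prob \<eta> i y \<partial>exp_law)"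
      by (subst integral_exp_law) auto
    finally show ?thesis by (simp add: exp_minus t_def)
  qed
  have "exp x * hit_prob n x = (\<Sum>k=1..n. \<integral>y. hit_kernel (x + y) (\<eta> * real k) * stay_prob \<eta> (n - k) y \<partial>exp_law)"
    unfolding hit_prob_last_exit sum_distrib_left by (intro sum.cong term_eq refl) auto
  also have "\<dots> = (\<integral>y. (\<Sum>k=1..n. hit_kernel (x + y) (\<eta> * real k) * stay_prob \<eta> (n - k) y) \<partial>exp_law)"
    using \<eta>_pos by (intro Bochner_Integration.integral_sum[symmetric] integrable_hit_term) auto
  finally show ?thesis .
qed

text \<open>Level \<open>z\<close> and overshoot \<open>y\<close> are separate arguments, although
  \<open>z = x + y\<close> in the integrals, because the kernel is estimated through
  \<open>z\<close> and the stay probabilities through \<open>y\<close>. The factor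
  \<open>\<eta>\<close> makes this a weighted Riemann sum.\<close>

definition exit_sum :: "nat \<Rightarrow> real \<Rightarrow> real \<Rightarrow> real" where
  "exit_sum n z y = (\<Sum>k=1..n. \<eta> * hit_kernel z (\<eta> * real k) * stay_prob \<eta> (n - k) y)"

lemma exp_hit_prob_exit_sum: "\<eta> * exp x * hit_prob n x = (\<integral>y. exit_sum n (x + y) y \<partial>exp_law)"
proof -
  have "\<eta> * (\<integral>y. (\<Sum>k=1..n. hit_kernel (x + y) (\<eta> * real k) * stay_prob \<eta> (n - k) y) \<partial>exp_law)
      = (\<integral>y. exit_sum n (x + y) y \<partial>exp_law)"
    unfolding exit_sum_def by (subst integral_mult_right_zero[symmetric]) (simp add: sum_distrib_left mult.assoc)
  then show ?thesis using exp_hit_prob[of x n] by (simp add: mult.assoc)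
qed

lemma measurable_exit_sum [measurable]: "(\<lambda>y. exit_sum n (x + y) y) \<in> borel_measurable borel"
  unfolding exit_sum_def by measurable

lemma shows exit_sum_nonneg: "0 \<le> exit_sum n z y"
    and exit_sum_le: "exit_sum n z y \<le> mesh_sum \<eta> z n"
    and exit_sum_ge: "escape_prob \<eta> y * mesh_sum \<eta> z n \<le> exit_sum n z y"
    and exit_sum_le': "exit_sum n z y \<le> stay_prob \<eta> L y * mesh_sum \<eta> z n
      + (\<Sum>k\<in>{n-L<..n}. \<eta> * hit_kernel z (\<eta> * real k))"
proof -
  have a: "0 \<le> \<eta> * hit_kernel z (\<eta> * real k)" for k
    using \<eta>_pos by (simp add: hit_kernel_nonneg)
  show "0 \<le> exit_sum n z y"
    unfolding exit_sum_def by (intro sum_nonneg mult_nonneg_nonneg[OF a stay_prob_nonneg])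
  show "exit_sum n z y \<le> mesh_sum \<eta> z n"
    unfolding exit_sum_def mesh_sum_def using a stay_prob_le_1 by (intro sum_mono mult_left_le) auto
  show "escape_prob \<eta> y * mesh_sum \<eta> z n \<le> exit_sum n z y"
    and "exit_sum n z y \<le> stay_prob \<eta> L y * mesh_sum \<eta> z n
      + (\<Sum>k\<in>{n-L<..n}. \<eta> * hit_kernel z (\<eta> * real k))"
    unfolding exit_sum_def mesh_sum_def
    using convolution_bounds[of "\<lambda>k. \<eta> * hit_kernel z (\<eta> * real k)" "\<lambda>i. stay_prob \<eta> i y" "escape_prob \<eta> y",
        OF a decseq_stay_prob stay_prob_le_1 escape_prob_le_stay_prob stay_prob_nonneg] by auto
qed

lemma exit_sum_tendsto:
  assumes "z > 0" shows "(\<lambda>n. exit_sum n z y) \<longlonglongrightarrow> escape_prob \<eta> y * mesh_limit \<eta> z"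
  unfolding exit_sum_def
proof (rule convolution_tendsto[OF _ decseq_stay_prob stay_prob_le_1 escape_prob_le_stay_prob stay_prob_nonneg stay_prob_tendsto])
  show "(\<lambda>n. \<Sum>k=1..n. \<eta> * hit_kernel z (\<eta> * real k)) \<longlonglongrightarrow> mesh_limit \<eta> z"
    using mesh_sum_tendsto[OF \<eta>_pos assms] by (simp add: mesh_sum_def[abs_def])
qed (use \<eta>_pos in \<open>simp add: hit_kernel_nonneg\<close>)

lemma integrable_escape_prob: "integrable exp_law (escape_prob \<eta>)"
  by (rule exp_law.integrable_const_bound[where B=1]) (auto simp: escape_prob_nonneg escape_prob_le_1)

lemma measurable_mesh_limit [measurable]: "(\<lambda>y. mesh_limit \<eta> (x + y)) \<in> borel_measurable borel"
  unfolding mesh_limit_def mesh_sum_def by measurable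

text \<open>Both sides are the limit of \<open>\<eta> * exp x * hit_prob n x\<close> as
  \<open>n\<close> grows; the uniform bound on \<open>mesh_sum\<close> dominates the
  integrands.\<close>

lemma ever_hit_prob_eq:
  assumes x: "x > 0"
  shows "\<eta> * exp x * ever_hit_prob x = (\<integral>y. escape_prob \<eta> y * mesh_limit \<eta> (x + y) \<partial>exp_law)"
proof (rule LIMSEQ_unique)
  show "(\<lambda>n. \<eta> * exp x * hit_prob n x) \<longlonglongrightarrow> \<eta> * exp x * ever_hit_prob x"
    by (intro tendsto_intros hit_prob_tendsto)
  show "(\<lambda>n. \<eta> * exp x * hit_prob n x) \<longlonglongrightarrow> (\<integral>y. escape_prob \<eta> y * mesh_limit \<eta> (x + y) \<partial>exp_law)"
    unfolding exp_hit_prob_exit_sum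
  proof (rule integral_dominated_convergence[where w="\<lambda>_. 1 + 2 * \<eta> * mesh_error x"])
    show "AE y in exp_law. (\<lambda>n. exit_sum n (x + y) y) \<longlonglongrightarrow> escape_prob \<eta> y * mesh_limit \<eta> (x + y)"
      using AE_exp_law_pos by eventually_elim (use x in \<open>auto intro!: exit_sum_tendsto\<close>)
    show "AE y in exp_law. norm (exit_sum n (x + y) y) \<le> 1 + 2 * \<eta> * mesh_error x" for n
      using AE_exp_law_pos
    proof eventually_elim
      case (elim y)
      have "exit_sum n (x + y) y \<le> 1 + 2 * \<eta> * mesh_error x"
        using exit_sum_le[of n "x + y" y] mesh_sum_le[OF \<eta>_pos x, of "x + y" n] elim by simp
      then show ?case using exit_sum_nonneg[of n "x + y" y] by simp
    qed
  qed auto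
qed

lemma escape_const_nonneg: "escape_const \<eta> \<ge> 0"
  unfolding escape_const_def by (intro integral_nonneg_AE) (simp add: escape_prob_nonneg)

text \<open>The error is proportional to \<open>escape_const \<eta>\<close> and not just to
  \<open>\<eta>\<close>, so that after division by \<open>\<eta>\<close> it still vanishes when the
  mesh is refined.\<close>

lemma ever_hit_prob_bound:
  assumes x: "x > 0"
  shows "\<bar>\<eta> * exp x * ever_hit_prob x - escape_const \<eta>\<bar> \<le> 2 * \<eta> * mesh_error x * escape_const \<eta>"
proof -
  have bnd: "\<bar>mesh_limit \<eta> (x + y) - 1\<bar> \<le> 2 * \<eta> * mesh_error x" if "y > 0" for y
    using mesh_limit_bound[OF \<eta>_pos x] that by simp
  have pw: "\<bar>escape_prob \<eta> y * mesh_limit \<eta> (x + y) - escape_prob \<eta> y\<bar> \<le> 2 * \<eta> * mesh_error x * escape_prob \<eta> y"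
    if "y > 0" for y
  proof -
    have "\<bar>escape_prob \<eta> y * mesh_limit \<eta> (x + y) - escape_prob \<eta> y\<bar> = escape_prob \<eta> y * \<bar>mesh_limit \<eta> (x + y) - 1\<bar>"
    proof -
      have "escape_prob \<eta> y * mesh_limit \<eta> (x + y) - escape_prob \<eta> y = escape_prob \<eta> y * (mesh_limit \<eta> (x + y) - 1)"
        by (simp add: right_diff_distrib)
      then show ?thesis using escape_prob_nonneg[of y] by (simp only: abs_mult abs_of_nonneg)
    qed
    also have "\<dots> \<le> escape_prob \<eta> y * (2 * \<eta> * mesh_error x)"
      by (intro mult_left_mono bnd that escape_prob_nonneg)
    finally show ?thesis by (simp add: mult_ac)
  qed
  have int: "integrable exp_law (\<lambda>y. escape_prob \<eta> y * mesh_limit \<eta> (x + y))"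
  proof (rule exp_law.integrable_const_bound[where B="1 + 2 * \<eta> * mesh_error x"])
    show "AE y in exp_law. norm (escape_prob \<eta> y * mesh_limit \<eta> (x + y)) \<le> 1 + 2 * \<eta> * mesh_error x"
      using AE_exp_law_pos
    proof eventually_elim
      case (elim y)
      have "\<bar>escape_prob \<eta> y * mesh_limit \<eta> (x + y)\<bar> \<le> 1 * \<bar>mesh_limit \<eta> (x + y)\<bar>"
        unfolding abs_mult using escape_prob_nonneg[of y] escape_prob_le_1[of y] by (intro mult_right_mono) auto
      then show ?case using bnd[OF elim] by simp
    qed
  qed auto
  have "\<bar>\<eta> * exp x * ever_hit_prob x - escape_const \<eta>\<bar>
      = \<bar>\<integral>y. escape_prob \<eta> y * mesh_limit \<eta> (x + y) - escape_prob \<eta> y \<partial>exp_law\<bar>"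
    unfolding ever_hit_prob_eq[OF x] escape_const_def using int integrable_escape_prob by simp
  also have "\<dots> \<le> (\<integral>y. \<bar>escape_prob \<eta> y * mesh_limit \<eta> (x + y) - escape_prob \<eta> y\<bar> \<partial>exp_law)"
    by (rule integral_abs_bound)
  also have "\<dots> \<le> (\<integral>y. 2 * \<eta> * mesh_error x * escape_prob \<eta> y \<partial>exp_law)"
    using int integrable_escape_prob pw AE_exp_law_pos by (intro integral_mono_AE) (auto elim: eventually_mono)
  finally show ?thesis by (simp add: escape_const_def)
qed

lemma exp_ever_hit_prob_tendsto:
  "((\<lambda>x. \<eta> * exp x * ever_hit_prob x) \<longlongrightarrow> escape_const \<eta>) at_top"
proof (rule LIM_zero_cancel, rule Lim_null_comparison)
  show "((\<lambda>x. 2 * \<eta> * mesh_error x * escape_const \<eta>) \<longlongrightarrow> 0) at_top"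
    by (intro tendsto_mult_left_zero tendsto_mult_right_zero mesh_error_tendsto_0)
  show "\<forall>\<^sub>F x in at_top. norm (\<eta> * exp x * ever_hit_prob x - escape_const \<eta>) \<le> 2 * \<eta> * mesh_error x * escape_const \<eta>"
    using eventually_gt_at_top[of 0] by eventually_elim (simp add: ever_hit_prob_bound)
qed

text \<open>The horizon lies in the central limit window, where \<open>mesh_sum\<close> tends to
  \<open>Phi s\<close>. The last \<open>L\<close> terms of \<open>exit_sum\<close> are negligible
  because the kernel is uniformly small, and in the others the stay probability is at most
  \<open>stay_prob \<eta> L y\<close>, which is close to its limit for large
  \<open>L\<close>.\<close>

lemma exp_hit_prob_tendsto:
  fixes n :: "real \<Rightarrow> nat"
  assumes n: "((\<lambda>x. (\<eta> * real (n x) - x) / sqrt (2 * x)) \<longlongrightarrow> s) at_top"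
  shows "((\<lambda>x. \<eta> * exp x * hit_prob (n x) x) \<longlongrightarrow> Phi s * escape_const \<eta>) at_top"
proof -
  have err: "((\<lambda>x. 2 * \<eta> * mesh_error x) \<longlongrightarrow> 0) at_top"
    by (intro tendsto_mult_right_zero mesh_error_tendsto_0)
  have mesh: "((\<lambda>x. mesh_sum \<eta> (x + y) (n x)) \<longlongrightarrow> Phi s) at_top" if y: "y > 0" for y
  proof (rule Lim_transform[OF hit_cdf_tendsto_Phi[OF n, of y]], rule Lim_null_comparison[OF _ err])
    show "\<forall>\<^sub>F x in at_top. norm (mesh_sum \<eta> (x + y) (n x) - hit_cdf (x + y) (\<eta> * real (n x))) \<le> 2 * \<eta> * mesh_error x"
      using eventually_gt_at_top[of 0] by eventually_elim (use y in \<open>auto intro!: mesh_sum_bound \<eta>_pos\<close>)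
  qed
  have pointwise: "((\<lambda>x. exit_sum (n x) (x + y) y) \<longlongrightarrow> escape_prob \<eta> y * Phi s) at_top" if y: "y > 0" for y
  proof (rule tendstoI)
    fix e :: real assume e: "e > 0"
    have "(\<lambda>L. stay_prob \<eta> L y * Phi s) \<longlonglongrightarrow> escape_prob \<eta> y * Phi s"
      by (intro tendsto_intros stay_prob_tendsto)
    then have "eventually (\<lambda>L. dist (stay_prob \<eta> L y * Phi s) (escape_prob \<eta> y * Phi s) < e) sequentially"
      using e by (rule tendstoD)
    then obtain L where L: "dist (stay_prob \<eta> L y * Phi s) (escape_prob \<eta> y * Phi s) < e"
      by (auto simp: eventually_sequentially)
    have "((\<lambda>x. stay_prob \<eta> L y * mesh_sum \<eta> (x + y) (n x) + real L * (\<eta> * mesh_error x))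
        \<longlongrightarrow> stay_prob \<eta> L y * Phi s + 0) at_top"
      by (intro tendsto_intros mesh y tendsto_mult_right_zero mesh_error_tendsto_0)
    moreover have "stay_prob \<eta> L y * Phi s + 0 < escape_prob \<eta> y * Phi s + e"
      using L by (simp add: dist_real_def)
    ultimately have up: "eventually (\<lambda>x. stay_prob \<eta> L y * mesh_sum \<eta> (x + y) (n x) + real L * (\<eta> * mesh_error x)
        < escape_prob \<eta> y * Phi s + e) at_top"
      by (rule order_tendstoD(2))
    have "((\<lambda>x. escape_prob \<eta> y * mesh_sum \<eta> (x + y) (n x)) \<longlongrightarrow> escape_prob \<eta> y * Phi s) at_top"
      by (intro tendsto_intros mesh y)
    then have low: "eventually (\<lambda>x. escape_prob \<eta> y * Phi s - e < escape_prob \<eta> y * mesh_sum \<eta> (x + y) (n x)) at_top"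
      by (rule order_tendstoD(1)) (use e in simp)
    show "eventually (\<lambda>x. dist (exit_sum (n x) (x + y) y) (escape_prob \<eta> y * Phi s) < e) at_top"
      using up low eventually_gt_at_top[of 0]
    proof eventually_elim
      case (elim x)
      have "(\<Sum>k\<in>{n x - L<..n x}. \<eta> * hit_kernel (x + y) (\<eta> * real k)) \<le> real (card {n x - L<..n x}) * (\<eta> * mesh_error x)"
      proof (rule sum_bounded_above)
        fix k
        have "hit_kernel (x + y) (\<eta> * real k) \<le> mesh_error (x + y)"
          using elim y \<eta>_pos by (intro hit_kernel_le_mesh_error) auto
        also have "\<dots> \<le> mesh_error x" using elim y by (intro mesh_error_antimono) auto
        finally show "\<eta> * hit_kernel (x + y) (\<eta> * real k) \<le> \<eta> * mesh_error x"
          using \<eta>_pos by simp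
      qed
      also have "\<dots> \<le> real L * (\<eta> * mesh_error x)"
        using elim \<eta>_pos mesh_error_pos[of x] by (intro mult_right_mono) auto
      finally show ?case
        using exit_sum_le'[of "n x" "x + y" y L] exit_sum_ge[of y "x + y" "n x"] elim
        by (simp add: dist_real_def abs_less_iff)
    qed
  qed
  have "((\<lambda>x. \<integral>y. exit_sum (n x) (x + y) y \<partial>exp_law) \<longlongrightarrow> (\<integral>y. escape_prob \<eta> y * Phi s \<partial>exp_law)) at_top"
  proof (rule integral_dominated_convergence_at_top[where w="\<lambda>_. 2"])
    show "AE y in exp_law. ((\<lambda>x. exit_sum (n x) (x + y) y) \<longlongrightarrow> escape_prob \<eta> y * Phi s) at_top"
      using AE_exp_law_pos by eventually_elim (rule pointwise)
    \<comment> \<open>The dominating constant 2 is the bound 1 for \<open>hit_cdf\<close> plus a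
      mesh error that is eventually below 1.\<close>
    have "eventually (\<lambda>x. 2 * \<eta> * mesh_error x < 1) at_top"
      by (rule order_tendstoD(2)[OF err]) simp
    then show "\<forall>\<^sub>F x in at_top. AE y in exp_law. norm (exit_sum (n x) (x + y) y) \<le> 2"
      using eventually_gt_at_top[of 0]
    proof eventually_elim
      case (elim x)
      show ?case
        using AE_exp_law_pos
      proof eventually_elim
        case (elim y)
        with \<open>2 * \<eta> * mesh_error x < 1\<close> \<open>x > 0\<close> show ?case
          using exit_sum_nonneg[of "n x" "x + y" y] exit_sum_le[of "n x" "x + y" y]
            mesh_sum_le[OF \<eta>_pos, of x "x + y" "n x"] by simp
      qed
    qed
  qed auto
  then show ?thesis
    unfolding exp_hit_prob_exit_sum by (simp add: escape_const_def mult.commute)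
qed

end

text \<open>Among the \<open>n + 1\<close> pairs on the antidiagonal all but at most
  \<open>2 * K\<close> have both entries at least \<open>K\<close>; the exceptional terms are
  bounded and disappear after division by \<open>n + 1\<close>.\<close>

lemma antidiagonal_cesaro:
  fixes f :: "nat \<Rightarrow> nat \<Rightarrow> real"
  assumes bound: "\<And>a b. \<bar>f a b\<bar> \<le> 1"
    and lim: "\<And>e. e > 0 \<Longrightarrow> \<exists>K. \<forall>a\<ge>K. \<forall>b\<ge>K. \<bar>f a b - l\<bar> < e"
  shows "(\<lambda>n. (\<Sum>k\<le>n. f k (n - k)) / real (Suc n)) \<longlonglongrightarrow> l"
proof (rule LIMSEQ_I)
  fix r :: real assume "r > 0"
  then obtain K where K: "\<And>a b. a \<ge> K \<Longrightarrow> b \<ge> K \<Longrightarrow> \<bar>f a b - l\<bar> < r / 2"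
    using lim[of "r / 2"] by (auto simp: )
  define C where "C = 1 + \<bar>l\<bar>"
  have "(\<lambda>n. r / 2 + 2 * real K * C / real (Suc n)) \<longlonglongrightarrow> r / 2 + 0"
    by (intro tendsto_intros LIMSEQ_Suc[OF lim_const_over_n])
  then have "eventually (\<lambda>n. r / 2 + 2 * real K * C / real (Suc n) < r) sequentially"
    by (rule order_tendstoD(2)) (use \<open>r > 0\<close> in simp)
  then obtain n0 where n0: "\<And>n. n \<ge> n0 \<Longrightarrow> r / 2 + 2 * real K * C / real (Suc n) < r"
    by (auto simp: eventually_sequentially)
  show "\<exists>no. \<forall>n\<ge>no. norm ((\<Sum>k\<le>n. f k (n - k)) / real (Suc n) - l) < r"
  proof (intro exI allI impI)
    fix n assume n: "n \<ge> n0"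
    have term_le: "\<bar>f k (n - k) - l\<bar> \<le> r / 2 + (if k < K then C else 0) + (if n - k < K then C else 0)" for k
      using K[of k "n - k"] bound[of k "n - k"] \<open>r > 0\<close> by (auto simp: C_def not_less)
    have c1: "card {k. k \<le> n \<and> k < K} \<le> card {..<K}"
      by (rule card_mono) auto
    have c2: "card {k. k \<le> n \<and> n - k < K} \<le> card {..<K}"
      by (rule card_inj_on_le[of "\<lambda>k. n - k"]) (auto simp: inj_on_def)
    have "0 \<le> C" by (simp add: C_def)
    with c1 c2 have cards: "real (card {k. k \<le> n \<and> k < K}) * C + real (card {k. k \<le> n \<and> n - k < K}) * C \<le> 2 * real K * C"
      unfolding distrib_right[symmetric] by (intro mult_right_mono) simp_all
    have "\<bar>(\<Sum>k\<le>n. f k (n - k)) - l * real (Suc n)\<bar> = \<bar>\<Sum>k\<le>n. f k (n - k) - l\<bar>"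
      by (simp add: sum_subtractf mult.commute)
    also have "\<dots> \<le> (\<Sum>k\<le>n. \<bar>f k (n - k) - l\<bar>)" by (rule sum_abs)
    also have "\<dots> \<le> (\<Sum>k\<le>n. r / 2 + (if k < K then C else 0) + (if n - k < K then C else 0))"
      by (intro sum_mono term_le)
    also have "\<dots> = r / 2 * real (Suc n) + (real (card {k. k \<le> n \<and> k < K}) * C + real (card {k. k \<le> n \<and> n - k < K}) * C)"
    proof -
      have "(\<Sum>k\<le>n. if P k then C else 0) = real (card {k. k \<le> n \<and> P k}) * C" for P
        using sum.inter_filter[of "{..n}" "\<lambda>_. C" P] by simp
      then show ?thesis by (simp only: sum.distrib) simp
    qed
    also have "\<dots> \<le> r / 2 * real (Suc n) + 2 * real K * C"
      using cards by simp
    finally have "\<bar>(\<Sum>k\<le>n. f k (n - k)) - l * real (Suc n)\<bar> / real (Suc n) \<le> (r / 2 * real (Suc n) + 2 * real K * C) / real (Suc n)"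
      by (rule divide_right_mono) simp
    moreover have "\<bar>(\<Sum>k\<le>n. f k (n - k)) - l * real (Suc n)\<bar> / real (Suc n) = \<bar>(\<Sum>k\<le>n. f k (n - k)) / real (Suc n) - l\<bar>"
    proof -
      have "(\<Sum>k\<le>n. f k (n - k)) / real (Suc n) - l = ((\<Sum>k\<le>n. f k (n - k)) - l * real (Suc n)) / real (Suc n)"
        by (simp add: diff_divide_distrib del: of_nat_Suc)
      then show ?thesis by (simp add: abs_divide del: of_nat_Suc)
    qed
    moreover have "(r / 2 * real (Suc n) + 2 * real K * C) / real (Suc n) = r / 2 + 2 * real K * C / real (Suc n)"
      by (subst add_divide_distrib) (simp del: of_nat_Suc)
    ultimately show "norm ((\<Sum>k\<le>n. f k (n - k)) / real (Suc n) - l) < r"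
      using n0[OF n] by simp
  qed
qed

text \<open>Both measures agree on boxes, where density and indicator factor over the coordinates,
  and boxes determine a finite product measure.\<close>

lemma PiM_density:
  fixes f :: "'i \<Rightarrow> 'a \<Rightarrow> ennreal"
  assumes I: "finite I" and M: "product_sigma_finite M" and Mf: "product_sigma_finite (\<lambda>i. density (M i) (f i))"
    and f[measurable]: "\<And>i. f i \<in> borel_measurable (M i)"
  shows "PiM I (\<lambda>i. density (M i) (f i)) = density (PiM I M) (\<lambda>x. \<Prod>i\<in>I. f i (x i))"
proof -
  interpret M: product_sigma_finite M by fact
  interpret Mf: product_sigma_finite "\<lambda>i. density (M i) (f i)" by fact
  show ?thesis
  proof (rule Mf.PiM_eqI[OF I, symmetric])
    show "sets (density (PiM I M) (\<lambda>x. \<Prod>i\<in>I. f i (x i))) = sets (PiM I (\<lambda>i. density (M i) (f i)))"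
      unfolding sets_density by (rule sets_PiM_cong) simp_all
    fix A assume "\<And>i. i \<in> I \<Longrightarrow> A i \<in> sets (density (M i) (f i))"
    then have A: "\<And>i. i \<in> I \<Longrightarrow> A i \<in> sets (M i)" by simp
    have "emeasure (density (PiM I M) (\<lambda>x. \<Prod>i\<in>I. f i (x i))) (PiE I A)
        = (\<integral>\<^sup>+x. (\<Prod>i\<in>I. f i (x i)) * indicator (PiE I A) x \<partial>PiM I M)"
    proof (rule emeasure_density)
      have "(\<lambda>x. f i (x i)) \<in> borel_measurable (PiM I M)" if "i \<in> I" for i
        by (rule measurable_compose[OF measurable_component_singleton[OF that] f])
      then show "(\<lambda>x. \<Prod>i\<in>I. f i (x i)) \<in> borel_measurable (PiM I M)"
        by (rule borel_measurable_prod_ennreal)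
    qed (use I A in auto)
    also have "\<dots> = (\<integral>\<^sup>+x. (\<Prod>i\<in>I. f i (x i) * indicator (A i) (x i)) \<partial>PiM I M)"
    proof (rule nn_integral_cong)
      fix x assume "x \<in> space (PiM I M)"
      then have "x \<in> extensional I" by (auto simp: space_PiM PiE_def)
      then have "indicator (PiE I A) x = (\<Prod>i\<in>I. indicator (A i) (x i) :: ennreal)"
        using I by (cases "\<forall>i\<in>I. x i \<in> A i") (auto simp: PiE_def Pi_def indicator_def intro!: prod_zero[symmetric])
      then show "(\<Prod>i\<in>I. f i (x i)) * indicator (PiE I A) x = (\<Prod>i\<in>I. f i (x i) * indicator (A i) (x i))"
        by (simp add: prod.distrib)
    qed
    also have "\<dots> = (\<Prod>i\<in>I. \<integral>\<^sup>+x. f i x * indicator (A i) x \<partial>M i)"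
      using I A by (intro M.product_nn_integral_prod) auto
    also have "\<dots> = (\<Prod>i\<in>I. emeasure (density (M i) (f i)) (A i))"
      using A by (intro prod.cong refl emeasure_density[symmetric]) auto
    finally show "emeasure (density (PiM I M) (\<lambda>x. \<Prod>i\<in>I. f i (x i))) (PiE I A)
        = (\<Prod>i\<in>I. emeasure (density (M i) (f i)) (A i))" .
  qed
qed

text \<open>At \<open>a = - m\<close> the value is \<open>max 1 (exp m) - exp m\<close>, the amount
  by which a maximum \<open>exp m\<close> grows when the value 1 at time 0 is included.\<close>

lemma emeasure_exp_law_atMost: "emeasure exp_law {..a} = ennreal (max 0 (1 - exp (- a)))"
proof (cases "a \<ge> 0")
  case True
  have "distributed exp_law lborel (\<lambda>x. x) (exponential_density 1)"
    unfolding distributed_def by (auto simp: distr_id2)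
  from exp_law.exponential_distributedD_le[OF this True] True show ?thesis
    by (simp add: exp_law.emeasure_eq_measure atMost_def)
next
  case False
  then have "AE y in exp_law. y \<notin> {..a}"
    using AE_exp_law_pos by (auto elim: eventually_mono)
  then have "emeasure exp_law {..a} = 0"
    by (subst (asm) AE_iff_measurable[of "{..a}"]) auto
  then show ?thesis using False by simp
qed

section \<open>The mean maximum of the exponential walk\<close>

context gaussian_walk
begin

lemma nn_integral_stay_prob:
  "(\<integral>\<^sup>+\<omega>. emeasure exp_law {y. \<forall>j\<in>{1..n}. V j \<omega> \<le> - y} \<partial>M) = ennreal (\<integral>y. stay_prob \<eta> n y \<partial>exp_law)"
proof -
  interpret pair_sigma_finite M exp_law ..
  have P: "Measurable.pred (M \<Otimes>\<^sub>M exp_law) (\<lambda>w. \<forall>j\<in>{1..n}. V j (fst w) \<le> - snd w)"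
    by measurable
  then have ind[measurable]: "(\<lambda>(\<omega>, y). indicator {w. \<forall>j\<in>{1..n}. V j (fst w) \<le> - snd w} (\<omega>, y) :: ennreal) \<in> borel_measurable (M \<Otimes>\<^sub>M exp_law)"
    by (simp add: indicator_def[abs_def] case_prod_beta')
  have "(\<integral>\<^sup>+\<omega>. emeasure exp_law {y. \<forall>j\<in>{1..n}. V j \<omega> \<le> - y} \<partial>M)
      = (\<integral>\<^sup>+\<omega>. (\<integral>\<^sup>+y. indicator {w. \<forall>j\<in>{1..n}. V j (fst w) \<le> - snd w} (\<omega>, y) \<partial>exp_law) \<partial>M)"
  proof (rule nn_integral_cong)
    fix \<omega> assume "\<omega> \<in> space M"
    have "(\<integral>\<^sup>+y. indicator {w. \<forall>j\<in>{1..n}. V j (fst w) \<le> - snd w} (\<omega>, y) \<partial>exp_law)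
        = (\<integral>\<^sup>+y. indicator {y. \<forall>j\<in>{1..n}. V j \<omega> \<le> - y} y \<partial>exp_law)"
      by (rule nn_integral_cong) (simp add: indicator_def)
    also have "\<dots> = emeasure exp_law {y. \<forall>j\<in>{1..n}. V j \<omega> \<le> - y}"
      by (rule nn_integral_indicator) measurable
    finally show "emeasure exp_law {y. \<forall>j\<in>{1..n}. V j \<omega> \<le> - y}
      = (\<integral>\<^sup>+y. indicator {w. \<forall>j\<in>{1..n}. V j (fst w) \<le> - snd w} (\<omega>, y) \<partial>exp_law)" by simp
  qed
  also have "\<dots> = (\<integral>\<^sup>+y. (\<integral>\<^sup>+\<omega>. indicator {w. \<forall>j\<in>{1..n}. V j (fst w) \<le> - snd w} (\<omega>, y) \<partial>M) \<partial>exp_law)"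
    by (rule Fubini'[OF ind, symmetric])
  also have "\<dots> = (\<integral>\<^sup>+y. ennreal (stay_prob \<eta> n y) \<partial>exp_law)"
  proof (rule nn_integral_cong)
    fix y
    have "(\<integral>\<^sup>+\<omega>. indicator {w. \<forall>j\<in>{1..n}. V j (fst w) \<le> - snd w} (\<omega>, y) \<partial>M)
        = (\<integral>\<^sup>+\<omega>. indicator {\<omega> \<in> space M. \<forall>j\<in>{1..n}. V j \<omega> \<le> - y} \<omega> \<partial>M)"
      by (rule nn_integral_cong) (simp add: indicator_def)
    also have "\<dots> = emeasure M {\<omega> \<in> space M. \<forall>j\<in>{1..n}. V j \<omega> \<le> - y}"
      by (rule nn_integral_indicator) measurable
    finally show "(\<integral>\<^sup>+\<omega>. indicator {w. \<forall>j\<in>{1..n}. V j (fst w) \<le> - snd w} (\<omega>, y) \<partial>M) = ennreal (stay_prob \<eta> n y)"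
      by (simp add: stay_prob_eq emeasure_eq_measure)
  qed
  also have "\<dots> = ennreal (\<integral>y. stay_prob \<eta> n y \<partial>exp_law)"
    by (intro nn_integral_eq_integral exp_law.integrable_const_bound[where B=1])
       (auto simp: stay_prob_nonneg stay_prob_le_1)
  finally show ?thesis .
qed

text \<open>Taken in \<open>ennreal\<close>, so that it can be expanded without first proving
  integrability; finiteness comes out of \<open>mean_max_eq_stay_sum\<close>.\<close>

definition mean_max :: "nat \<Rightarrow> ennreal" where
  "mean_max n = (\<integral>\<^sup>+\<omega>. ennreal (MAX j\<in>{0..n}. exp (V j \<omega>)) \<partial>M)"

lemma V_0 [simp]: "V 0 \<omega> = 0"
  by (simp add: V_def)

lemma measurable_Max_exp_V [measurable]:
  "(\<lambda>\<omega>. MAX j\<in>{a..b}. exp (V j \<omega>)) \<in> borel_measurable M"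
  by (cases "a \<le> b") (auto intro!: borel_measurable_Max)

text \<open>Peeling off time 0: the maximum grows by \<open>max 1 (exp m) - exp m\<close>, which is
  the probability that an exponential variable is at most \<open>- m\<close>. Averaging over the
  walk turns this into the mean of \<open>stay_prob\<close> under \<open>exp_law\<close>.\<close>

lemma mean_max_decompose:
  assumes n: "n \<ge> 1"
  shows "mean_max n = (\<integral>\<^sup>+\<omega>. ennreal (MAX j\<in>{1..n}. exp (V j \<omega>)) \<partial>M) + ennreal (\<integral>y. stay_prob \<eta> n y \<partial>exp_law)"
proof -
  have pw: "ennreal (MAX j\<in>{0..n}. exp (V j \<omega>)) =
      ennreal (MAX j\<in>{1..n}. exp (V j \<omega>)) + emeasure exp_law {y. \<forall>j\<in>{1..n}. V j \<omega> \<le> - y}" for \<omega>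
  proof -
    define m where "m = (MAX j\<in>{1..n}. V j \<omega>)"
    have "exp m = (MAX x\<in>(\<lambda>j. V j \<omega>) ` {1..n}. exp x)"
      unfolding m_def using n by (intro mono_Max_commute) (auto intro!: monoI)
    then have m: "(MAX j\<in>{1..n}. exp (V j \<omega>)) = exp m"
      by (simp add: image_image)
    have "{0..n} = insert 0 {1..n}" by auto
    then have "(MAX j\<in>{0..n}. exp (V j \<omega>)) = max 1 (exp m)"
      using n m by simp
    moreover have "{y. \<forall>j\<in>{1..n}. V j \<omega> \<le> - y} = {..- m}"
    proof -
      have "(\<forall>j\<in>{1..n}. V j \<omega> \<le> - y) \<longleftrightarrow> m \<le> - y" for y
        unfolding m_def using n by (subst Max_le_iff) auto
      then show ?thesis by auto
    qed
    ultimately show ?thesis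
      unfolding m by (simp add: emeasure_exp_law_atMost max_def flip: ennreal_plus)
  qed
  have "(\<lambda>\<omega>. emeasure exp_law {y. \<forall>j\<in>{1..n}. V j \<omega> \<le> - y}) \<in> borel_measurable M"
  proof -
    define m where "m \<omega> = (MAX j\<in>{1..n}. V j \<omega>)" for \<omega>
    have "{y. \<forall>j\<in>{1..n}. V j \<omega> \<le> - y} = {..- m \<omega>}" for \<omega>
    proof -
      have "(\<forall>j\<in>{1..n}. V j \<omega> \<le> - y) \<longleftrightarrow> m \<omega> \<le> - y" for y
        unfolding m_def using n by (subst Max_le_iff) auto
      then show ?thesis by auto
    qed
    moreover have "m \<in> borel_measurable M"
      unfolding m_def using n by (intro borel_measurable_Max) auto
    ultimately show ?thesis by (simp add: emeasure_exp_law_atMost)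
  qed
  then have "mean_max n = (\<integral>\<^sup>+\<omega>. ennreal (MAX j\<in>{1..n}. exp (V j \<omega>)) \<partial>M)
      + (\<integral>\<^sup>+\<omega>. emeasure exp_law {y. \<forall>j\<in>{1..n}. V j \<omega> \<le> - y} \<partial>M)"
    unfolding mean_max_def pw by (intro nn_integral_add) auto
  then show ?thesis
    by (simp only: nn_integral_stay_prob)
qed

lemma mean_max_0: "mean_max 0 = ennreal (\<integral>y. stay_prob \<eta> 0 y \<partial>exp_law)"
  using exp_law.prob_space by (simp add: mean_max_def emeasure_space_1 stay_prob_eq prob_space)

end

subsection \<open>The Pickands constant\<close>

lemma (in prob_space) indep_vars_nat_UNIV:
  assumes "\<And>n. indep_vars M' X {..<n::nat}"
  shows "indep_vars M' X UNIV"
  unfolding indep_vars_def2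
proof (intro conjI ballI)
  fix i :: nat
  show "random_variable (M' i) (X i)"
    using assms[of "Suc i"] by (auto simp: indep_vars_def2)
  show "indep_sets (\<lambda>i. {X i -` A \<inter> space M |A. A \<in> sets (M' i)}) UNIV"
  proof (subst indep_sets_finite_index_sets, intro allI impI)
    fix J :: "nat set" assume "finite J"
    then obtain n where "J \<subseteq> {..<n}" using finite_nat_iff_bounded by auto
    then show "indep_sets (\<lambda>i. {X i -` A \<inter> space M |A. A \<in> sets (M' i)}) J"
      using assms[of n] by (auto simp: indep_vars_def2 intro: indep_sets_mono_index)
  qed
qed

section \<open>Gaussian walks from Brownian increments\<close>

lemma (in brownian_motion) distributed_scaled_increment:
  assumes "s \<in> T" "t \<in> T" "s < t" "a \<noteq> 0"
  shows "distributed M lborel (\<lambda>\<omega>. b + a * (B t \<omega> - B s \<omega>)) (normal_density b (\<bar>a\<bar> * sqrt (t - s)))"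
  using normal_density_affine[OF gaussian_increments[OF assms(1-3)], of a b] assms by simp

lemma (in brownian_motion) indep_scaled_increments:
  assumes "incseq t" "range t \<subseteq> T"
  shows "indep_vars (\<lambda>_. borel) (\<lambda>i \<omega>. b i + a * (B (t (Suc i)) \<omega> - B (t i) \<omega>)) {..<n}"
  by (rule indep_vars_compose2[OF indep_increments[OF assms]]) simp

text \<open>The drift is forced by the scale \<open>a\<close>: the step variance
  \<open>a\<^sup>2 * \<delta>\<close> has to be minus twice the step mean. In the ruin problem
  \<open>a = 2 * c\<close> gives the parameter \<open>2 * c\<^sup>2 * \<delta>\<close>.\<close>

lemma (in brownian_motion) gaussian_walk_increments:
  assumes T: "{0..} \<subseteq> T" and a: "a > 0" and \<delta>: "\<delta> > 0"
  shows "gaussian_walk M (\<lambda>i \<omega>. - (a\<^sup>2 * \<delta> / 2) + a * (B (\<delta> * real (Suc i)) \<omega> - B (\<delta> * real i) \<omega>)) (a\<^sup>2 * \<delta> / 2)"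
proof
  show "a\<^sup>2 * \<delta> / 2 > 0" using a \<delta> by simp
  show "indep_vars (\<lambda>_. borel) (\<lambda>i \<omega>. - (a\<^sup>2 * \<delta> / 2) + a * (B (\<delta> * real (Suc i)) \<omega> - B (\<delta> * real i) \<omega>)) UNIV"
    using T \<delta> by (intro indep_vars_nat_UNIV indep_scaled_increments) (auto simp: incseq_def)
  fix i
  have "distributed M lborel (\<lambda>\<omega>. - (a\<^sup>2 * \<delta> / 2) + a * (B (\<delta> * real (Suc i)) \<omega> - B (\<delta> * real i) \<omega>))
      (normal_density (- (a\<^sup>2 * \<delta> / 2)) (\<bar>a\<bar> * sqrt (\<delta> * real (Suc i) - \<delta> * real i)))"
    using T a \<delta> by (intro distributed_scaled_increment) auto
  moreover have "\<bar>a\<bar> * sqrt (\<delta> * real (Suc i) - \<delta> * real i) = sqrt (2 * (a\<^sup>2 * \<delta> / 2))"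
    using a by (simp add: algebra_simps real_sqrt_mult)
  ultimately show "distributed M lborel (\<lambda>\<omega>. - (a\<^sup>2 * \<delta> / 2) + a * (B (\<delta> * real (Suc i)) \<omega> - B (\<delta> * real i) \<omega>))
      (normal_density (- (a\<^sup>2 * \<delta> / 2)) (sqrt (2 * (a\<^sup>2 * \<delta> / 2))))" by simp
qed

section \<open>Ratio of maximum to sum over a finite window\<close>

lemma Max_mult_left:
  fixes f :: "'i \<Rightarrow> real"
  assumes "finite A" "A \<noteq> {}" "c \<ge> 0"
  shows "c * (MAX j\<in>A. f j) = (MAX j\<in>A. c * f j)"
proof -
  have "c * (MAX j\<in>A. f j) = (MAX x\<in>f ` A. c * x)"
    using assms by (intro mono_Max_commute) (auto intro!: monoI mult_left_mono)
  then show ?thesis by (simp add: image_image)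
qed

definition max_ratio :: "'i set \<Rightarrow> ('i \<Rightarrow> real) \<Rightarrow> real" where
  "max_ratio A w = (MAX j\<in>A. w j) / (\<Sum>j\<in>A. w j)"

text \<open>It discards the reference point: the change of measure acts on increments of
  \<open>W\<close>, while \<open>window_mean\<close> involves \<open>W\<close> itself.\<close>

lemma max_ratio_scale:
  assumes "finite A" "A \<noteq> {}" "c > 0"
  shows "max_ratio A (\<lambda>j. c * w j) = max_ratio A w"
proof -
  have "max_ratio A (\<lambda>j. c * w j) = (c * (MAX j\<in>A. w j)) / (c * (\<Sum>j\<in>A. w j))"
    using assms Max_mult_left[of A c w] by (simp add: max_ratio_def sum_distrib_left)
  then show ?thesis using assms by (simp add: max_ratio_def)
qed

lemma max_ratio_bounds:
  assumes "finite A" "A \<noteq> {}" "\<And>j. j \<in> A \<Longrightarrow> w j > 0"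
  shows "0 \<le> max_ratio A w" "max_ratio A w \<le> 1"
proof -
  have "Max (w ` A) \<in> w ` A" using assms by (intro Max_in) auto
  then obtain i where i: "i \<in> A" "(MAX j\<in>A. w j) = w i" by blast
  moreover have "w i \<le> (\<Sum>j\<in>A. w j)"
    using assms i by (intro member_le_sum) (auto intro: less_imp_le)
  moreover have "w i > 0" using assms i by simp
  ultimately show "0 \<le> max_ratio A w" "max_ratio A w \<le> 1"
    by (auto simp: max_ratio_def)
qed

section \<open>The Pickands process on the grid\<close>

locale two_sided_grid = brownian_motion N UNIV B for N :: "'a measure" and B +
  fixes \<eta> :: real
  assumes \<eta>_pos: "\<eta> > 0"
begin

definition W :: "int \<Rightarrow> 'a \<Rightarrow> real" where
  "W j \<omega> = pickands_process B (\<eta> * of_int j) \<omega>"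

lemma measurable_W [measurable]: "W j \<in> borel_measurable N"
  unfolding W_def pickands_process_def using measurable_B by simp

text \<open>The kink of the absolute value sits at a grid point, so every grid interval lies on one
  side of it and has drift \<open>\<eta>\<close> or \<open>- \<eta>\<close>.\<close>

lemma W_increment:
  "W (j + 1) \<omega> - W j \<omega> = (if j < 0 then \<eta> else - \<eta>) + sqrt 2 * (B (\<eta> * of_int (j + 1)) \<omega> - B (\<eta> * of_int j) \<omega>)"
proof -
  have "\<eta> * of_int i \<le> 0" if "i \<le> 0" for i
    using \<eta>_pos that by (intro mult_nonneg_nonpos) auto
  moreover have "\<eta> * of_int i \<ge> 0" if "i \<ge> 0" for i
    using \<eta>_pos that by (intro mult_nonneg_nonneg) auto
  ultimately have "\<bar>\<eta> * of_int j\<bar> = (if j < 0 then - (\<eta> * of_int j) else \<eta> * of_int j)"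
    and "\<bar>\<eta> * of_int (j + 1)\<bar> = (if j < 0 then - (\<eta> * of_int (j + 1)) else \<eta> * of_int (j + 1))"
    by (cases "j < 0"; simp only: if_True if_False abs_of_nonneg abs_of_nonpos; force)+
  then show ?thesis
    by (auto simp: W_def pickands_process_def algebra_simps)
qed

lemma distributed_W_increment:
  "distributed N lborel (\<lambda>\<omega>. W (j + 1) \<omega> - W j \<omega>) (normal_density (if j < 0 then \<eta> else - \<eta>) (sqrt (2 * \<eta>)))"
proof -
  have "\<bar>sqrt 2\<bar> * sqrt (\<eta> * of_int (j + 1) - \<eta> * of_int j) = sqrt (2 * \<eta>)"
    by (simp add: algebra_simps flip: real_sqrt_mult)
  then show ?thesis
    unfolding W_increment
    using distributed_scaled_increment[of "\<eta> * of_int j" "\<eta> * of_int (j + 1)" "sqrt 2"] \<eta>_pos by simp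
qed

lemma indep_W_increments:
  "indep_vars (\<lambda>_. borel) (\<lambda>i \<omega>. W (int i - k + 1) \<omega> - W (int i - k) \<omega>) {..<n}"
proof -
  define t where "t i = \<eta> * of_int (int i - k)" for i
  have "incseq t" using \<eta>_pos by (auto simp: t_def incseq_def)
  from indep_scaled_increments[OF this, of "\<lambda>i. if int i - k < 0 then \<eta> else - \<eta>" "sqrt 2" n]
  show ?thesis unfolding W_increment by (simp add: t_def algebra_simps)
qed

sublocale walk: gaussian_walk N "\<lambda>i \<omega>. W (int i + 1) \<omega> - W (int i) \<omega>" \<eta>
proof
  show "indep_vars (\<lambda>_. borel) (\<lambda>i \<omega>. W (int i + 1) \<omega> - W (int i) \<omega>) UNIV"
    using indep_W_increments[of 0] by (intro indep_vars_nat_UNIV) simp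
  show "distributed N lborel (\<lambda>\<omega>. W (int i + 1) \<omega> - W (int i) \<omega>) (normal_density (- \<eta>) (sqrt (2 * \<eta>)))" for i
    using distributed_W_increment[of "int i"] by simp
qed (rule \<eta>_pos)

lemma sum_W_increments: "(\<Sum>l<j. W (int l - k + 1) \<omega> - W (int l - k) \<omega>) = W (int j - k) \<omega> - W (- k) \<omega>"
  by (induction j) (auto simp: algebra_simps)

text \<open>\<open>W 0\<close> vanishes only almost surely, hence it is kept in the identities that
  hold for every path.\<close>

lemma walk_V: "walk.V j \<omega> = W (int j) \<omega> - W 0 \<omega>"
  using sum_W_increments[where k=0] by (simp add: walk.V_def)

lemma normal_density_tilt: "normal_density \<eta> (sqrt (2 * \<eta>)) x = normal_density (- \<eta>) (sqrt (2 * \<eta>)) x * exp x"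
proof -
  have "- (x - \<eta>)\<^sup>2 / (4 * \<eta>) = - (x + \<eta>)\<^sup>2 / (4 * \<eta>) + x"
    using \<eta>_pos by (simp add: field_simps power2_eq_square)
  then have "exp (- (x - \<eta>)\<^sup>2 / (4 * \<eta>)) = exp (- (x + \<eta>)\<^sup>2 / (4 * \<eta>)) * exp x"
    by (simp only: exp_add)
  then show ?thesis using \<eta>_pos by (simp add: normal_density_def)
qed

text \<open>Cameron--Martin: weighting by \<open>exp (W k - W 0)\<close> reverses the drift of the first \<open>k\<close> steps,
  which turns the window starting at \<open>0\<close> into the window starting at \<open>- k\<close>.\<close>

lemma tilt:
  assumes F: "F \<in> borel_measurable (PiM {..<n} (\<lambda>_. borel))" and k: "k \<le> n"
  shows "(\<integral>\<^sup>+\<omega>. ennreal (exp (W (int k) \<omega> - W 0 \<omega>)) * F (\<lambda>i\<in>{..<n}. W (int i + 1) \<omega> - W (int i) \<omega>) \<partial>N)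
    = (\<integral>\<^sup>+\<omega>. F (\<lambda>i\<in>{..<n}. W (int i - int k + 1) \<omega> - W (int i - int k) \<omega>) \<partial>N)"
proof -
  define f where "f i x = (if i < k then ennreal (exp x) else 1)" for i :: nat and x
  define D where "D i x = ennreal (normal_density (if int i - int k < 0 then \<eta> else - \<eta>) (sqrt (2 * \<eta>)) x)" for i :: nat and x
  have f[measurable]: "f i \<in> borel_measurable borel" for i
    by (cases "i < k") (simp_all add: f_def[abs_def])
  have [measurable]: "D i \<in> borel_measurable borel" for i by (simp add: D_def[abs_def])
  have D: "density lborel (D i) = density (step_law \<eta>) (f i)" for i
    unfolding step_law_def
    by (subst density_density_eq)
       (auto intro!: density_cong simp: D_def f_def normal_density_tilt ennreal_mult'')
  have prodF: "(\<lambda>z. \<Prod>i<n. f i (z i)) \<in> borel_measurable (PiM {..<n} (\<lambda>_. borel))"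
  proof (rule borel_measurable_prod_ennreal)
    fix i assume "i \<in> {..<n}"
    then show "(\<lambda>z. f i (z i)) \<in> borel_measurable (PiM {..<n} (\<lambda>_. borel))"
      by (intro measurable_compose[OF measurable_component_singleton[of i "{..<n}" "\<lambda>_. borel"] f[of i]])
  qed
  have step_prob: "prob_space (step_law \<eta>)"
    unfolding step_law_def using \<eta>_pos by (intro prob_space_normal_density) simp
  have D_prob: "prob_space (density lborel (D i))" for i
    unfolding D_def using \<eta>_pos by (intro prob_space_normal_density) simp
  have distr: "distr N (PiM {..<n} (\<lambda>_. borel)) (\<lambda>\<omega>. \<lambda>i\<in>{..<n}. W (int i - int k + 1) \<omega> - W (int i - int k) \<omega>)
      = density (walk_law \<eta> n) (\<lambda>z. \<Prod>i<n. f i (z i))"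
  proof -
    have "distr N (PiM {..<n} (\<lambda>_. borel)) (\<lambda>\<omega>. \<lambda>i\<in>{..<n}. W (int i - int k + 1) \<omega> - W (int i - int k) \<omega>)
        = PiM {..<n} (\<lambda>i. density lborel (D i))"
      unfolding D_def by (intro distr_indep_vars_density indep_W_increments distributed_W_increment)
    also have "\<dots> = PiM {..<n} (\<lambda>i. density (step_law \<eta>) (f i))"
      by (simp add: D)
    also have "\<dots> = density (walk_law \<eta> n) (\<lambda>z. \<Prod>i<n. f i (z i))"
      unfolding walk_law_def
    proof (rule PiM_density)
      show "product_sigma_finite (\<lambda>i::nat. step_law \<eta>)"
        using step_prob by (simp add: product_sigma_finite_def prob_space_imp_sigma_finite)
      show "product_sigma_finite (\<lambda>i::nat. density (step_law \<eta>) (f i))"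
        using D_prob by (simp add: product_sigma_finite_def prob_space_imp_sigma_finite flip: D)
    qed simp_all
    finally show ?thesis .
  qed
  have meas: "(\<lambda>\<omega>. \<lambda>i\<in>{..<n}. W (int i - int m + 1) \<omega> - W (int i - int m) \<omega>) \<in> measurable N (PiM {..<n} (\<lambda>_. borel))" for m
    by (rule measurable_restrict) measurable
  have "(\<integral>\<^sup>+\<omega>. F (\<lambda>i\<in>{..<n}. W (int i - int k + 1) \<omega> - W (int i - int k) \<omega>) \<partial>N)
      = (\<integral>\<^sup>+z. F z \<partial>density (walk_law \<eta> n) (\<lambda>z. \<Prod>i<n. f i (z i)))"
    unfolding distr[symmetric] using F meas by (subst nn_integral_distr) auto
  also have "\<dots> = (\<integral>\<^sup>+z. (\<Prod>i<n. f i (z i)) * F z \<partial>walk_law \<eta> n)"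
    using F prodF by (intro nn_integral_density) (simp_all cong: measurable_cong_sets add: measurable_cong_sets[OF sets_walk_law refl])
  also have "\<dots> = (\<integral>\<^sup>+\<omega>. (\<Prod>i<n. f i (W (int i + 1) \<omega> - W (int i) \<omega>)) * F (\<lambda>i\<in>{..<n}. W (int i + 1) \<omega> - W (int i) \<omega>) \<partial>N)"
    unfolding walk.distr_steps[of n 0, symmetric]
    using F prodF meas[of 0] by (subst nn_integral_distr) auto
  also have "\<dots> = (\<integral>\<^sup>+\<omega>. ennreal (exp (W (int k) \<omega> - W 0 \<omega>)) * F (\<lambda>i\<in>{..<n}. W (int i + 1) \<omega> - W (int i) \<omega>) \<partial>N)"
  proof -
    have "(\<Prod>i<n. f i (W (int i + 1) \<omega> - W (int i) \<omega>)) = ennreal (exp (W (int k) \<omega> - W 0 \<omega>))" for \<omega>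
    proof -
      have "(\<Prod>i<n. f i (W (int i + 1) \<omega> - W (int i) \<omega>)) = (\<Prod>i<k. ennreal (exp (W (int i + 1) \<omega> - W (int i) \<omega>)))"
        using k by (intro prod.mono_neutral_cong_right) (auto simp: f_def)
      also have "\<dots> = ennreal (exp (\<Sum>i<k. W (int i + 1) \<omega> - W (int i) \<omega>))"
        by (simp add: prod_ennreal exp_sum)
      finally show ?thesis using sum_W_increments[where k=0] by simp
    qed
    then show ?thesis by simp
  qed
  finally show ?thesis by simp
qed

text \<open>After time 0 is peeled off, the exponential of the first step is factored out of the
  maximum over \<open>1..Suc n\<close>. The tilt with \<open>k = 1\<close> absorbs this factor and
  shifts the window by one, which leaves the maximum over \<open>0..n\<close>.\<close>

lemma mean_max_Suc:
  "walk.mean_max (Suc n) = walk.mean_max n + ennreal (\<integral>y. stay_prob \<eta> (Suc n) y \<partial>exp_law)"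
proof -
  define F where "F z = ennreal (MAX j\<in>{1..Suc n}. exp ((\<Sum>l<j. z l) - z 0))" for z :: "nat \<Rightarrow> real"
  have F: "F \<in> borel_measurable (PiM {..<Suc n} (\<lambda>_. borel))"
    unfolding F_def
    by (intro measurable_compose[OF _ measurable_ennreal] borel_measurable_Max borel_measurable_exp borel_measurable_diff
        measurable_compose[OF _ borel_measurable_exp] measurable_partial_sum measurable_component_singleton) auto
  have "(\<integral>\<^sup>+\<omega>. ennreal (MAX j\<in>{1..Suc n}. exp (walk.V j \<omega>)) \<partial>N)
      = (\<integral>\<^sup>+\<omega>. ennreal (exp (W (int 1) \<omega> - W 0 \<omega>)) * F (\<lambda>i\<in>{..<Suc n}. W (int i + 1) \<omega> - W (int i) \<omega>) \<partial>N)"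
  proof (rule nn_integral_cong)
    fix \<omega>
    have "exp (W 1 \<omega> - W 0 \<omega>) * (MAX j\<in>{1..Suc n}. exp (W (int j) \<omega> - W 0 \<omega> - (W 1 \<omega> - W 0 \<omega>)))
        = (MAX j\<in>{1..Suc n}. exp (W (int j) \<omega> - W 0 \<omega>))"
      by (subst Max_mult_left) (auto simp flip: exp_add)
    moreover have "F (\<lambda>i\<in>{..<Suc n}. W (int i + 1) \<omega> - W (int i) \<omega>)
        = ennreal (MAX j\<in>{1..Suc n}. exp (W (int j) \<omega> - W 0 \<omega> - (W 1 \<omega> - W 0 \<omega>)))"
    proof -
      have "(\<Sum>l<j. (\<lambda>i\<in>{..<Suc n}. W (int i + 1) \<omega> - W (int i) \<omega>) l) = W (int j) \<omega> - W 0 \<omega>" if "j \<in> {1..Suc n}" for j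
      proof -
        have "(\<Sum>l<j. (\<lambda>i\<in>{..<Suc n}. W (int i + 1) \<omega> - W (int i) \<omega>) l) = (\<Sum>l<j. W (int l + 1) \<omega> - W (int l) \<omega>)"
          using that by (intro sum.cong) auto
        then show ?thesis using sum_W_increments[where k=0] by simp
      qed
      then have "(\<lambda>j. exp ((\<Sum>l<j. (\<lambda>i\<in>{..<Suc n}. W (int i + 1) \<omega> - W (int i) \<omega>) l) - (\<lambda>i\<in>{..<Suc n}. W (int i + 1) \<omega> - W (int i) \<omega>) 0)) ` {1..Suc n}
        = (\<lambda>j. exp (W (int j) \<omega> - W 0 \<omega> - (W 1 \<omega> - W 0 \<omega>))) ` {1..Suc n}"
        by (intro image_cong) auto
      then show ?thesis unfolding F_def by (rule arg_cong)
    qed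
    ultimately show "ennreal (MAX j\<in>{1..Suc n}. exp (walk.V j \<omega>))
        = ennreal (exp (W (int 1) \<omega> - W 0 \<omega>)) * F (\<lambda>i\<in>{..<Suc n}. W (int i + 1) \<omega> - W (int i) \<omega>)"
      by (simp add: walk_V flip: ennreal_mult')
  qed
  also have "\<dots> = (\<integral>\<^sup>+\<omega>. F (\<lambda>i\<in>{..<Suc n}. W (int i - int 1 + 1) \<omega> - W (int i - int 1) \<omega>) \<partial>N)"
    by (rule tilt[OF F]) simp
  also have "\<dots> = walk.mean_max n"
    unfolding walk.mean_max_def
  proof (rule nn_integral_cong)
    fix \<omega>
    have sum: "(\<Sum>l<j. (\<lambda>i\<in>{..<Suc n}. W (int i - int 1 + 1) \<omega> - W (int i - int 1) \<omega>) l) = W (int j - 1) \<omega> - W (- 1) \<omega>"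
      if "j \<in> {1..Suc n}" for j
    proof -
      have "(\<Sum>l<j. (\<lambda>i\<in>{..<Suc n}. W (int i - int 1 + 1) \<omega> - W (int i - int 1) \<omega>) l) = (\<Sum>l<j. W (int l - 1 + 1) \<omega> - W (int l - 1) \<omega>)"
        using that by (intro sum.cong) auto
      then show ?thesis using sum_W_increments[where k=1] by simp
    qed
    have "(\<lambda>j. exp ((\<Sum>l<j. (\<lambda>i\<in>{..<Suc n}. W (int i - int 1 + 1) \<omega> - W (int i - int 1) \<omega>) l) - (\<lambda>i\<in>{..<Suc n}. W (int i - int 1 + 1) \<omega> - W (int i - int 1) \<omega>) 0)) ` {1..Suc n}
        = (\<lambda>j. exp (W (int j - 1) \<omega> - W 0 \<omega>)) ` {1..Suc n}"
      by (intro image_cong refl) (subst sum, auto)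
    also have "\<dots> = (\<lambda>j. exp (W (int j) \<omega> - W 0 \<omega>)) ` {0..n}"
    proof -
      have "(\<lambda>j. exp (W (int j - 1) \<omega> - W 0 \<omega>)) ` Suc ` {0..n} = (\<lambda>j. exp (W (int j) \<omega> - W 0 \<omega>)) ` {0..n}"
        by (simp only: image_image) simp
      moreover have "Suc ` {0..n} = {1..Suc n}" by (simp add: image_Suc_atLeastAtMost)
      ultimately show ?thesis by simp
    qed
    finally show "F (\<lambda>i\<in>{..<Suc n}. W (int i - int 1 + 1) \<omega> - W (int i - int 1) \<omega>) = ennreal (MAX j\<in>{0..n}. exp (walk.V j \<omega>))"
      unfolding F_def walk_V by (rule arg_cong)
  qed
  finally show ?thesis
    by (subst walk.mean_max_decompose) auto
qed

lemma mean_max_eq_stay_sum: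
  "walk.mean_max n = ennreal (\<Sum>i\<le>n. \<integral>y. stay_prob \<eta> i y \<partial>exp_law)"
proof (induction n)
  case 0
  show ?case by (simp add: walk.mean_max_0)
next
  case (Suc n)
  have "0 \<le> (\<integral>y. stay_prob \<eta> i y \<partial>exp_law)" for i
    by (intro integral_nonneg_AE) (simp add: walk.stay_prob_nonneg)
  then show ?case
    by (simp add: mean_max_Suc Suc.IH sum_nonneg flip: ennreal_plus)
qed

definition window_mean :: "nat \<Rightarrow> nat \<Rightarrow> real" where
  "window_mean a b = (\<integral>\<omega>. max_ratio {- int a..int b} (\<lambda>j. exp (W j \<omega>)) \<partial>N)"

lemma measurable_max_ratio [measurable]:
  assumes "a \<le> b"
  shows "(\<lambda>\<omega>. max_ratio {a..b} (\<lambda>j. exp (W j \<omega>))) \<in> borel_measurable N"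
  unfolding max_ratio_def using assms by (intro borel_measurable_divide borel_measurable_Max) auto

lemma window_bounds:
  "0 \<le> max_ratio {- int a..int b} (\<lambda>j. exp (W j \<omega>))" "max_ratio {- int a..int b} (\<lambda>j. exp (W j \<omega>)) \<le> 1"
  by (rule max_ratio_bounds; simp)+

lemma nn_integral_window:
  "(\<integral>\<^sup>+\<omega>. ennreal (max_ratio {- int a..int b} (\<lambda>j. exp (W j \<omega>))) \<partial>N) = ennreal (window_mean a b)"
  unfolding window_mean_def
  by (intro nn_integral_eq_integral integrable_const_bound[where B=1]) (auto simp: window_bounds)

lemma window_mean_bounds: "0 \<le> window_mean a b" "window_mean a b \<le> 1"
proof -
  show "0 \<le> window_mean a b"
    unfolding window_mean_def by (intro integral_nonneg_AE) (simp add: window_bounds)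
  have "ennreal (window_mean a b) \<le> (\<integral>\<^sup>+\<omega>. 1 \<partial>N)"
    unfolding nn_integral_window[symmetric] by (intro nn_integral_mono) (simp add: window_bounds)
  then show "window_mean a b \<le> 1"
    by (simp add: emeasure_space_1)
qed

text \<open>The maximum is the sum of the weights \<open>exp (walk.V k)\<close> times the ratio.
  Tilting by the \<open>k\<close>-th weight moves the window from \<open>0..n\<close> to
  \<open>- k..n - k\<close>, and scale invariance of the ratio removes the reference value
  \<open>W (- k)\<close>.\<close>

lemma mean_max_eq_window_sum: "walk.mean_max n = ennreal (\<Sum>k\<le>n. window_mean k (n - k))"
proof -
  define F where "F z = ennreal (max_ratio {0..n} (\<lambda>j. exp (\<Sum>l<j. z l)))" for z :: "nat \<Rightarrow> real"
  have F: "F \<in> borel_measurable (PiM {..<n} (\<lambda>_. borel))"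
    unfolding F_def max_ratio_def
    by (intro measurable_compose[OF _ measurable_ennreal] borel_measurable_divide borel_measurable_Max borel_measurable_sum
        measurable_compose[OF _ borel_measurable_exp] measurable_partial_sum) auto
  have sum: "(\<Sum>l<j. (\<lambda>i\<in>{..<n}. W (int i - int k + 1) \<omega> - W (int i - int k) \<omega>) l) = W (int j - int k) \<omega> - W (- int k) \<omega>"
    if "j \<in> {0..n}" for j k \<omega>
  proof -
    have "(\<Sum>l<j. (\<lambda>i\<in>{..<n}. W (int i - int k + 1) \<omega> - W (int i - int k) \<omega>) l) = (\<Sum>l<j. W (int l - int k + 1) \<omega> - W (int l - int k) \<omega>)"
      using that by (intro sum.cong) auto
    then show ?thesis using sum_W_increments by simp
  qed
  have F_shift: "F (\<lambda>i\<in>{..<n}. W (int i - int k + 1) \<omega> - W (int i - int k) \<omega>)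
      = ennreal (max_ratio {0..n} (\<lambda>j. exp (W (int j - int k) \<omega> - W (- int k) \<omega>)))" for k \<omega>
  proof -
    let ?z = "\<lambda>i\<in>{..<n}. W (int i - int k + 1) \<omega> - W (int i - int k) \<omega>"
    have "(\<lambda>j. exp (\<Sum>l<j. ?z l)) ` {0..n} = (\<lambda>j. exp (W (int j - int k) \<omega> - W (- int k) \<omega>)) ` {0..n}"
      using sum by (intro image_cong) auto
    moreover have "(\<Sum>j=0..n. exp (\<Sum>l<j. ?z l)) = (\<Sum>j=0..n. exp (W (int j - int k) \<omega> - W (- int k) \<omega>))"
      using sum by (intro sum.cong) auto
    ultimately show ?thesis unfolding F_def max_ratio_def by (simp only:)
  qed
  have F0: "F (\<lambda>i\<in>{..<n}. W (int i + 1) \<omega> - W (int i) \<omega>) = ennreal (max_ratio {0..n} (\<lambda>j. exp (walk.V j \<omega>)))" for \<omega>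
    using F_shift[of 0] by (simp add: walk_V)
  have "walk.mean_max n = (\<integral>\<^sup>+\<omega>. (\<Sum>k\<le>n. ennreal (exp (W (int k) \<omega> - W 0 \<omega>)) * F (\<lambda>i\<in>{..<n}. W (int i + 1) \<omega> - W (int i) \<omega>)) \<partial>N)"
    unfolding walk.mean_max_def
  proof (rule nn_integral_cong)
    fix \<omega>
    have pos: "(\<Sum>k=0..n. exp (walk.V k \<omega>)) > 0" by (intro sum_pos) auto
    have nonneg: "0 \<le> max_ratio {0..n} (\<lambda>j. exp (walk.V j \<omega>))" by (intro max_ratio_bounds) auto
    have "(MAX j\<in>{0..n}. exp (walk.V j \<omega>)) = (\<Sum>k=0..n. exp (walk.V k \<omega>)) * max_ratio {0..n} (\<lambda>j. exp (walk.V j \<omega>))"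
      using pos by (simp add: max_ratio_def)
    also have "\<dots> = (\<Sum>k\<le>n. exp (walk.V k \<omega>) * max_ratio {0..n} (\<lambda>j. exp (walk.V j \<omega>)))"
      by (simp add: sum_distrib_right atLeast0AtMost)
    finally show "ennreal (MAX j\<in>{0..n}. exp (walk.V j \<omega>))
        = (\<Sum>k\<le>n. ennreal (exp (W (int k) \<omega> - W 0 \<omega>)) * F (\<lambda>i\<in>{..<n}. W (int i + 1) \<omega> - W (int i) \<omega>))"
      unfolding F0 using nonneg by (simp add: walk_V flip: ennreal_mult' sum_ennreal)
  qed
  also have "\<dots> = (\<Sum>k\<le>n. \<integral>\<^sup>+\<omega>. ennreal (exp (W (int k) \<omega> - W 0 \<omega>)) * F (\<lambda>i\<in>{..<n}. W (int i + 1) \<omega> - W (int i) \<omega>) \<partial>N)"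
    unfolding F0 max_ratio_def by (intro nn_integral_sum) measurable
  also have "\<dots> = (\<Sum>k\<le>n. \<integral>\<^sup>+\<omega>. F (\<lambda>i\<in>{..<n}. W (int i - int k + 1) \<omega> - W (int i - int k) \<omega>) \<partial>N)"
    by (intro sum.cong refl tilt F) simp
  also have "\<dots> = (\<Sum>k\<le>n. ennreal (window_mean k (n - k)))"
  proof (intro sum.cong refl)
    fix k assume k: "k \<in> {..n}"
    have "max_ratio {0..n} (\<lambda>j. exp (W (int j - int k) \<omega> - W (- int k) \<omega>)) = max_ratio {- int k..int (n - k)} (\<lambda>j. exp (W j \<omega>))" for \<omega>
    proof -
      have "max_ratio {0..n} (\<lambda>j. exp (W (int j - int k) \<omega> - W (- int k) \<omega>))
          = max_ratio {0..n} (\<lambda>j. exp (- W (- int k) \<omega>) * exp (W (int j - int k) \<omega>))"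
        by (simp flip: exp_add)
      also have "\<dots> = max_ratio {0..n} (\<lambda>j. exp (W (int j - int k) \<omega>))"
        by (rule max_ratio_scale) auto
      also have "\<dots> = max_ratio {- int k..int (n - k)} (\<lambda>j. exp (W j \<omega>))"
      proof -
        have bij: "bij_betw (\<lambda>j. int j - int k) {0..n} {- int k..int (n - k)}"
          by (rule bij_betwI[where g="\<lambda>j. nat (j + int k)"]) (use k in auto)
        have "(\<lambda>j. exp (W (int j - int k) \<omega>)) ` {0..n} = (\<lambda>j. exp (W j \<omega>)) ` {- int k..int (n - k)}"
          unfolding bij_betw_imp_surj_on[OF bij, symmetric] by (simp only: image_image)
        moreover have "(\<Sum>j=0..n. exp (W (int j - int k) \<omega>)) = (\<Sum>j=- int k..int (n - k). exp (W j \<omega>))"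
          using sum.reindex_bij_betw[OF bij, of "\<lambda>j. exp (W j \<omega>)"] by simp
        ultimately show ?thesis unfolding max_ratio_def by simp
      qed
      finally show ?thesis .
    qed
    then show "(\<integral>\<^sup>+\<omega>. F (\<lambda>i\<in>{..<n}. W (int i - int k + 1) \<omega> - W (int i - int k) \<omega>) \<partial>N) = ennreal (window_mean k (n - k))"
      unfolding F_shift by (simp add: nn_integral_window)
  qed
  also have "\<dots> = ennreal (\<Sum>k\<le>n. window_mean k (n - k))"
    by (simp add: window_mean_bounds)
  finally show ?thesis .
qed

text \<open>The two expansions of \<open>mean_max n\<close> into \<open>n + 1\<close> terms have
  equal sums. After division by \<open>n + 1\<close>, one tends to the limit of the mean stay
  probabilities and the other to the limit of the window means.\<close>

lemma escape_const_eq_limit: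
  assumes "\<And>e. e > 0 \<Longrightarrow> \<exists>K. \<forall>a\<ge>K. \<forall>b\<ge>K. \<bar>window_mean a b - p\<bar> < e"
  shows "escape_const \<eta> = p"
proof -
  define s where "s i = (\<integral>y. stay_prob \<eta> i y \<partial>exp_law)" for i
  have s0: "0 \<le> s i" for i
    unfolding s_def by (intro integral_nonneg_AE) (simp add: walk.stay_prob_nonneg)
  have s1: "s i \<le> 1" for i
  proof -
    have "s i \<le> (\<integral>y. 1 \<partial>exp_law)"
      unfolding s_def
      by (intro integral_mono exp_law.integrable_const_bound[where B=1])
         (auto simp: walk.stay_prob_nonneg walk.stay_prob_le_1)
    then show ?thesis using exp_law.prob_space by simp
  qed
  \<comment> \<open>The stay means have one index; reading them as functions of the second
    coordinate lets the same averaging lemma treat both sums.\<close>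
  have "(\<lambda>n. (\<Sum>k\<le>n. (\<lambda>a b. s b) k (n - k)) / real (Suc n)) \<longlonglongrightarrow> escape_const \<eta>"
  proof (rule antidiagonal_cesaro)
    fix e :: real assume "e > 0"
    then obtain K where "\<forall>b\<ge>K. \<bar>s b - escape_const \<eta>\<bar> < e"
      using LIMSEQ_D[OF walk.stay_prob_integral_tendsto] by (auto simp: s_def)
    then show "\<exists>K. \<forall>a\<ge>K. \<forall>b\<ge>K. \<bar>s b - escape_const \<eta>\<bar> < e" by blast
  qed (use s0 s1 in auto)
  moreover have "(\<Sum>k\<le>n. s (n - k)) = (\<Sum>k\<le>n. window_mean k (n - k))" for n
  proof -
    have "(\<Sum>k\<le>n. s (n - k)) = (\<Sum>i\<le>n. s i)"
      by (rule sum.reindex_bij_witness[of _ "\<lambda>i. n - i" "\<lambda>i. n - i"]) auto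
    moreover have "ennreal (\<Sum>i\<le>n. s i) = ennreal (\<Sum>k\<le>n. window_mean k (n - k))"
      using mean_max_eq_stay_sum[of n] mean_max_eq_window_sum[of n] by (simp add: s_def)
    ultimately show ?thesis
      using s0 window_mean_bounds by (subst (asm) ennreal_inj) (auto intro!: sum_nonneg)
  qed
  ultimately have "(\<lambda>n. (\<Sum>k\<le>n. window_mean k (n - k)) / real (Suc n)) \<longlonglongrightarrow> escape_const \<eta>" by simp
  moreover have "(\<lambda>n. (\<Sum>k\<le>n. window_mean k (n - k)) / real (Suc n)) \<longlonglongrightarrow> p"
    by (rule antidiagonal_cesaro) (use assms window_mean_bounds in auto)
  ultimately show ?thesis by (rule LIMSEQ_unique)
qed

end

section \<open>From finite windows to all integers\<close>

lemma filterlim_int_windows: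
  assumes "filterlim a at_top sequentially" "filterlim b at_top sequentially"
  shows "filterlim (\<lambda>n. {- int (a n)..int (b n)}) (finite_subsets_at_top UNIV) sequentially"
  unfolding filterlim_finite_subsets_at_top
proof (intro allI impI)
  fix X :: "int set" assume "finite X \<and> X \<subseteq> UNIV"
  then have fin: "finite X" by simp
  define K where "K = (\<Sum>x\<in>X. \<bar>x\<bar>)"
  have K: "\<bar>x\<bar> \<le> K" if "x \<in> X" for x
    unfolding K_def using fin that by (intro member_le_sum) auto
  have "eventually (\<lambda>n. nat K \<le> a n) sequentially" "eventually (\<lambda>n. nat K \<le> b n) sequentially"
    using assms by (auto simp: filterlim_at_top)
  then show "\<forall>\<^sub>F n in sequentially. finite {- int (a n)..int (b n)} \<and> X \<subseteq> {- int (a n)..int (b n)} \<and> {- int (a n)..int (b n)} \<subseteq> UNIV"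
    by eventually_elim (use K in \<open>force simp: abs_le_iff\<close>)
qed

lemma summable_on_bdd_above:
  fixes w :: "'i \<Rightarrow> real"
  assumes "w summable_on UNIV" "\<And>j. w j \<ge> 0"
  shows "w j \<le> infsum w UNIV" "bdd_above (range w)"
proof -
  show le: "w j \<le> infsum w UNIV" for j
    using finite_sum_le_infsum[OF assms(1), of "{j}"] assms(2) by simp
  then show "bdd_above (range w)" by (auto simp: bdd_above_def)
qed

text \<open>The windows eventually contain every finite set, so the sums converge by the definition
  of unordered summation, and the maxima because an index with value close to the supremum is
  eventually included.\<close>

lemma max_ratio_tendsto:
  fixes w :: "int \<Rightarrow> real"
  assumes w: "\<And>j. w j > 0" and S: "w summable_on UNIV"
    and a: "filterlim a at_top sequentially" and b: "filterlim b at_top sequentially"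
  shows "(\<lambda>n. max_ratio {- int (a n)..int (b n)} w) \<longlonglongrightarrow> (SUP j. w j) / infsum w UNIV"
  unfolding max_ratio_def
proof (rule tendsto_divide)
  show "(\<lambda>n. \<Sum>j=- int (a n)..int (b n). w j) \<longlonglongrightarrow> infsum w UNIV"
    using has_sum_infsum[OF S] filterlim_int_windows[OF a b]
    unfolding has_sum_def by (rule filterlim_compose)
  have bdd: "bdd_above (range w)" using summable_on_bdd_above[OF S] w by (simp add: less_imp_le)
  show "(\<lambda>n. MAX j\<in>{- int (a n)..int (b n)}. w j) \<longlonglongrightarrow> (SUP j. w j)"
  proof (rule order_tendstoI)
    fix y assume "y < (SUP j. w j)"
    then have "\<exists>i\<in>UNIV. y < w i"
      by (rule less_cSUP_iff[THEN iffD1, OF UNIV_not_empty bdd])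
    then obtain i where i: "y < w i" by blast
    have "eventually (\<lambda>n. finite {- int (a n)..int (b n)} \<and> {i} \<subseteq> {- int (a n)..int (b n)} \<and> {- int (a n)..int (b n)} \<subseteq> UNIV) sequentially"
      by (rule filterlim_finite_subsets_at_top[THEN iffD1, rule_format, OF filterlim_int_windows[OF a b]]) simp
    then show "\<forall>\<^sub>F n in sequentially. y < (MAX j\<in>{- int (a n)..int (b n)}. w j)"
    proof eventually_elim
      case (elim n)
      then have "w i \<le> (MAX j\<in>{- int (a n)..int (b n)}. w j)" by (intro Max_ge) auto
      with i show ?case by simp
    qed
  next
    fix y assume y: "(SUP j. w j) < y"
    show "\<forall>\<^sub>F n in sequentially. (MAX j\<in>{- int (a n)..int (b n)}. w j) < y"
    proof (intro always_eventually allI)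
      fix n
      have "(MAX j\<in>{- int (a n)..int (b n)}. w j) \<in> w ` {- int (a n)..int (b n)}"
        by (intro Max_in) auto
      then obtain j where j: "(MAX j\<in>{- int (a n)..int (b n)}. w j) = w j" by blast
      have "w j \<le> (SUP j. w j)" using bdd by (intro cSUP_upper) auto
      then show "(MAX j\<in>{- int (a n)..int (b n)}. w j) < y" unfolding j using y by (rule le_less_trans)
    qed
  qed
  have "0 < w 0" using w by simp
  also have "w 0 \<le> infsum w UNIV" using summable_on_bdd_above[OF S] w by (simp add: less_imp_le)
  finally show "infsum w UNIV \<noteq> 0" by simp
qed

text \<open>The right-hand side is built from countable suprema, which gives measurability. Without
  summability the denominator is 0 on the left by the default of \<open>infsum\<close>, and on the
  right because \<open>enn2real\<close> sends the infinite value to 0, so both quotients are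
  0.\<close>

lemma sup_over_sum_eq_ennreal:
  fixes w :: "int \<Rightarrow> real"
  assumes w: "\<And>j. w j > 0"
  shows "(SUP j. w j) / infsum w UNIV
    = enn2real (SUP j. ennreal (w j)) / enn2real (SUP n. ennreal (\<Sum>j=- int n..int n. w j))"
proof (cases "w summable_on UNIV")
  case True
  have id: "filterlim (\<lambda>n::nat. n) at_top sequentially" by (rule filterlim_ident)
  have "(\<lambda>n. \<Sum>j=- int n..int n. w j) \<longlonglongrightarrow> infsum w UNIV"
    using has_sum_infsum[OF True] filterlim_int_windows[OF id id]
    unfolding has_sum_def by (rule filterlim_compose)
  then have "(\<lambda>n. ennreal (\<Sum>j=- int n..int n. w j)) \<longlonglongrightarrow> ennreal (infsum w UNIV)"
    by (rule tendsto_ennrealI)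
  moreover have "incseq (\<lambda>n. ennreal (\<Sum>j=- int n..int n. w j))"
    using w by (intro incseq_SucI ennreal_leI sum_mono2) (auto intro: less_imp_le)
  ultimately have sum: "(SUP n. ennreal (\<Sum>j=- int n..int n. w j)) = ennreal (infsum w UNIV)"
    using LIMSEQ_SUP LIMSEQ_unique by blast
  have le: "w j \<le> infsum w UNIV" for j
    using summable_on_bdd_above[OF True] w by (simp add: less_imp_le)
  have nn: "0 \<le> (SUP j. w j)"
    using w[of 0] cSUP_upper[OF UNIV_I summable_on_bdd_above(2)[OF True], of 0] w by (smt (verit))
  have "(SUP j. ennreal (w j)) \<le> ennreal (infsum w UNIV)"
    by (rule SUP_least) (simp add: le ennreal_leI)
  then have "(SUP j. ennreal (w j)) \<noteq> top" by (metis ennreal_less_top leD top.not_eq_extremum)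
  then have "ennreal (SUP j. w j) = (SUP j. ennreal (w j))"
    using w by (intro ennreal_SUP) (auto intro: less_imp_le)
  moreover have "0 \<le> infsum w UNIV" using le[of 0] w[of 0] by linarith
  ultimately show ?thesis unfolding sum using nn by (metis enn2real_ennreal)
next
  case False
  have "(SUP n. ennreal (\<Sum>j=- int n..int n. w j)) = top"
  proof (rule ccontr)
    assume "(SUP n. ennreal (\<Sum>j=- int n..int n. w j)) \<noteq> top"
    then obtain r where r: "r \<ge> 0" "(SUP n. ennreal (\<Sum>j=- int n..int n. w j)) = ennreal r"
      by (cases "SUP n. ennreal (\<Sum>j=- int n..int n. w j)") auto
    have bound: "(\<Sum>j=- int n..int n. w j) \<le> r" for n
    proof -
      have "ennreal (\<Sum>j=- int n..int n. w j) \<le> ennreal r"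
        unfolding r(2)[symmetric] by (rule SUP_upper) simp
      then show ?thesis using r(1) by (simp add: ennreal_le_iff)
    qed
    have "w summable_on UNIV"
    proof (rule nonneg_bdd_above_summable_on)
      show "bdd_above (sum w ` {F. F \<subseteq> UNIV \<and> finite F})"
      proof (rule bdd_aboveI2)
        fix F :: "int set" assume "F \<in> {F. F \<subseteq> UNIV \<and> finite F}"
        then have "finite F" by simp
        moreover have "filterlim (\<lambda>n. {- int n..int n}) (finite_subsets_at_top UNIV) sequentially"
          by (rule filterlim_int_windows) (rule filterlim_ident)+
        ultimately have "eventually (\<lambda>n. finite {- int n..int n} \<and> F \<subseteq> {- int n..int n} \<and> {- int n..int n} \<subseteq> UNIV) sequentially"
          by (intro filterlim_finite_subsets_at_top[THEN iffD1, rule_format]) simp_all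
        then obtain n where "F \<subseteq> {- int n..int n}" by (auto simp: eventually_sequentially)
        then have "sum w F \<le> (\<Sum>j=- int n..int n. w j)"
          using w by (intro sum_mono2) (auto intro: less_imp_le)
        then show "sum w F \<le> r" using bound[of n] by simp
      qed
    qed (use w in \<open>auto intro: less_imp_le\<close>)
    with False show False by simp
  qed
  then show ?thesis unfolding infsum_not_exists[OF False] by (simp only:) simp
qed

text \<open>The exponent one half minimises the mean
  \<open>exp (\<theta>\<^sup>2 * m - \<theta> * m)\<close> of \<open>exp (\<theta> * X)\<close>; at
  exponent one this mean is 1 for every \<open>m\<close> and gives no decay.\<close>

lemma (in prob_space) nn_integral_exp_half_normal:
  assumes X: "distributed M lborel X (normal_density (- m) (sqrt (2 * m)))" and m: "m > 0"
  shows "(\<integral>\<^sup>+\<omega>. ennreal (exp (X \<omega> / 2)) \<partial>M) = ennreal (exp (- m / 4))"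
proof -
  have eq: "normal_density (- m) (sqrt (2 * m)) x * exp (x / 2) = exp (- m / 4) * normal_density 0 (sqrt (2 * m)) x" for x
  proof -
    have "- (x + m)\<^sup>2 / (4 * m) + x / 2 = - m / 4 + - x\<^sup>2 / (4 * m)"
      using m by (simp add: field_simps power2_eq_square)
    then have "exp (- (x + m)\<^sup>2 / (4 * m)) * exp (x / 2) = exp (- m / 4) * exp (- x\<^sup>2 / (4 * m))"
      by (simp only: exp_add[symmetric])
    then show ?thesis using m by (simp add: normal_density_def)
  qed
  have "(\<integral>\<^sup>+\<omega>. ennreal (exp (X \<omega> / 2)) \<partial>M)
      = (\<integral>\<^sup>+x. ennreal (normal_density (- m) (sqrt (2 * m)) x) * ennreal (exp (x / 2)) \<partial>lborel)"
    by (rule distributed_nn_integral[OF X, symmetric]) simp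
  also have "\<dots> = (\<integral>\<^sup>+x. ennreal (exp (- m / 4)) * ennreal (normal_density 0 (sqrt (2 * m)) x) \<partial>lborel)"
    by (simp add: eq flip: ennreal_mult)
  also have "\<dots> = ennreal (exp (- m / 4)) * (\<integral>\<^sup>+x. ennreal (normal_density 0 (sqrt (2 * m)) x) \<partial>lborel)"
    by (rule nn_integral_cmult) simp
  also have "(\<integral>\<^sup>+x. ennreal (normal_density 0 (sqrt (2 * m)) x) \<partial>lborel) = 1"
    using m by (subst nn_integral_eq_integral) auto
  finally show ?thesis by simp
qed

text \<open>The means of \<open>exp (X n / 2)\<close> form a convergent geometric series, so almost
  surely these terms are summable and eventually below 1, after which squaring makes them
  smaller.\<close>

lemma (in prob_space) AE_summable_exp_normal:
  fixes X :: "nat \<Rightarrow> 'a \<Rightarrow> real"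
  assumes X: "\<And>n. n > 0 \<Longrightarrow> distributed M lborel (X n) (normal_density (- (\<eta> * real n)) (sqrt (2 * (\<eta> * real n))))"
    and \<eta>: "\<eta> > 0"
  shows "AE \<omega> in M. summable (\<lambda>n. exp (X n \<omega>))"
proof -
  \<comment> \<open>The law of \<open>X 0\<close> is not prescribed; the shift leaves summability
    unchanged.\<close>
  define Y where "Y n = X (Suc n)" for n
  have [measurable]: "Y n \<in> borel_measurable M" for n
    using distributed_measurable[OF X[of "Suc n"]] by (simp add: Y_def)
  have Y: "(\<integral>\<^sup>+\<omega>. ennreal (exp (Y n \<omega> / 2)) \<partial>M) = ennreal (exp (- (\<eta> / 4)) ^ Suc n)" for n
    unfolding Y_def using \<eta> by (subst nn_integral_exp_half_normal[OF X]) (auto simp: exp_of_nat_mult[symmetric] mult_ac simp del: power_Suc)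
  have "summable (\<lambda>n. exp (- (\<eta> / 4)) ^ Suc n)"
    using \<eta> by (subst summable_Suc_iff) (simp add: summable_geometric)
  then have "(\<Sum>n. ennreal (exp (- (\<eta> / 4)) ^ Suc n)) < top"
    by (subst suminf_ennreal2) auto
  then have "(\<integral>\<^sup>+\<omega>. (\<Sum>n. ennreal (exp (Y n \<omega> / 2))) \<partial>M) \<noteq> \<infinity>"
    by (subst nn_integral_suminf) (auto simp: Y)
  then have "AE \<omega> in M. (\<Sum>n. ennreal (exp (Y n \<omega> / 2))) \<noteq> \<infinity>"
    by (intro nn_integral_PInf_AE) auto
  then show ?thesis
  proof eventually_elim
    case (elim \<omega>)
    then have s: "summable (\<lambda>n. exp (Y n \<omega> / 2))"
      by (intro summable_suminf_not_top) auto
    then have "(\<lambda>n. exp (Y n \<omega> / 2)) \<longlonglongrightarrow> 0" by (rule summable_LIMSEQ_zero)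
    then have "eventually (\<lambda>n. exp (Y n \<omega> / 2) < 1) sequentially"
      by (rule order_tendstoD) simp
    then have "eventually (\<lambda>n. norm (exp (Y n \<omega>)) \<le> exp (Y n \<omega> / 2)) sequentially"
      by eventually_elim simp
    then have "summable (\<lambda>n. exp (Y n \<omega>))"
      using s by (rule summable_comparison_test_ev)
    then show ?case unfolding Y_def by (subst (asm) summable_Suc_iff)
  qed
qed

section \<open>Identification and positivity of the Pickands constant\<close>

context two_sided_grid
begin

text \<open>Seen from time 0, the process has the same one-dimensional laws in both directions, so
  \<open>AE_summable_exp_normal\<close> treats each half-line.\<close>

lemma AE_summable_exp_W: "AE \<omega> in N. (\<lambda>j. exp (W j \<omega>)) summable_on UNIV"
proof -
  have "AE \<omega> in N. summable (\<lambda>n. exp (W (int n) \<omega> - W 0 \<omega>))"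
    using walk.distributed_V \<eta>_pos unfolding walk_V[abs_def] by (intro AE_summable_exp_normal)
  moreover have "AE \<omega> in N. summable (\<lambda>n. exp (W (- int n) \<omega> - W 0 \<omega>))"
  proof (rule AE_summable_exp_normal[OF _ \<eta>_pos])
    fix n :: nat assume n: "n > 0"
    have "distributed N lborel (\<lambda>\<omega>. - (\<eta> * real n) + - sqrt 2 * (B 0 \<omega> - B (- (\<eta> * real n)) \<omega>))
        (normal_density (- (\<eta> * real n)) (\<bar>- sqrt 2\<bar> * sqrt (0 - - (\<eta> * real n))))"
      using n \<eta>_pos by (intro distributed_scaled_increment) auto
    moreover have "\<bar>- sqrt 2\<bar> * sqrt (0 - - (\<eta> * real n)) = sqrt (2 * (\<eta> * real n))"
      by (simp add: real_sqrt_mult)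
    moreover have "- (\<eta> * real n) + - sqrt 2 * (B 0 \<omega> - B (- (\<eta> * real n)) \<omega>) = W (- int n) \<omega> - W 0 \<omega>" for \<omega>
      using \<eta>_pos by (simp add: W_def pickands_process_def abs_mult algebra_simps)
    ultimately show "distributed N lborel (\<lambda>\<omega>. W (- int n) \<omega> - W 0 \<omega>)
        (normal_density (- (\<eta> * real n)) (sqrt (2 * (\<eta> * real n))))" by simp
  qed
  ultimately show ?thesis
  proof eventually_elim
    case (elim \<omega>)
    have exp_eq: "exp (W j \<omega>) = exp (W 0 \<omega>) * exp (W j \<omega> - W 0 \<omega>)" for j
      by (simp flip: exp_add)
    have pos: "(\<lambda>n. exp (W (int n) \<omega>)) summable_on UNIV"
      using elim(1) by (subst summable_on_UNIV_nonneg_real_iff) (auto simp: exp_eq[of "int _"] intro: summable_mult)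
    have neg: "(\<lambda>n. exp (W (- int n) \<omega>)) summable_on UNIV"
      using elim(2) by (subst summable_on_UNIV_nonneg_real_iff) (auto simp: exp_eq[of "- int _"] intro: summable_mult)
    have "(\<lambda>j. exp (W j \<omega>)) summable_on range int"
      using pos by (subst summable_on_reindex) (auto simp: comp_def inj_on_def)
    moreover have "(\<lambda>j. exp (W j \<omega>)) summable_on range (\<lambda>n. - int n)"
      using neg by (subst summable_on_reindex) (auto simp: comp_def inj_on_def)
    moreover have "range int \<union> range (\<lambda>n. - int n) = UNIV"
    proof -
      have "j \<in> range int \<union> range (\<lambda>n. - int n)" for j
        by (cases j) (auto simp del: of_nat_Suc)
      then show ?thesis by auto
    qed
    ultimately show ?case by (metis summable_on_union)
  qed
qed

definition sup_over_sum :: "'a \<Rightarrow> real" where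
  "sup_over_sum \<omega> = (SUP j. exp (W j \<omega>)) / (\<Sum>\<^sub>\<infinity>j. exp (W j \<omega>))"

lemma measurable_sup_over_sum [measurable]: "sup_over_sum \<in> borel_measurable N"
  unfolding sup_over_sum_def by (subst sup_over_sum_eq_ennreal) (auto intro: measurable_compose)

lemma pickands_constant_eq: "\<eta> * pickands_constant N B \<eta> = (\<integral>\<omega>. sup_over_sum \<omega> \<partial>N)"
proof -
  have inj: "inj (\<lambda>k::int. \<eta> * of_int k)" using \<eta>_pos by (auto simp: inj_on_def)
  have "(\<Sum>\<^sub>\<infinity>t\<in>int_grid \<eta>. exp (pickands_process B t \<omega>)) = (\<Sum>\<^sub>\<infinity>j. exp (W j \<omega>))" for \<omega>
    unfolding int_grid_def by (subst infsum_reindex[OF inj]) (simp add: comp_def W_def)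
  moreover have "(SUP t\<in>int_grid \<eta>. exp (pickands_process B t \<omega>)) = (SUP j. exp (W j \<omega>))" for \<omega>
    unfolding int_grid_def by (simp add: image_image W_def)
  ultimately show ?thesis
    using \<eta>_pos by (simp add: pickands_constant_def sup_over_sum_def)
qed

lemma window_mean_tendsto:
  assumes "filterlim a at_top sequentially" "filterlim b at_top sequentially"
  shows "(\<lambda>n. window_mean (a n) (b n)) \<longlonglongrightarrow> (\<integral>\<omega>. sup_over_sum \<omega> \<partial>N)"
  unfolding window_mean_def
proof (rule integral_dominated_convergence[where w="\<lambda>_. 1"])
  show "AE \<omega> in N. (\<lambda>n. max_ratio {- int (a n)..int (b n)} (\<lambda>j. exp (W j \<omega>))) \<longlonglongrightarrow> sup_over_sum \<omega>"
    using AE_summable_exp_W by eventually_elim (auto simp: sup_over_sum_def intro!: max_ratio_tendsto assms)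
qed (auto simp: window_bounds)

text \<open>Dominated convergence gives the limit along sequences of windows. If the joint limit in
  both window sizes failed, picking for each \<open>K\<close> a violating window with both sizes at
  least \<open>K\<close> would produce such a sequence.\<close>

lemma escape_const_eq_pickands: "escape_const \<eta> = \<eta> * pickands_constant N B \<eta>"
  unfolding pickands_constant_eq
proof (rule escape_const_eq_limit, rule ccontr)
  fix e :: real assume e: "e > 0"
  let ?p = "\<integral>\<omega>. sup_over_sum \<omega> \<partial>N"
  assume "\<nexists>K. \<forall>a\<ge>K. \<forall>b\<ge>K. \<bar>window_mean a b - ?p\<bar> < e"
  then have "\<forall>K. \<exists>a b. K \<le> a \<and> K \<le> b \<and> e \<le> \<bar>window_mean a b - ?p\<bar>"
    by (meson not_le)
  then obtain a b where ab: "\<And>K. K \<le> a K" "\<And>K. K \<le> b K" "\<And>K. e \<le> \<bar>window_mean (a K) (b K) - ?p\<bar>"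
    by metis
  have "filterlim a at_top sequentially" "filterlim b at_top sequentially"
    using ab by (auto intro!: filterlim_at_top_mono[OF filterlim_ident])
  from LIMSEQ_D[OF window_mean_tendsto[OF this] e] obtain n where "\<bar>window_mean (a n) (b n) - ?p\<bar> < e"
    by auto
  with ab(3)[of n] show False by simp
qed

text \<open>Positivity is what allows division by the constant for both conclusions. The integrand
  is almost surely positive, and at most 1 as a limit of ratios.\<close>

lemma pickands_constant_pos: "pickands_constant N B \<eta> > 0"
proof -
  have pos: "AE \<omega> in N. 0 < sup_over_sum \<omega>"
    using AE_summable_exp_W
  proof eventually_elim
    case (elim \<omega>)
    have b: "exp (W 0 \<omega>) \<le> (\<Sum>\<^sub>\<infinity>j. exp (W j \<omega>))" "bdd_above (range (\<lambda>j. exp (W j \<omega>)))"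
      using summable_on_bdd_above[OF elim] by auto
    have "exp (W 0 \<omega>) \<le> (SUP j. exp (W j \<omega>))" by (rule cSUP_upper[OF UNIV_I b(2)])
    moreover have "exp (W 0 \<omega>) > 0" by simp
    ultimately show ?case unfolding sup_over_sum_def using b(1) by (intro divide_pos_pos) linarith+
  qed
  have le1: "AE \<omega> in N. sup_over_sum \<omega> \<le> 1"
    using AE_summable_exp_W
  proof eventually_elim
    case (elim \<omega>)
    have id: "filterlim (\<lambda>n::nat. n) at_top sequentially" by (rule filterlim_ident)
    have "(\<lambda>n. max_ratio {- int n..int n} (\<lambda>j. exp (W j \<omega>))) \<longlonglongrightarrow> sup_over_sum \<omega>"
      unfolding sup_over_sum_def by (rule max_ratio_tendsto[OF _ elim id id]) simp
    then show ?case by (rule LIMSEQ_le_const2) (auto simp: window_bounds)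
  qed
  have int: "integrable N sup_over_sum"
  proof (rule integrable_const_bound[where B=1])
    show "AE \<omega> in N. norm (sup_over_sum \<omega>) \<le> 1" using pos le1 by eventually_elim simp
  qed measurable
  have "(\<integral>\<omega>. sup_over_sum \<omega> \<partial>N) \<noteq> 0"
  proof
    assume "(\<integral>\<omega>. sup_over_sum \<omega> \<partial>N) = 0"
    then have "AE \<omega> in N. sup_over_sum \<omega> = 0"
      using int pos by (subst (asm) integral_nonneg_eq_0_iff_AE) (auto elim: eventually_mono)
    with pos have "AE \<omega> in N. False" by eventually_elim simp
    then show False by simp
  qed
  moreover have "(\<integral>\<omega>. sup_over_sum \<omega> \<partial>N) \<ge> 0"
    using pos by (intro integral_nonneg_AE) (auto elim: eventually_mono)
  ultimately have "\<eta> * pickands_constant N B \<eta> > 0" unfolding pickands_constant_eq by simp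
  then show ?thesis using \<eta>_pos by (simp add: zero_less_mult_iff)
qed

end

subsection \<open>Brownian motion with drift\<close>

lemma Phi_strict_mono: "x < y \<Longrightarrow> Phi x < Phi y"
  by (rule DERIV_pos_imp_increasing)
     (auto intro!: exI[of _ "std_normal_density _"] Phi_has_real_derivative normal_density_pos)

lemma integral_normal_density_atMost:
  assumes "\<sigma> > 0"
  shows "(\<integral>v. indicator {..x} v * normal_density \<mu> \<sigma> v \<partial>lborel) = Phi ((x - \<mu>) / \<sigma>)"
proof -
  have "(\<integral>v. indicator {..x} v * normal_density \<mu> \<sigma> v \<partial>lborel)
      = \<sigma> * (\<integral>v. indicator {..x} (\<mu> + \<sigma> * v) * normal_density \<mu> \<sigma> (\<mu> + \<sigma> * v) \<partial>lborel)"
    using assms by (subst lborel_integral_real_affine[of \<sigma> _ \<mu>]) auto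
  also have "\<dots> = (\<integral>v. \<sigma> * (indicator {..x} (\<mu> + \<sigma> * v) * normal_density \<mu> \<sigma> (\<mu> + \<sigma> * v)) \<partial>lborel)"
    by simp
  also have "\<dots> = (\<integral>v. std_normal_density v * indicator {..(x - \<mu>) / \<sigma>} v \<partial>lborel)"
  proof (rule Bochner_Integration.integral_cong[OF refl])
    fix v
    have "\<sigma> * normal_density \<mu> \<sigma> (\<mu> + \<sigma> * v) = std_normal_density v"
      using assms by (simp add: normal_density_def real_sqrt_mult power_mult_distrib)
    moreover have "indicator {..x} (\<mu> + \<sigma> * v) = (indicator {..(x - \<mu>) / \<sigma>} v :: real)"
      using assms by (simp add: indicator_def field_simps)
    ultimately show "\<sigma> * (indicator {..x} (\<mu> + \<sigma> * v) * normal_density \<mu> \<sigma> (\<mu> + \<sigma> * v))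
        = std_normal_density v * indicator {..(x - \<mu>) / \<sigma>} v"
      by (metis mult.assoc mult.commute)
  qed
  also have "\<dots> = (\<integral>v. indicator {..(x - \<mu>) / \<sigma>} v \<partial>std_normal_distribution)"
    by (subst integral_density) auto
  also have "\<dots> = Phi ((x - \<mu>) / \<sigma>)"
    by (simp add: cdf_def)
  finally show ?thesis .
qed

context gaussian_walk
begin

lemma ever_hit_prob_nonneg: "0 \<le> ever_hit_prob x"
  and ever_hit_prob_le_1: "ever_hit_prob x \<le> 1"
  by (auto simp: ever_hit_prob_def)

lemma measurable_hit_prob [measurable]: "hit_prob i \<in> borel_measurable borel"
proof -
  have "hit_prob i y \<le> hit_prob i x" if "x \<le> y" for x y
    unfolding hit_prob_def
  proof (rule finite_measure_mono)
    show "{\<omega> \<in> space M. \<exists>j\<in>{1..i}. y < V j \<omega>} \<subseteq> {\<omega> \<in> space M. \<exists>j\<in>{1..i}. x < V j \<omega>}"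
      using that by (blast intro: le_less_trans)
  qed measurable
  then have "mono (\<lambda>x. - hit_prob i x)" by (intro monoI) simp
  then have "(\<lambda>x. - (- hit_prob i x)) \<in> borel_measurable borel"
    by (intro borel_measurable_uminus borel_measurable_mono)
  then show ?thesis by simp
qed

lemma measurable_ever_hit_prob [measurable]: "ever_hit_prob \<in> borel_measurable borel"
  by (rule borel_measurable_LIMSEQ_real[OF hit_prob_tendsto]) measurable

lemma stay_prob_eq_hit_prob: "stay_prob \<eta> i y = 1 - hit_prob i (- y)"
proof -
  have "{\<omega> \<in> space M. \<exists>j\<in>{1..i}. V j \<omega> > - y} \<in> events" by measurable
  from prob_neg[OF this] show ?thesis
    by (simp add: stay_prob_eq hit_prob_def not_less)
qed

text \<open>Markov property at step \<open>k\<close>: the constraint before step \<open>k\<close> is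
  dropped, and the rest of the path restarts from \<open>v\<close>. The inequality suffices later,
  where the time of step \<open>k\<close> tends to 0.\<close>

lemma ever_hit_prob_renewal:
  assumes k: "k > 0"
  shows "1 - ever_hit_prob x \<le> (\<integral>v. indicator {..x} v
    * normal_density (- (\<eta> * real k)) (sqrt (2 * (\<eta> * real k))) v * (1 - ever_hit_prob (x - v)) \<partial>lborel)"
proof (rule LIMSEQ_le)
  define p where "p = normal_density (- (\<eta> * real k)) (sqrt (2 * (\<eta> * real k)))"
  have p[measurable]: "p \<in> borel_measurable borel" "integrable lborel p" "p v \<ge> 0" for v
    using \<eta>_pos k by (auto simp: p_def)
  have "(\<lambda>i. 1 - hit_prob (k + i) x) \<longlonglongrightarrow> 1 - ever_hit_prob x"
    using LIMSEQ_ignore_initial_segment[OF hit_prob_tendsto[of x], of k] by (intro tendsto_intros) (simp add: add.commute)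
  then show "(\<lambda>i. 1 - hit_prob (k + i) x) \<longlonglongrightarrow> 1 - ever_hit_prob x" .
  show "(\<lambda>i. \<integral>v. indicator {..x} v * p v * (1 - hit_prob i (x - v)) \<partial>lborel)
      \<longlonglongrightarrow> (\<integral>v. indicator {..x} v * normal_density (- (\<eta> * real k)) (sqrt (2 * (\<eta> * real k))) v * (1 - ever_hit_prob (x - v)) \<partial>lborel)"
    unfolding p_def[symmetric]
  proof (rule integral_dominated_convergence[where w=p])
    show "AE v in lborel. (\<lambda>i. indicator {..x} v * p v * (1 - hit_prob i (x - v))) \<longlonglongrightarrow> indicator {..x} v * p v * (1 - ever_hit_prob (x - v))"
      by (intro AE_I2 tendsto_intros hit_prob_tendsto)
    show "AE v in lborel. norm (indicator {..x} v * p v * (1 - hit_prob i (x - v))) \<le> p v" for i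
    proof (rule AE_I2)
      fix v
      have "0 \<le> hit_prob i (x - v)" "hit_prob i (x - v) \<le> 1" by (auto simp: hit_prob_def)
      then show "norm (indicator {..x} v * p v * (1 - hit_prob i (x - v))) \<le> p v"
        using p(3)[of v] by (simp add: indicator_def abs_mult mult_left_le)
    qed
  qed (use p in measurable)
  have "1 - hit_prob (k + i) x \<le> (\<integral>v. indicator {..x} v * p v * (1 - hit_prob i (x - v)) \<partial>lborel)" for i
  proof -
    have "1 - hit_prob (k + i) x = \<P>(\<omega> in M. \<forall>j\<in>{1..k+i}. V j \<omega> \<le> x)"
      using stay_prob_eq_hit_prob[of "k + i" "- x"] by (simp add: stay_prob_eq)
    also have "\<dots> \<le> \<P>(\<omega> in M. V k \<omega> \<in> {..x} \<and> (\<forall>j\<in>{1..i}. V (k + j) \<omega> \<le> x))"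
      using k by (intro finite_measure_mono) auto
    also have "\<dots> = (\<integral>v. indicator {..x} v * p v * stay_prob \<eta> i (v - x) \<partial>lborel)"
      unfolding p_def by (rule markov_property[OF k]) simp
    finally show ?thesis by (simp add: stay_prob_eq_hit_prob)
  qed
  then show "\<exists>N. \<forall>i\<ge>N. 1 - hit_prob (k + i) x \<le> (\<integral>v. indicator {..x} v * p v * (1 - hit_prob i (x - v)) \<partial>lborel)"
    by blast
qed

lemma escape_const_le_1: "escape_const \<eta> \<le> 1"
proof -
  have "escape_const \<eta> \<le> (\<integral>y. 1 \<partial>exp_law)"
    unfolding escape_const_def using integrable_escape_prob escape_prob_le_1 by (intro integral_mono) auto
  then show ?thesis using exp_law.prob_space by simp
qed

end

section \<open>The risk process as a scaled walk\<close>

locale risk_model = brownian_motion M "{0..}" B for M :: "'a measure" and B +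
  fixes c :: real
  assumes c_pos: "c > 0"
begin

definition step :: "real \<Rightarrow> nat \<Rightarrow> 'a \<Rightarrow> real" where
  "step \<delta> i \<omega> = - ((2 * c)\<^sup>2 * \<delta> / 2) + 2 * c * (B (\<delta> * real (Suc i)) \<omega> - B (\<delta> * real i) \<omega>)"

lemma walk: "\<delta> > 0 \<Longrightarrow> gaussian_walk M (step \<delta>) (2 * c\<^sup>2 * \<delta>)"
proof -
  assume "\<delta> > 0"
  then have "gaussian_walk M (step \<delta>) ((2 * c)\<^sup>2 * \<delta> / 2)"
    unfolding step_def[abs_def] using c_pos by (intro gaussian_walk_increments) auto
  moreover have "(2 * c)\<^sup>2 * \<delta> / 2 = 2 * c\<^sup>2 * \<delta>" by (simp add: power_mult_distrib)
  ultimately show ?thesis by (simp only:)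
qed

abbreviation walk_V :: "real \<Rightarrow> nat \<Rightarrow> 'a \<Rightarrow> real" where
  "walk_V \<delta> \<equiv> gaussian_walk.V (step \<delta>)"

abbreviation walk_hit :: "real \<Rightarrow> nat \<Rightarrow> real \<Rightarrow> real" where
  "walk_hit \<delta> \<equiv> gaussian_walk.hit_prob M (step \<delta>)"

abbreviation walk_ever_hit :: "real \<Rightarrow> real \<Rightarrow> real" where
  "walk_ever_hit \<delta> \<equiv> gaussian_walk.ever_hit_prob M (step \<delta>)"

lemma walk_V_eq:
  assumes "\<delta> > 0"
  shows "walk_V \<delta> k \<omega> = 2 * c * (B (\<delta> * real k) \<omega> - B 0 \<omega> - c * (\<delta> * real k))"
proof -
  interpret gaussian_walk M "step \<delta>" "2 * c\<^sup>2 * \<delta>" by (rule walk[OF assms])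
  have V_Suc: "V (Suc k) \<omega> = V k \<omega> + step \<delta> k \<omega>" for k by (simp add: V_def)
  show ?thesis
    by (induction k) (simp_all only: V_Suc V_0, simp_all add: step_def algebra_simps power2_eq_square)
qed

lemma walk_V_gt_iff:
  assumes "\<delta> > 0" "B 0 \<omega> = 0"
  shows "walk_V \<delta> k \<omega> > 2 * c * u \<longleftrightarrow> B (\<delta> * real k) \<omega> - c * (\<delta> * real k) > u"
  unfolding walk_V_eq[OF assms(1)] using assms c_pos by simp

lemma measurable_B_grid [measurable]: "\<delta> > 0 \<Longrightarrow> B (\<delta> * real k) \<in> borel_measurable M"
  by (rule measurable_B) simp

lemma discrete_ruin_prob_eq_grid:
  "discrete_ruin_prob M B c \<delta> u = \<P>(\<omega> in M. \<exists>k::nat. B (\<delta> * real k) \<omega> - c * (\<delta> * real k) > u)"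
proof -
  have "(INF t\<in>grid \<delta>. ereal (risk_process B c u t \<omega>)) < 0 \<longleftrightarrow> (\<exists>k::nat. B (\<delta> * real k) \<omega> - c * (\<delta> * real k) > u)" for \<omega>
  proof -
    have "risk_process B c u t \<omega> < 0 \<longleftrightarrow> B t \<omega> - c * t > u" for t
      by (auto simp: risk_process_def)
    then show ?thesis unfolding INF_less_iff by (simp add: grid_def)
  qed
  then show ?thesis by (simp add: discrete_ruin_prob_def)
qed

text \<open>Time 0 belongs to the grid but not to \<open>ever_hit_prob\<close>; almost surely the
  path is 0 there, which does not exceed \<open>u > 0\<close>.\<close>

lemma discrete_ruin_prob_eq:
  assumes \<delta>: "\<delta> > 0" and u: "u > 0"
  shows "discrete_ruin_prob M B c \<delta> u = walk_ever_hit \<delta> (2 * c * u)"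
proof -
  interpret gaussian_walk M "step \<delta>" "2 * c\<^sup>2 * \<delta>" by (rule walk[OF \<delta>])
  show ?thesis
    unfolding discrete_ruin_prob_eq_grid ever_hit_prob_def
  proof (rule prob_eq_AE)
    show "AE \<omega> in M. (\<exists>k::nat. B (\<delta> * real k) \<omega> - c * (\<delta> * real k) > u) \<longleftrightarrow> (\<exists>j\<ge>1. V j \<omega> > 2 * c * u)"
      using B_zero
    proof eventually_elim
      case (elim \<omega>)
      show ?case
        unfolding walk_V_gt_iff[OF \<delta> elim]
        using elim u by (metis less_one linorder_not_le mult_zero_right of_nat_0 order_less_imp_not_less diff_zero)
    qed
  qed (use \<delta> in measurable)
qed

section \<open>Ruin in continuous time\<close>

lemma ruin_prob_eq: "ruin_prob M B c u = \<P>(\<omega> in M. \<exists>t\<ge>0. B t \<omega> - c * t > u)"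
proof -
  have "(INF t\<in>{0..}. ereal (risk_process B c u t \<omega>)) < 0 \<longleftrightarrow> (\<exists>t\<ge>0. B t \<omega> - c * t > u)" for \<omega>
  proof -
    have "risk_process B c u t \<omega> < 0 \<longleftrightarrow> B t \<omega> - c * t > u" for t
      by (auto simp: risk_process_def)
    then show ?thesis unfolding INF_less_iff by (auto simp: Bex_def)
  qed
  then show ?thesis by (simp add: ruin_prob_def)
qed

text \<open>Dyadic grids are nested, so the ruin events increase. By continuity, a drifted path that
  exceeds \<open>u\<close> at some time also does so nearby, hence at a sufficiently fine dyadic
  time.\<close>

lemma dyadic_ruin_prob_tendsto: "(\<lambda>n. discrete_ruin_prob M B c (1 / 2 ^ n) u) \<longlonglongrightarrow> ruin_prob M B c u"
proof -
  define E where "E n = {\<omega> \<in> space M. \<exists>k::nat. B (1 / 2 ^ n * real k) \<omega> - c * (1 / 2 ^ n * real k) > u}" for n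
  have "(\<lambda>n. prob (E n)) \<longlonglongrightarrow> prob (\<Union>n. E n)"
  proof (rule finite_Lim_measure_incseq)
    have "E n \<in> events" for n unfolding E_def by measurable
    then show "range E \<subseteq> events" by auto
    show "incseq E"
    proof (rule incseq_SucI, safe)
      fix n \<omega> assume "\<omega> \<in> E n"
      then obtain k :: nat where k: "\<omega> \<in> space M" "B (1 / 2 ^ n * real k) \<omega> - c * (1 / 2 ^ n * real k) > u"
        by (auto simp: E_def)
      moreover have "1 / 2 ^ n * real k = 1 / 2 ^ Suc n * real (2 * k)" by simp
      ultimately show "\<omega> \<in> E (Suc n)" unfolding E_def by (metis (mono_tags, lifting) mem_Collect_eq)
    qed
  qed
  also have "(\<Union>n. E n) = {\<omega> \<in> space M. \<exists>t\<ge>0. B t \<omega> - c * t > u}"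
  proof safe
    fix n \<omega> assume "\<omega> \<in> E n"
    then obtain k :: nat where "\<omega> \<in> space M" "B (1 / 2 ^ n * real k) \<omega> - c * (1 / 2 ^ n * real k) > u"
      by (auto simp: E_def)
    moreover have "0 \<le> 1 / 2 ^ n * real k" by simp
    ultimately show "\<omega> \<in> space M" "\<exists>t\<ge>0. B t \<omega> - c * t > u" by blast+
  next
    fix \<omega> t assume \<omega>: "\<omega> \<in> space M" and t: "(0::real) \<le> t" "B t \<omega> - c * t > u"
    have "continuous_on {0..} (\<lambda>t. B t \<omega> - c * t)"
      by (intro continuous_intros continuous_paths \<omega>)
    then obtain d where d: "d > 0" "\<And>s. s \<ge> 0 \<Longrightarrow> dist s t < d \<Longrightarrow> dist (B s \<omega> - c * s) (B t \<omega> - c * t) < B t \<omega> - c * t - u"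
      unfolding continuous_on_iff using t by (metis atLeast_iff diff_gt_0_iff_gt)
    obtain n where n: "(1/2) ^ n < d" using real_arch_pow_inv[OF d(1), of "1/2"] by auto
    \<comment> \<open>This makes \<open>s\<close> the last grid time up to \<open>t\<close>, so it
      is nonnegative and less than one mesh width away.\<close>
    define k where "k = nat \<lfloor>t * 2 ^ n\<rfloor>"
    define s where "s = 1 / 2 ^ n * real k"
    have "real k \<le> t * 2 ^ n" "t * 2 ^ n < real k + 1"
      using t(1) by (auto simp: k_def)
    then have "s \<le> t" "t < s + 1 / 2 ^ n"
      by (auto simp: s_def field_simps)
    then have "dist s t < d" using n by (auto simp: dist_real_def power_one_over)
    moreover have "s \<ge> 0" by (simp add: s_def)
    ultimately have "B s \<omega> - c * s > u" using d(2)[of s] by (auto simp: dist_real_def)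
    then have "\<omega> \<in> E n" using \<omega> unfolding E_def s_def by blast
    then show "\<omega> \<in> (\<Union>n. E n)" by blast
  qed
  finally show ?thesis
    by (simp add: ruin_prob_eq discrete_ruin_prob_eq_grid E_def)
qed

lemma walk_ever_hit_tendsto:
  assumes "x > 0"
  shows "(\<lambda>n. walk_ever_hit (1 / 2 ^ n) x) \<longlonglongrightarrow> ruin_prob M B c (x / (2 * c))"
  using dyadic_ruin_prob_tendsto[of "x / (2 * c)"] assms c_pos
  by (simp add: discrete_ruin_prob_eq)

text \<open>On each dyadic grid the same \<open>escape_const\<close> approximates the scaled hitting
  probabilities at both levels, by \<open>ever_hit_prob_bound\<close>. Divided by
  \<open>\<eta> n\<close>, the errors are proportional to \<open>escape_const (\<eta> n)\<close>,
  which vanishes with the mesh.\<close>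

lemma exp_ruin_prob_const:
  assumes x: "x > 0" and y: "y > 0"
  shows "exp x * ruin_prob M B c (x / (2 * c)) = exp y * ruin_prob M B c (y / (2 * c))"
proof -
  define \<eta> where "\<eta> n = 2 * c\<^sup>2 * (1 / 2 ^ n)" for n :: nat
  define e where "e n = walk_ever_hit (1 / 2 ^ n)" for n :: nat
  have \<eta>: "\<eta> n > 0" for n using c_pos by (simp add: \<eta>_def)
  have walk_n: "gaussian_walk M (step (1 / 2 ^ n)) (\<eta> n)" for n
    unfolding \<eta>_def by (rule walk) simp
  note bound = gaussian_walk.ever_hit_prob_bound[OF walk_n, folded e_def]
    and G_nonneg = gaussian_walk.escape_const_nonneg[OF walk_n]
    and G_le_1 = gaussian_walk.escape_const_le_1[OF walk_n]
  have \<eta>_lim: "\<eta> \<longlonglongrightarrow> 0"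
    unfolding \<eta>_def by real_asymp
  \<comment> \<open>The bound at \<open>x\<close>, with both the hitting probability and
    \<open>escape_const\<close> at most 1, shows that \<open>escape_const (\<eta> n)\<close> is of
    order \<open>\<eta> n\<close>.\<close>
  have "(\<lambda>n. escape_const (\<eta> n)) \<longlonglongrightarrow> 0"
  proof (rule tendsto_sandwich[OF _ _ tendsto_const])
    show "(\<lambda>n. \<eta> n * (exp x + 2 * mesh_error x)) \<longlonglongrightarrow> 0"
      by (intro tendsto_mult_left_zero \<eta>_lim)
    show "\<forall>\<^sub>F n in sequentially. escape_const (\<eta> n) \<le> \<eta> n * (exp x + 2 * mesh_error x)"
    proof (intro always_eventually allI)
      fix n
      have "escape_const (\<eta> n) \<le> \<eta> n * exp x * e n x + 2 * \<eta> n * mesh_error x * escape_const (\<eta> n)"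
        using bound[OF x, of n] by linarith
      also have "\<dots> \<le> \<eta> n * exp x * 1 + 2 * \<eta> n * mesh_error x * 1"
        using \<eta>[of n] G_le_1[of n] G_nonneg[of n] mesh_error_pos[OF x] gaussian_walk.ever_hit_prob_le_1[OF walk_n, folded e_def]
        by (intro add_mono mult_left_mono) auto
      finally show "escape_const (\<eta> n) \<le> \<eta> n * (exp x + 2 * mesh_error x)" by (simp add: algebra_simps)
    qed
  qed (use G_nonneg in auto)
  then have lim0: "(\<lambda>n. 2 * (mesh_error x + mesh_error y) * escape_const (\<eta> n)) \<longlonglongrightarrow> 0"
    by (rule tendsto_mult_right_zero)
  have "(\<lambda>n. exp x * e n x - exp y * e n y) \<longlonglongrightarrow> 0"
  proof (rule Lim_null_comparison[OF _ lim0], intro always_eventually allI)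
    fix n
    have "\<bar>\<eta> n * (exp x * e n x - exp y * e n y)\<bar> \<le> \<eta> n * (2 * (mesh_error x + mesh_error y) * escape_const (\<eta> n))"
      using bound[OF x, of n] bound[OF y, of n] by (simp add: algebra_simps abs_le_iff)
    then show "norm (exp x * e n x - exp y * e n y) \<le> 2 * (mesh_error x + mesh_error y) * escape_const (\<eta> n)"
      using \<eta>[of n] by (simp add: abs_mult)
  qed
  moreover have "(\<lambda>n. exp x * e n x - exp y * e n y) \<longlonglongrightarrow> exp x * ruin_prob M B c (x / (2 * c)) - exp y * ruin_prob M B c (y / (2 * c))"
    unfolding e_def by (intro tendsto_intros walk_ever_hit_tendsto x y)
  ultimately show ?thesis using LIMSEQ_unique by fastforce
qed

text \<open>In the variable \<open>x = 2 * c * u\<close> the ruin probability is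
  \<open>C * exp (- x)\<close>. Probabilities being at most 1, letting \<open>x\<close> tend to 0
  gives \<open>C \<le> 1\<close>; the Markov property at a small time gives
  \<open>C \<ge> 1\<close>.\<close>

lemma ruin_prob_exp:
  assumes u: "u > 0" shows "ruin_prob M B c u = exp (- 2 * c * u)"
proof -
  define C where "C = exp 1 * ruin_prob M B c (1 / (2 * c))"
  have f: "ruin_prob M B c (x / (2 * c)) = C * exp (- x)" if "x > 0" for x
    using exp_ruin_prob_const[OF that, of 1] unfolding C_def by (simp add: exp_minus field_simps)
  have "C \<le> exp x" if "x > 0" for x
  proof -
    have "C * exp (- x) \<le> 1" using f[OF that] by (simp add: ruin_prob_eq flip: f[OF that])
    then show ?thesis by (simp add: exp_minus field_simps)
  qed
  moreover have "(exp \<longlongrightarrow> exp (0::real)) (at_right 0)" by (intro tendsto_intros)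
  ultimately have C_le: "C \<le> 1"
    by (intro tendsto_lowerbound[where f=exp and F="at_right (0::real)"]) 
       (auto simp: eventually_at_right_less eventually_at_filter)
  have C_nonneg: "C \<ge> 0" by (simp add: C_def ruin_prob_eq)
  \<comment> \<open>Elapsed time in walk units and level are both \<open>h\<close>. Survival below
    \<open>h\<close> then has probability \<open>1 - C * exp (- h)\<close>, and the Markov bound
    integrates to \<open>Phi (sqrt (2 * h)) - C * exp (- h) * Phi 0\<close>. As \<open>h\<close>
    tends to 0 the claim becomes \<open>1 - Phi 0 \<le> C * (1 - Phi 0)\<close>.\<close>
  have ineq: "1 - Phi (sqrt (2 * h)) \<le> C * exp (- h) * (1 - Phi 0)" if h: "h = 2 * c\<^sup>2 * (1 / 2 ^ m)" for h and m :: nat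
  proof -
    have hpos: "h > 0" using c_pos by (simp add: h)
    define p where "p = normal_density (- h) (sqrt (2 * h))"
    have p[measurable]: "p \<in> borel_measurable borel" "integrable lborel p" "p v \<ge> 0" for v
      using hpos by (auto simp: p_def)
    have p_exp: "p v * exp v = normal_density h (sqrt (2 * h)) v" for v
    proof -
      have "- (v - h)\<^sup>2 / (4 * h) = - (v + h)\<^sup>2 / (4 * h) + v"
        using hpos by (simp add: field_simps power2_eq_square)
      then have "exp (- (v - h)\<^sup>2 / (4 * h)) = exp (- (v + h)\<^sup>2 / (4 * h)) * exp v"
        by (simp only: exp_add)
      then show ?thesis using hpos by (simp add: normal_density_def p_def)
    qed
    have step_le: "1 - walk_ever_hit (1 / 2 ^ (m + n)) h
        \<le> (\<integral>v. indicator {..h} v * p v * (1 - walk_ever_hit (1 / 2 ^ (m + n)) (h - v)) \<partial>lborel)" for n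
    proof -
      \<comment> \<open>The time belonging to \<open>h\<close> is \<open>1 / 2 ^ m\<close>, which a
        grid of mesh \<open>1 / 2 ^ (m + n)\<close> reaches after \<open>2 ^ n\<close>
        steps.\<close>
      have "2 * c\<^sup>2 * (1 / 2 ^ (m + n)) * real (2 ^ n) = h" by (simp add: h power_add)
      then show ?thesis
        using gaussian_walk.ever_hit_prob_renewal[OF walk, of "1 / 2 ^ (m + n)" "2 ^ n" h] by (simp add: p_def)
    qed
    have lim: "(\<lambda>n. walk_ever_hit (1 / 2 ^ (m + n)) x) \<longlonglongrightarrow> C * exp (- x)" if "x > 0" for x
      using LIMSEQ_ignore_initial_segment[OF walk_ever_hit_tendsto[OF that], of m] f[OF that] by (simp add: add.commute)
    have int_p: "integrable lborel (\<lambda>v. indicator {..h} v * p v)"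
      by (subst mult.commute) (intro integrable_real_mult_indicator p, simp)
    have int_p': "integrable lborel (\<lambda>v. indicator {..h} v * normal_density h (sqrt (2 * h)) v)"
      using hpos by (subst mult.commute) (intro integrable_real_mult_indicator integrable_normal_density, auto)
    have "1 - C * exp (- h) \<le> (\<integral>v. indicator {..h} v * p v * (1 - C * exp (- (h - v))) \<partial>lborel)"
    proof (rule LIMSEQ_le[OF _ _ exI])
      show "(\<lambda>n. 1 - walk_ever_hit (1 / 2 ^ (m + n)) h) \<longlonglongrightarrow> 1 - C * exp (- h)"
        by (intro tendsto_intros lim hpos)
      show "(\<lambda>n. \<integral>v. indicator {..h} v * p v * (1 - walk_ever_hit (1 / 2 ^ (m + n)) (h - v)) \<partial>lborel)
          \<longlonglongrightarrow> (\<integral>v. indicator {..h} v * p v * (1 - C * exp (- (h - v))) \<partial>lborel)"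
      proof (rule integral_dominated_convergence[where w=p])
        have [measurable]: "walk_ever_hit (1 / 2 ^ (m + n)) \<in> borel_measurable borel" for n
          using gaussian_walk.measurable_ever_hit_prob[OF walk] by simp
        show "(\<lambda>v. indicator {..h} v * p v * (1 - walk_ever_hit (1 / 2 ^ (m + n)) (h - v))) \<in> borel_measurable lborel" for n
          by measurable
        show "AE v in lborel. (\<lambda>n. indicator {..h} v * p v * (1 - walk_ever_hit (1 / 2 ^ (m + n)) (h - v)))
            \<longlonglongrightarrow> indicator {..h} v * p v * (1 - C * exp (- (h - v)))"
          \<comment> \<open>The limit is known for positive levels \<open>h - v\<close>, so the
            single point \<open>v = h\<close> is left out.\<close>
          using AE_lborel_singleton[of h]
        proof eventually_elim
          case (elim v)
          show ?case
          proof (cases "v < h")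
            case True
            then show ?thesis by (intro tendsto_intros lim) simp
          qed (use elim in simp)
        qed
        show "AE v in lborel. norm (indicator {..h} v * p v * (1 - walk_ever_hit (1 / 2 ^ (m + n)) (h - v))) \<le> p v" for n
        proof (rule AE_I2)
          fix v
          have "0 \<le> walk_ever_hit (1 / 2 ^ (m + n)) (h - v)" "walk_ever_hit (1 / 2 ^ (m + n)) (h - v) \<le> 1"
            using gaussian_walk.ever_hit_prob_nonneg[OF walk] gaussian_walk.ever_hit_prob_le_1[OF walk] by simp_all
          then show "norm (indicator {..h} v * p v * (1 - walk_ever_hit (1 / 2 ^ (m + n)) (h - v))) \<le> p v"
            using p(3)[of v] by (simp add: indicator_def abs_mult mult_left_le)
        qed
      qed (use p in measurable)
      show "\<forall>n\<ge>0. 1 - walk_ever_hit (1 / 2 ^ (m + n)) h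
        \<le> (\<integral>v. indicator {..h} v * p v * (1 - walk_ever_hit (1 / 2 ^ (m + n)) (h - v)) \<partial>lborel)"
        using step_le by blast
    qed
    also have "\<dots> = (\<integral>v. indicator {..h} v * p v - C * exp (- h) * (indicator {..h} v * normal_density h (sqrt (2 * h)) v) \<partial>lborel)"
    proof (rule Bochner_Integration.integral_cong[OF refl])
      fix v
      have "exp (- (h - v)) = exp (- h) * exp v" by (simp flip: exp_add)
      then show "indicator {..h} v * p v * (1 - C * exp (- (h - v)))
          = indicator {..h} v * p v - C * exp (- h) * (indicator {..h} v * normal_density h (sqrt (2 * h)) v)"
        unfolding p_exp[symmetric] by (simp add: algebra_simps)
    qed
    also have "\<dots> = Phi ((h - - h) / sqrt (2 * h)) - C * exp (- h) * Phi ((h - h) / sqrt (2 * h))"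
      using int_p int_p' hpos by (simp add: integral_normal_density_atMost p_def)
    also have "(h - - h) / sqrt (2 * h) = sqrt (2 * h)"
      using hpos by (simp add: real_div_sqrt)
    finally show ?thesis by (simp add: algebra_simps)
  qed
  have hlim: "(\<lambda>m. 2 * c\<^sup>2 * (1 / 2 ^ m)) \<longlonglongrightarrow> 0" by real_asymp
  have "1 - Phi (sqrt (2 * 0)) \<le> C * exp (- 0) * (1 - Phi 0)"
  proof (rule LIMSEQ_le[OF _ _ exI])
    show "(\<lambda>m. 1 - Phi (sqrt (2 * (2 * c\<^sup>2 * (1 / 2 ^ m))))) \<longlonglongrightarrow> 1 - Phi (sqrt (2 * 0))"
      by (intro tendsto_intros isCont_tendsto_compose[OF isCont_Phi] hlim)
    show "(\<lambda>m. C * exp (- (2 * c\<^sup>2 * (1 / 2 ^ m))) * (1 - Phi 0)) \<longlonglongrightarrow> C * exp (- 0) * (1 - Phi 0)"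
      by (intro tendsto_intros hlim)
    show "\<forall>m\<ge>0. 1 - Phi (sqrt (2 * (2 * c\<^sup>2 * (1 / 2 ^ m)))) \<le> C * exp (- (2 * c\<^sup>2 * (1 / 2 ^ m))) * (1 - Phi 0)"
      using ineq by blast
  qed
  moreover have "Phi 0 < 1"
    using Phi_strict_mono[of 0 1] std_normal.cdf_bounded_prob[of 1] by linarith
  ultimately have "C \<ge> 1" by (simp add: mult_le_cancel_right1)
  with C_le have "C = 1" by simp
  then show ?thesis
    using f[of "2 * c * u"] u c_pos by simp
qed

section \<open>The discrete ruin time\<close>

lemma discrete_ruin_time_less_top_iff:
  "discrete_ruin_time B c \<delta> u \<omega> < \<infinity> \<longleftrightarrow> (\<exists>k::nat. B (\<delta> * real k) \<omega> - c * (\<delta> * real k) > u)"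
proof -
  have "discrete_ruin_time B c \<delta> u \<omega> < \<infinity> \<longleftrightarrow> (\<exists>t\<in>grid \<delta>. B t \<omega> - c * t > u)"
    unfolding discrete_ruin_time_def Inf_less_iff by (simp add: Bex_def)
  then show ?thesis by (simp add: grid_def)
qed

text \<open>\<open>real_of_ereal\<close> maps infinity to 0, so finiteness has to be stated
  separately. When finite, the infimum is attained at the least grid index at which the level is
  exceeded.\<close>

lemma discrete_ruin_time_le_iff:
  assumes \<delta>: "\<delta> > 0"
  shows "discrete_ruin_time B c \<delta> u \<omega> < \<infinity> \<and> real_of_ereal (discrete_ruin_time B c \<delta> u \<omega>) \<le> T
    \<longleftrightarrow> (\<exists>k::nat. \<delta> * real k \<le> T \<and> B (\<delta> * real k) \<omega> - c * (\<delta> * real k) > u)"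
proof (cases "\<exists>k::nat. B (\<delta> * real k) \<omega> - c * (\<delta> * real k) > u")
  case False
  then show ?thesis unfolding discrete_ruin_time_less_top_iff by blast
next
  case True
  define P where "P k \<longleftrightarrow> B (\<delta> * real k) \<omega> - c * (\<delta> * real k) > u" for k :: nat
  define k0 where "k0 = (LEAST k. P k)"
  have "\<exists>k. P k" unfolding P_def by (rule True)
  then have Pk0: "P k0" unfolding k0_def by (rule LeastI_ex)
  have k0_le: "k0 \<le> k" if "P k" for k unfolding k0_def using that by (rule Least_le)
  have "discrete_ruin_time B c \<delta> u \<omega> = ereal (\<delta> * real k0)"
    unfolding discrete_ruin_time_def
  proof (rule antisym)
    show "Inf (ereal ` {t \<in> grid \<delta>. u < B t \<omega> - c * t}) \<le> ereal (\<delta> * real k0)"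
      using Pk0 by (intro Inf_lower imageI) (auto simp: P_def grid_def)
    show "ereal (\<delta> * real k0) \<le> Inf (ereal ` {t \<in> grid \<delta>. u < B t \<omega> - c * t})"
    proof (rule Inf_greatest)
      fix z assume "z \<in> ereal ` {t \<in> grid \<delta>. u < B t \<omega> - c * t}"
      then obtain k where "z = ereal (\<delta> * real k)" "P k" by (auto simp: grid_def P_def)
      then show "ereal (\<delta> * real k0) \<le> z" using \<delta> k0_le[of k] by simp
    qed
  qed
  moreover have "\<delta> * real k0 \<le> T \<longleftrightarrow> (\<exists>k. \<delta> * real k \<le> T \<and> P k)"
  proof
    assume "\<exists>k. \<delta> * real k \<le> T \<and> P k"
    then obtain k where k: "\<delta> * real k \<le> T" "P k" by blast
    have "\<delta> * real k0 \<le> \<delta> * real k" using \<delta> k0_le[OF k(2)] by simp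
    with k(1) show "\<delta> * real k0 \<le> T" by simp
  qed (use Pk0 in blast)
  ultimately show ?thesis by (simp add: P_def)
qed

text \<open>In walk units, with level \<open>x = 2 * c * u\<close> and clock
  \<open>2 * c\<^sup>2 * t\<close>, the normalisation becomes a deviation of \<open>s\<close> times
  \<open>sqrt (2 * x)\<close>. The two inequalities differ by the factor
  \<open>2 * sqrt c * sqrt u\<close>.\<close>

lemma scaled_time_le_iff:
  assumes u: "u > 0"
  shows "c powr (3/2) * (t - u / c) / sqrt u \<le> s \<longleftrightarrow> 2 * c\<^sup>2 * t \<le> 2 * c * u + s * sqrt (2 * (2 * c * u))"
proof -
  have powr: "c powr (3/2) = c * sqrt c"
    using c_pos powr_add[of c 1 "1/2"] by (simp add: powr_half_sqrt)
  have sq: "sqrt (2 * (2 * c * u)) = 2 * (sqrt c * sqrt u)"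
    by (simp add: real_sqrt_mult)
  have pos: "sqrt c > 0" "sqrt u > 0" "sqrt c * sqrt c = c" using c_pos u by auto
  have "c powr (3/2) * (t - u / c) / sqrt u \<le> s \<longleftrightarrow> c * sqrt c * (t - u / c) \<le> s * sqrt u"
    unfolding powr by (rule pos_divide_le_eq[OF pos(2)])
  also have "\<dots> \<longleftrightarrow> 2 * sqrt c * (c * sqrt c * (t - u / c)) \<le> 2 * sqrt c * (s * sqrt u)"
    by (rule mult_le_cancel_left_pos[symmetric]) (use pos in simp)
  also have "2 * sqrt c * (c * sqrt c * (t - u / c)) = 2 * c * (sqrt c * sqrt c) * (t - u / c)"
    by (simp add: mult_ac)
  also have "\<dots> = 2 * c\<^sup>2 * t - 2 * c * u"
    using c_pos unfolding pos(3) by (simp add: field_simps power2_eq_square)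
  finally show ?thesis unfolding sq by (simp add: algebra_simps)
qed

text \<open>By \<open>ruin_prob_exp\<close> the ratio is a multiple of
  \<open>\<eta> * exp x * ever_hit_prob x\<close> at \<open>x = 2 * c * u\<close>, whose limit
  \<open>escape_const \<eta>\<close> is \<open>\<eta>\<close> times the Pickands constant.\<close>

lemma discrete_ruin_prob_asymp:
  assumes \<delta>: "\<delta> > 0" and N: "two_sided_brownian_motion N B'"
  shows "discrete_ruin_prob M B c \<delta> \<sim>[at_top] (\<lambda>u. pickands_constant N B' (2 * c\<^sup>2 * \<delta>) * ruin_prob M B c u)"
proof (rule asymp_equivI')
  define \<eta> where "\<eta> = 2 * c\<^sup>2 * \<delta>"
  have \<eta>: "\<eta> > 0" using c_pos \<delta> by (simp add: \<eta>_def)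
  interpret walk: gaussian_walk M "step \<delta>" \<eta> unfolding \<eta>_def by (rule walk[OF \<delta>])
  have grid: "two_sided_grid N B' \<eta>"
    using N \<eta> by (intro two_sided_grid.intro two_sided_grid_axioms.intro)
  define H where "H = pickands_constant N B' \<eta>"
  have H: "H > 0" "escape_const \<eta> = \<eta> * H"
    unfolding H_def
    by (rule two_sided_grid.pickands_constant_pos[OF grid], rule two_sided_grid.escape_const_eq_pickands[OF grid])
  have lim: "filterlim (\<lambda>u. 2 * c * u) at_top at_top"
    using c_pos by real_asymp
  have "((\<lambda>u. \<eta> * exp (2 * c * u) * walk.ever_hit_prob (2 * c * u) / (\<eta> * H)) \<longlongrightarrow> \<eta> * H / (\<eta> * H)) at_top"
    using \<eta> H filterlim_compose[OF walk.exp_ever_hit_prob_tendsto lim] by (intro tendsto_divide) auto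
  then have "((\<lambda>u. \<eta> * exp (2 * c * u) * walk.ever_hit_prob (2 * c * u) / (\<eta> * H)) \<longlongrightarrow> 1) at_top"
    using \<eta> H(1) by simp
  then show "((\<lambda>u. discrete_ruin_prob M B c \<delta> u / (pickands_constant N B' (2 * c\<^sup>2 * \<delta>) * ruin_prob M B c u)) \<longlongrightarrow> 1) at_top"
  proof (rule Lim_transform_eventually)
    show "\<forall>\<^sub>F u in at_top. \<eta> * exp (2 * c * u) * walk.ever_hit_prob (2 * c * u) / (\<eta> * H)
        = discrete_ruin_prob M B c \<delta> u / (pickands_constant N B' (2 * c\<^sup>2 * \<delta>) * ruin_prob M B c u)"
      using eventually_gt_at_top[of 0]
    proof eventually_elim
      case (elim u)
      show ?case
        using \<eta> H(1) elim unfolding \<eta>_def[symmetric] H_def[symmetric]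
        by (simp add: discrete_ruin_prob_eq[OF \<delta>] ruin_prob_exp exp_minus divide_simps)
    qed
  qed
qed

text \<open>Ruin by the rescaled time is a hit within the first \<open>n x\<close> steps, so the
  conditional probability is a ratio of \<open>hit_prob\<close> and \<open>ever_hit_prob\<close>.
  Multiplied by \<open>\<eta> * exp x\<close>, both have limits that share the factor
  \<open>escape_const \<eta>\<close>.\<close>

lemma conditional_ruin_time_tendsto:
  assumes \<delta>: "\<delta> > 0" and G: "escape_const (2 * c\<^sup>2 * \<delta>) > 0"
  shows "((\<lambda>u. \<P>(\<omega> in M. c powr (3/2) * (real_of_ereal (discrete_ruin_time B c \<delta> u \<omega>) - u / c) / sqrt u \<le> s
           \<bar> discrete_ruin_time B c \<delta> u \<omega> < \<infinity>)) \<longlongrightarrow> Phi s) at_top"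
proof -
  define \<eta> where "\<eta> = 2 * c\<^sup>2 * \<delta>"
  have \<eta>: "\<eta> > 0" using c_pos \<delta> by (simp add: \<eta>_def)
  interpret walk: gaussian_walk M "step \<delta>" \<eta> unfolding \<eta>_def by (rule walk[OF \<delta>])
  define z where "z x = x + s * sqrt (2 * x)" for x :: real
  \<comment> \<open>\<open>nat\<close> truncates a negative value to 0, so the equivalence
    \<open>le_n_iff\<close> requires \<open>z x \<ge> 0\<close>, which holds for all large
    \<open>x\<close>.\<close>
  define n where "n x = nat \<lfloor>z x / \<eta>\<rfloor>" for x
  have z_top: "filterlim z at_top at_top" unfolding z_def by real_asymp
  have z_nonneg: "eventually (\<lambda>x. z x \<ge> 0) at_top"
    using z_top by (auto simp: filterlim_at_top)
  have le_n_iff: "k \<le> n x \<longleftrightarrow> \<eta> * real k \<le> z x" if "z x \<ge> 0" for k x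
  proof -
    have "k \<le> n x \<longleftrightarrow> real k \<le> z x / \<eta>"
      unfolding n_def using that \<eta> by (simp add: le_nat_iff le_floor_iff)
    then show ?thesis using \<eta> by (simp add: pos_le_divide_eq mult.commute)
  qed
  have n_lim: "((\<lambda>x. (\<eta> * real (n x) - x) / sqrt (2 * x)) \<longlongrightarrow> s) at_top"
  proof (rule tendsto_sandwich[OF _ _ _ tendsto_const])
    have "((\<lambda>x. s - \<eta> / sqrt (2 * x)) \<longlongrightarrow> s - 0) at_top"
      by (intro tendsto_intros) real_asymp
    then show "((\<lambda>x. s - \<eta> / sqrt (2 * x)) \<longlongrightarrow> s) at_top" by simp
    show "\<forall>\<^sub>F x in at_top. s - \<eta> / sqrt (2 * x) \<le> (\<eta> * real (n x) - x) / sqrt (2 * x)"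
      using z_nonneg eventually_gt_at_top[of 0]
    proof eventually_elim
      case (elim x)
      \<comment> \<open>Rounding down loses less than one step, an error of \<open>\<eta>\<close>
        that is negligible against \<open>sqrt (2 * x)\<close>.\<close>
      have "\<not> Suc (n x) \<le> n x" by simp
      then have "z x < \<eta> * real (Suc (n x))" unfolding le_n_iff[OF elim(1)] by simp
      then have "s * sqrt (2 * x) - \<eta> \<le> \<eta> * real (n x) - x" by (simp add: z_def algebra_simps)
      then have "(s * sqrt (2 * x) - \<eta>) / sqrt (2 * x) \<le> (\<eta> * real (n x) - x) / sqrt (2 * x)"
        using elim by (intro divide_right_mono) auto
      then show ?case using elim by (simp add: diff_divide_distrib)
    qed
    show "\<forall>\<^sub>F x in at_top. (\<eta> * real (n x) - x) / sqrt (2 * x) \<le> s"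
      using z_nonneg eventually_gt_at_top[of 0]
    proof eventually_elim
      case (elim x)
      have "\<eta> * real (n x) \<le> z x" using le_n_iff[OF elim(1), of "n x"] by simp
      then have "\<eta> * real (n x) - x \<le> s * sqrt (2 * x)" by (simp add: z_def)
      then show ?case using elim by (simp add: pos_divide_le_eq)
    qed
  qed
  have lim: "filterlim (\<lambda>u. 2 * c * u) at_top at_top"
    using c_pos by real_asymp
  have "((\<lambda>u. (\<eta> * exp (2 * c * u) * walk.hit_prob (n (2 * c * u)) (2 * c * u)) / (\<eta> * exp (2 * c * u) * walk.ever_hit_prob (2 * c * u)))
      \<longlongrightarrow> Phi s * escape_const \<eta> / escape_const \<eta>) at_top"
    using G unfolding \<eta>_def[symmetric]
    by (intro tendsto_divide filterlim_compose[OF walk.exp_hit_prob_tendsto[OF n_lim] lim]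
        filterlim_compose[OF walk.exp_ever_hit_prob_tendsto lim]) auto
  then have "((\<lambda>u. walk.hit_prob (n (2 * c * u)) (2 * c * u) / walk.ever_hit_prob (2 * c * u)) \<longlongrightarrow> Phi s) at_top"
    using G \<eta> unfolding \<eta>_def[symmetric] by simp
  then show ?thesis
  proof (rule Lim_transform_eventually)
    show "\<forall>\<^sub>F u in at_top. walk.hit_prob (n (2 * c * u)) (2 * c * u) / walk.ever_hit_prob (2 * c * u)
      = \<P>(\<omega> in M. c powr (3/2) * (real_of_ereal (discrete_ruin_time B c \<delta> u \<omega>) - u / c) / sqrt u \<le> s
           \<bar> discrete_ruin_time B c \<delta> u \<omega> < \<infinity>)"
      using eventually_compose_filterlim[OF z_nonneg lim] eventually_gt_at_top[of 0]
    proof eventually_elim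
      case (elim u)
      have event: "c powr (3/2) * (real_of_ereal (discrete_ruin_time B c \<delta> u \<omega>) - u / c) / sqrt u \<le> s
            \<and> discrete_ruin_time B c \<delta> u \<omega> < \<infinity>
          \<longleftrightarrow> (\<exists>k\<le>n (2 * c * u). B (\<delta> * real k) \<omega> - c * (\<delta> * real k) > u)" for \<omega>
      proof -
        have "2 * c\<^sup>2 * t \<le> z (2 * c * u) \<longleftrightarrow> t \<le> z (2 * c * u) / (2 * c\<^sup>2)" for t
          using c_pos by (simp add: pos_le_divide_eq mult.commute)
        then have "c powr (3/2) * (t - u / c) / sqrt u \<le> s \<longleftrightarrow> t \<le> z (2 * c * u) / (2 * c\<^sup>2)" for t
          using scaled_time_le_iff[OF elim(2)] by (simp add: z_def)
        moreover have "\<delta> * real k \<le> z (2 * c * u) / (2 * c\<^sup>2) \<longleftrightarrow> k \<le> n (2 * c * u)" for k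
          unfolding le_n_iff[OF elim(1)] using c_pos by (simp add: pos_le_divide_eq \<eta>_def mult_ac)
        ultimately show ?thesis
          using discrete_ruin_time_le_iff[OF \<delta>, of u \<omega> "z (2 * c * u) / (2 * c\<^sup>2)"] by auto
      qed
      have "\<P>(\<omega> in M. \<exists>k\<le>n (2 * c * u). B (\<delta> * real k) \<omega> - c * (\<delta> * real k) > u) = walk.hit_prob (n (2 * c * u)) (2 * c * u)"
        unfolding walk.hit_prob_def
      proof (rule prob_eq_AE)
        show "AE \<omega> in M. (\<exists>k\<le>n (2 * c * u). B (\<delta> * real k) \<omega> - c * (\<delta> * real k) > u) \<longleftrightarrow> (\<exists>j\<in>{1..n (2 * c * u)}. walk.V j \<omega> > 2 * c * u)"
          using B_zero
        proof eventually_elim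
          case (elim \<omega>)
          \<comment> \<open>Index 0 is excluded because the path starts at 0, below
            \<open>u\<close>; \<open>hit_prob\<close> begins with index 1.\<close>
          have "k \<noteq> 0" if "B (\<delta> * real k) \<omega> - c * (\<delta> * real k) > u" for k
            using that elim \<open>u > 0\<close> by (cases k) auto
          then show ?case
            unfolding walk_V_gt_iff[OF \<delta> elim] by (force simp: Suc_le_eq)
        qed
      qed (use \<delta> in measurable)
      moreover have "\<P>(\<omega> in M. discrete_ruin_time B c \<delta> u \<omega> < \<infinity>) = walk.ever_hit_prob (2 * c * u)"
        unfolding discrete_ruin_time_less_top_iff
        using discrete_ruin_prob_eq[OF \<delta> elim(2)] by (simp add: discrete_ruin_prob_eq_grid)
      ultimately show ?case
        unfolding cond_prob_def event by simp
    qed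
  qed
qed

end

theorem theorem1p1:
  fixes M :: "'a measure" and B :: "real \<Rightarrow> 'a \<Rightarrow> real"
    and N :: "'b measure" and B' :: "real \<Rightarrow> 'b \<Rightarrow> real"
    and c \<delta> :: real
  assumes "standard_brownian_motion M B"
    and "two_sided_brownian_motion N B'"
    and "c > 0" and "\<delta> > 0"
  shows "((\<lambda>u. discrete_ruin_prob M B c \<delta> u)
            \<sim>[at_top] (\<lambda>u. pickands_constant N B' (2 * c\<^sup>2 * \<delta>) * ruin_prob M B c u)) \<and>
         (\<forall>s::real.
           ((\<lambda>u::real. \<P>(\<omega> in M.
               c powr (3/2) * (real_of_ereal (discrete_ruin_time B c \<delta> u \<omega>) - u / c) / sqrt u \<le> s
               \<bar> discrete_ruin_time B c \<delta> u \<omega> < \<infinity>))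
             \<longlongrightarrow> cdf std_normal_distribution s) at_top)"
proof -
  interpret risk_model M B c
    using assms(1,3) by (intro risk_model.intro risk_model_axioms.intro)
  have \<eta>: "2 * c\<^sup>2 * \<delta> > 0" using assms(3,4) by simp
  then have "two_sided_grid N B' (2 * c\<^sup>2 * \<delta>)"
    using assms(2) by (intro two_sided_grid.intro two_sided_grid_axioms.intro)
  \<comment> \<open>The two Brownian motions live on unrelated spaces; they meet in
    \<open>escape_const\<close>, which depends on the mesh parameter alone.\<close>
  note grid = two_sided_grid.escape_const_eq_pickands[OF this] two_sided_grid.pickands_constant_pos[OF this]
  have "escape_const (2 * c\<^sup>2 * \<delta>) > 0"
    unfolding grid(1) using \<eta> grid(2) by (rule mult_pos_pos)
  with discrete_ruin_prob_asymp[OF assms(4,2)] conditional_ruin_time_tendsto[OF assms(4)]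
  show ?thesis by blast
qed

end
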